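(* Let $p$ be an odd prime, $X=R_p$ the dihedral quandle, and write $H^n(M)=H^n(X;X;\mathbf F_p)$. There exist classes $A_m\in H^{2m}(M)$ ($m\ge 0$, with $A_0=\mathbf 1$) and $B\in H^3(M)$ such that the elements $$A_{m_1}\cup B^{e_1}\cup P\bigl(A_{m_2}\cup B^{e_2}\cup P(\cdots P(A_{m_s}\cup B^{e_s})\cdots)\bigr),$$ indexed by all finite sequences $((m_1,e_1),\dots,(m_s,e_s))$ with $s\ge 1$, $m_i\in\{0,1,2,\dots\}$, $e_i\in\{0,1\}$ (so that $P$ is applied $s-1$ times), form a basis of the $\mathbf F_p$-vector space $\bigoplus_n H^n(M)$ (distinct sequences giving distinct basis elements).
   Context: $R_p$ is the set $\mathbf Z/p$ with operation $a*b=2b-a$. For a rack $X$ (acting on itself by $*$), $C_n(X;X)$ is the free abelian group on symbols $(y;x_1,\dots,x_n)$ with $y,x_i\in X$, and $\partial=\sum_{i=1}^n(-1)^i(\delta^0_i-\delta^1_i)$, where $\delta^0_i(y;x_1,\dots,x_n)=(y;x_1,\dots,x_{i-1},x_{i+1},\dots,x_n)$ and $\delta^1_i(y;x_1,\dots,x_n)=(y*x_i;x_1*x_i,\dots,x_{i-1}*x_i,x_{i+1},\dots,x_n)$. $H^n(X;X;\mathbf F_p)$ is the cohomology of the complex $C^n(X;X;\mathbf F_p)=\mathrm{Hom}(C_n(X;X),\mathbf F_p)$. Cup product: for $f\in C^k$, $g\in C^m$, $n=k+m$, and $z=(y;x_1,\dots,x_n)$, $(f\cup g)(z)=(-1)^{km}\sum_A\epsilon(A)f(\delta^0_Az)g(\delta^1_Bz)$,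 the sum running over subsets $A=\{a_1<\dots<a_m\}$ of $\{1,\dots,n\}$ with complement $B=\{b_1<\dots<b_k\}$; $\epsilon(A)$ is the sign of the permutation sending $(1,\dots,n)$ to $(b_1,\dots,b_k,a_1,\dots,a_m)$, $\delta^0_A=\delta^0_{a_1}\circ\dots\circ\delta^0_{a_m}$, and $\delta^1_B=\delta^1_{b_1}\circ\dots\circ\delta^1_{b_k}$. This makes $\bigoplus_nH^n(X;X;\mathbf F_p)$ a graded ring with unit $\mathbf 1$, the class of the $0$-cochain with constant value $1$; $B^0=\mathbf 1$, $B^1=B$. The operator $P\colon H^k(X;X;\mathbf F_p)\to H^{k+1}(X;X;\mathbf F_p)$ is induced by the cochain operator $(PF)(x_0;x_1,\dots,x_{k+1})=(-1)^kF(x_1;x_2,\dots,x_{k+1})$. *)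

theory Defs
  imports
    "Berlekamp_Zassenhaus.Finite_Field"
    "HOL-Combinatorics.Permutations"
    "HOL-Library.Poly_Mapping"
    "HOL-Library.Function_Algebras"
begin

section \<open>Racks and dihedral quandles\<close>

class rack =
  fixes rack_op :: "'a \<Rightarrow> 'a \<Rightarrow> 'a"  (infixl "\<triangleright>" 70)
  assumes rack_distrib: "(a \<triangleright> b) \<triangleright> c = (a \<triangleright> c) \<triangleright> (b \<triangleright> c)"
    and rack_bij: "bij (\<lambda>a. a \<triangleright> b)"

text \<open>With \<open>p = CARD('p)\<close>, the type \<open>'p mod_ring\<close> is the ring of integers modulo \<open>p\<close>;
  as a rack it is the dihedral quandle \<open>R\<^sub>p\<close>.\<close>

instantiation mod_ring :: (nontriv) rack
begin

definition rack_op_mod_ring :: "'a mod_ring \<Rightarrow> 'a mod_ring \<Rightarrow> 'a mod_ring" where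
  "(a :: 'a mod_ring) \<triangleright> b = 2 * b - a"

instance
proof
  fix a b c :: "'a mod_ring"
  show "(a \<triangleright> b) \<triangleright> c = (a \<triangleright> c) \<triangleright> (b \<triangleright> c)"
    by (simp add: rack_op_mod_ring_def algebra_simps)
  show "bij (\<lambda>a. a \<triangleright> b)"
    by (rule o_bij[of "\<lambda>a. a \<triangleright> b"]) (auto simp: rack_op_mod_ring_def fun_eq_iff)
qed

end

section \<open>The rack complex with coefficients in the rack itself\<close>

text \<open>The symbol \<open>(y; x\<^sub>1, \<dots>, x\<^sub>n)\<close> is \<open>(y, [x\<^sub>1, \<dots>, x\<^sub>n])\<close>. Face indices start at 1 and list
  indices at 0.\<close>

type_synonym 'x symbol = "'x \<times> 'x list"

abbreviation symdeg :: "'x symbol \<Rightarrow> nat" where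
  "symdeg z \<equiv> length (snd z)"

definition face0 :: "nat \<Rightarrow> 'x symbol \<Rightarrow> 'x symbol" where
  "face0 i z = (fst z, take (i - 1) (snd z) @ drop i (snd z))"

definition face1 :: "nat \<Rightarrow> 'x::rack symbol \<Rightarrow> 'x symbol" where
  "face1 i z = (let x = snd z ! (i - 1) in
     (fst z \<triangleright> x, map (\<lambda>u. u \<triangleright> x) (take (i - 1) (snd z)) @ drop i (snd z)))"

definition rack_boundary :: "'x::rack symbol \<Rightarrow> ('x symbol \<Rightarrow>\<^sub>0 int)" where
  "rack_boundary z =
     (\<Sum>i = 1..symdeg z. frag_cmul ((-1) ^ i) (frag_of (face0 i z) - frag_of (face1 i z)))"

text \<open>A homomorphism from the free abelian group on the symbols is given by its values on the
  symbols; \<open>eval_chain f\<close> is the homomorphism extending \<open>f\<close>.\<close>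

definition eval_chain :: "('s \<Rightarrow> 'k::comm_ring_1) \<Rightarrow> ('s \<Rightarrow>\<^sub>0 int) \<Rightarrow> 'k" where
  "eval_chain f c = (\<Sum>s\<in>Poly_Mapping.keys c. of_int (Poly_Mapping.lookup c s) * f s)"

definition rack_coboundary :: "('x::rack symbol \<Rightarrow> 'k::comm_ring_1) \<Rightarrow> 'x symbol \<Rightarrow> 'k" where
  "rack_coboundary f z = eval_chain f (rack_boundary z)"

text \<open>An \<open>n\<close>-cochain is extended by 0 to symbols of degree other than \<open>n\<close>, so that a function on
  all symbols is a family of cochains, one in each degree.\<close>

definition cochains :: "nat \<Rightarrow> ('x symbol \<Rightarrow> 'k::zero) set" where
  "cochains n = {f. \<forall>z. symdeg z \<noteq> n \<longrightarrow> f z = 0}"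

definition cocycles :: "nat \<Rightarrow> ('x::rack symbol \<Rightarrow> 'k::comm_ring_1) set" where
  "cocycles n = {f \<in> cochains n. rack_coboundary f = 0}"

definition coboundaries :: "nat \<Rightarrow> ('x::rack symbol \<Rightarrow> 'k::comm_ring_1) set" where
  "coboundaries n = (if n = 0 then {0} else rack_coboundary ` cochains (n - 1))"

definition component :: "nat \<Rightarrow> ('x symbol \<Rightarrow> 'k::zero) \<Rightarrow> 'x symbol \<Rightarrow> 'k" where
  "component n f z = (if symdeg z = n then f z else 0)"

section \<open>Products of cochains\<close>

definition face0_set :: "nat set \<Rightarrow> 'x symbol \<Rightarrow> 'x symbol" where
  "face0_set A = foldr face0 (sorted_list_of_set A)"

definition face1_set :: "nat set \<Rightarrow> 'x::rack symbol \<Rightarrow> 'x symbol" where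
  "face1_set B = foldr face1 (sorted_list_of_set B)"

definition shuffle_perm :: "nat \<Rightarrow> nat set \<Rightarrow> nat \<Rightarrow> nat" where
  "shuffle_perm n A i =
     (if i \<in> {1..n}
      then (sorted_list_of_set ({1..n} - A) @ sorted_list_of_set A) ! (i - 1) else i)"

definition shuffle_sign :: "nat \<Rightarrow> nat set \<Rightarrow> int" where
  "shuffle_sign n A = sign (shuffle_perm n A)"

text \<open>The sum runs over subsets of all cardinalities \<open>m\<close>: this is the biadditive extension
  to families of cochains, since the term of \<open>A\<close> only involves the component of \<open>f\<close> of
  degree \<open>k = n - m\<close> and that of \<open>g\<close> of degree \<open>m\<close>.\<close>

definition cochain_cup ::
  "('x::rack symbol \<Rightarrow> 'k::comm_ring_1) \<Rightarrow> ('x symbol \<Rightarrow> 'k) \<Rightarrow> 'x symbol \<Rightarrow> 'k" where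
  "cochain_cup f g z =
     (let n = symdeg z in
      \<Sum>A\<in>Pow {1..n}. (-1) ^ ((n - card A) * card A) * of_int (shuffle_sign n A)
         * f (face0_set A z) * g (face1_set ({1..n} - A) z))"

definition cochain_one :: "'x symbol \<Rightarrow> 'k::zero_neq_one" where
  "cochain_one z = (if symdeg z = 0 then 1 else 0)"

text \<open>If \<open>symdeg z = k + 1\<close>, then \<open>F\<close> is evaluated at a symbol of degree \<open>k\<close>.\<close>

definition cochain_P :: "('x symbol \<Rightarrow> 'k::comm_ring_1) \<Rightarrow> 'x symbol \<Rightarrow> 'k" where
  "cochain_P F z = (case snd z of [] \<Rightarrow> 0 | x # xs \<Rightarrow> (-1) ^ length xs * F (x, xs))"

section \<open>Leibniz rule\<close>

subsection \<open>Coboundaries\<close>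

lemma eval_chain_superset:
  assumes "finite S" "Poly_Mapping.keys c \<subseteq> S"
  shows "eval_chain f c = (\<Sum>s\<in>S. of_int (Poly_Mapping.lookup c s) * f s)"
  unfolding eval_chain_def
  by (rule sum.mono_neutral_left) (use assms in \<open>auto simp: in_keys_iff\<close>)

lemma eval_chain_zero [simp]: "eval_chain f 0 = 0"
  by (simp add: eval_chain_def)

lemma eval_chain_add: "eval_chain f (a + b) = eval_chain f a + eval_chain f b"
proof -
  let ?S = "Poly_Mapping.keys a \<union> Poly_Mapping.keys b"
  have "Poly_Mapping.keys (a + b) \<subseteq> ?S" by (rule Poly_Mapping.keys_add)
  then show ?thesis
    by (subst (1 2 3) eval_chain_superset[where S = ?S])
      (auto simp: lookup_add algebra_simps sum.distrib)
qed

lemma eval_chain_cmul: "eval_chain f (frag_cmul k a) = of_int k * eval_chain f a"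
proof -
  have "Poly_Mapping.keys (frag_cmul k a) \<subseteq> Poly_Mapping.keys a" by (rule keys_cmul)
  then show ?thesis
    by (subst (1 2) eval_chain_superset[where S = "Poly_Mapping.keys a"])
      (auto simp: sum_distrib_left algebra_simps)
qed

lemma eval_chain_of [simp]: "eval_chain f (frag_of s) = f s"
  by (simp add: eval_chain_def)

lemma eval_chain_diff: "eval_chain f (a - b) = eval_chain f a - eval_chain f b"
proof -
  have "a - b + b = a" by simp
  then show ?thesis by (metis eval_chain_add add_diff_cancel_right')
qed

lemma eval_chain_sum: "eval_chain f (\<Sum>i\<in>I. c i) = (\<Sum>i\<in>I. eval_chain f (c i))"
  by (induction I rule: infinite_finite_induct) (auto simp: eval_chain_add)

lemma rack_coboundary_eq:
  "rack_coboundary f z = (\<Sum>i = 1..symdeg z. (-1) ^ i * (f (face0 i z) - f (face1 i z)))"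
  by (simp add: rack_coboundary_def rack_boundary_def eval_chain_sum eval_chain_cmul eval_chain_diff)

lemma symdeg_face [simp]:
  "i \<in> {1..symdeg z} \<Longrightarrow> symdeg (face0 i z) = symdeg z - 1"
  "i \<in> {1..symdeg z} \<Longrightarrow> symdeg (face1 i z) = symdeg z - 1"
  by (auto simp: face0_def face1_def Let_def)

lemma rack_coboundary_add: "rack_coboundary (\<lambda>z. f z + g z) z = rack_coboundary f z + rack_coboundary g z"
  by (simp add: rack_coboundary_eq sum.distrib[symmetric] algebra_simps)

lemma rack_coboundary_cmul: "rack_coboundary (\<lambda>z. c * f z) z = c * rack_coboundary f z"
  by (simp add: rack_coboundary_eq sum_distrib_left algebra_simps)

lemma rack_coboundary_cong:
  assumes "\<And>w. Suc (symdeg w) = symdeg z \<Longrightarrow> f w = g w"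
  shows "rack_coboundary f z = rack_coboundary g z"
proof -
  have "f (face0 i z) = g (face0 i z)" "f (face1 i z) = g (face1 i z)" if "i \<in> {1..symdeg z}" for i
    using assms[of "face0 i z"] assms[of "face1 i z"] symdeg_face[OF that] that by auto
  then show ?thesis unfolding rack_coboundary_eq by (intro sum.cong refl) simp
qed

lemma rack_coboundary_zero [simp]: "rack_coboundary 0 = 0"
  by (simp add: rack_coboundary_eq fun_eq_iff)

lemma rack_coboundary_plus: "rack_coboundary (f + g) = rack_coboundary f + rack_coboundary g"
  by (simp add: fun_eq_iff rack_coboundary_add[symmetric] plus_fun_def)

lemma rack_coboundary_scale: "rack_coboundary (\<lambda>z. c * f z) = (\<lambda>z. c * rack_coboundary f z)"
  by (simp add: fun_eq_iff rack_coboundary_cmul)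

lemma rack_coboundary_uminus: "rack_coboundary (- f) = - rack_coboundary f"
  using rack_coboundary_scale[of "-1" f] by (simp add: fun_eq_iff fun_Compl_def)

lemma rack_coboundary_minus: "rack_coboundary (f - g) = rack_coboundary f - rack_coboundary g"
  using rack_coboundary_plus[of f "- g"] by (simp add: rack_coboundary_uminus)

lemma rack_coboundary_alternate:
  "rack_coboundary (\<lambda>w. (-1) ^ symdeg w * f w) z = - ((-1) ^ symdeg z * rack_coboundary f z)"
proof (cases "symdeg z")
  case 0
  then show ?thesis by (simp add: rack_coboundary_eq)
next
  case (Suc n)
  have "rack_coboundary (\<lambda>w. (-1) ^ symdeg w * f w) z = rack_coboundary (\<lambda>w. (-1) ^ n * f w) z"
    by (rule rack_coboundary_cong) (simp add: Suc)
  then show ?thesis by (simp add: rack_coboundary_cmul Suc)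
qed

text \<open>Appending a letter to a symbol, and acting by a letter on a symbol.\<close>

definition snoc :: "'x symbol \<Rightarrow> 'x \<Rightarrow> 'x symbol" where
  "snoc z x = (fst z, snd z @ [x])"

definition act :: "'x::rack symbol \<Rightarrow> 'x \<Rightarrow> 'x symbol" where
  "act z x = (fst z \<triangleright> x, map (\<lambda>u. u \<triangleright> x) (snd z))"

lemma symdeg_snoc [simp]: "symdeg (snoc z x) = Suc (symdeg z)"
  by (simp add: snoc_def)

lemma symdeg_act [simp]: "symdeg (act z x) = symdeg z"
  by (simp add: act_def)

lemma symbol_snoc_induct [case_names Nil snoc]:
  assumes "\<And>z. symdeg z = 0 \<Longrightarrow> Q z" "\<And>z x. Q z \<Longrightarrow> Q (snoc z x)"
  shows "Q z"
proof -
  have "Q (y, xs)" for y xs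
  proof (induction xs rule: rev_induct)
    case Nil
    then show ?case using assms(1) by simp
  next
    case (snoc x xs)
    then show ?case using assms(2)[of "(y, xs)" x] by (simp add: snoc_def)
  qed
  then show ?thesis by (cases z) simp
qed

lemma face_snoc:
  assumes "i \<in> {1..symdeg z}"
  shows "face0 i (snoc z x) = snoc (face0 i z) x" "face1 i (snoc z x) = snoc (face1 i z) x"
proof -
  have "i - 1 < symdeg z" using assms by auto
  with assms show "face0 i (snoc z x) = snoc (face0 i z) x" "face1 i (snoc z x) = snoc (face1 i z) x"
    by (auto simp: face0_def face1_def snoc_def nth_append Let_def)
qed

lemma face_snoc_last:
  "face0 (Suc (symdeg z)) (snoc z x) = z" "face1 (Suc (symdeg z)) (snoc z x) = act z x"
  by (auto simp: face0_def face1_def snoc_def act_def Let_def)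

lemma face_act:
  assumes "i \<in> {1..symdeg z}"
  shows "face0 i (act z x) = act (face0 i z) x" "face1 i (act z x) = act (face1 i z) x"
proof -
  have "i - 1 < symdeg z" using assms by auto
  then show "face0 i (act z x) = act (face0 i z) x" "face1 i (act z x) = act (face1 i z) x"
    by (auto simp: face0_def face1_def act_def Let_def take_map drop_map rack_distrib[symmetric])
qed

lemma rack_coboundary_snoc:
  "rack_coboundary f (snoc z x) =
     rack_coboundary (\<lambda>w. f (snoc w x)) z + (-1) ^ Suc (symdeg z) * (f z - f (act z x))"
proof -
  have "rack_coboundary f (snoc z x) =
      (\<Sum>i = 1..symdeg z. (-1) ^ i * (f (face0 i (snoc z x)) - f (face1 i (snoc z x))))
      + (-1) ^ Suc (symdeg z) * (f z - f (act z x))"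
    by (simp add: rack_coboundary_eq face_snoc_last)
  also have "(\<Sum>i = 1..symdeg z. (-1) ^ i * (f (face0 i (snoc z x)) - f (face1 i (snoc z x))))
      = rack_coboundary (\<lambda>w. f (snoc w x)) z"
    unfolding rack_coboundary_eq by (intro sum.cong refl) (simp add: face_snoc)
  finally show ?thesis .
qed

lemma rack_coboundary_act:
  "rack_coboundary (\<lambda>w. f (act w x)) z = rack_coboundary f (act z x)"
  unfolding rack_coboundary_eq symdeg_act by (intro sum.cong refl) (simp add: face_act)

lemma act_act: "act (act z a) b = act (act z b) (a \<triangleright> b)"
  by (simp add: act_def rack_distrib[symmetric] split: prod.splits)

lemma act_snoc: "act (snoc z a) b = snoc (act z b) (a \<triangleright> b)"
  by (simp add: act_def snoc_def)

lemma rack_coboundary_squared [simp]: "rack_coboundary (rack_coboundary f) = 0"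
proof -
  have "rack_coboundary (rack_coboundary f) z = 0" for z
  proof (induction z arbitrary: f rule: symbol_snoc_induct)
    case (Nil z)
    then show ?case by (simp add: rack_coboundary_eq)
  next
    case (snoc z x)
    have "rack_coboundary (rack_coboundary f) (snoc z x) =
      rack_coboundary (\<lambda>w. rack_coboundary (\<lambda>v. f (snoc v x)) w
         + (-1) * ((-1) ^ symdeg w * (f w + (-1) * f (act w x)))) z
         + (-1) ^ Suc (symdeg z) * (rack_coboundary f z - rack_coboundary f (act z x))"
      by (simp add: rack_coboundary_snoc[where z = z] rack_coboundary_snoc[abs_def] algebra_simps)
    also have "\<dots> = 0"
      unfolding rack_coboundary_add rack_coboundary_cmul rack_coboundary_alternate snoc
        rack_coboundary_act
      by (simp add: algebra_simps)
    finally show ?case .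
  qed
  then show ?thesis by (simp add: fun_eq_iff)
qed

subsection \<open>Signs of shuffles\<close>

lemma sorted_list_of_set_insert_greatest:
  assumes "finite S" "\<And>a. a \<in> S \<Longrightarrow> a < (m::nat)"
  shows "sorted_list_of_set (insert m S) = sorted_list_of_set S @ [m]"
proof (rule sorted_list_of_set_unique[THEN iffD1])
  show "finite (insert m S)" using assms by simp
  have "m \<notin> S" using assms(2) by blast
  then show "sorted_wrt (<) (sorted_list_of_set S @ [m]) \<and>
      set (sorted_list_of_set S @ [m]) = insert m S \<and>
      length (sorted_list_of_set S @ [m]) = card (insert m S)"
    using assms by (auto simp: sorted_wrt_append)
qed

lemma shuffle_perm_permutes:
  assumes "A \<subseteq> {1..n}"
  shows "shuffle_perm n A permutes {1..n}"
proof -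
  let ?l = "sorted_list_of_set ({1..n} - A) @ sorted_list_of_set A"
  have fin: "finite A" using assms finite_subset by blast
  have d: "distinct ?l" using fin by auto
  have s: "set ?l = {1..n}" using fin assms by auto
  have "length ?l = card {1..n}" using distinct_card[OF d] unfolding s by (rule sym)
  then have len: "length ?l = n" by (simp only: card_atLeastAtMost diff_Suc_1)
  have "bij_betw ((!) ?l) {..<n} {1..n}"
    using bij_betw_nth[OF d] len s by auto
  moreover have "bij_betw (\<lambda>i. i - 1) {1..n} {..<n}"
    by (rule bij_betw_byWitness[where f' = Suc]) auto
  ultimately have "bij_betw ((!) ?l \<circ> (\<lambda>i. i - 1)) {1..n} {1..n}"
    by (rule bij_betw_trans[rotated])
  then have "bij_betw (shuffle_perm n A) {1..n} {1..n}"
    by (rule bij_betw_cong[THEN iffD1, rotated]) (auto simp: shuffle_perm_def)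
  then show ?thesis
    by (rule bij_imp_permutes) (auto simp: shuffle_perm_def)
qed

lemma shuffle_sign_insert:
  assumes "A \<subseteq> {1..n}"
  shows "shuffle_sign (Suc n) (insert (Suc n) A) = shuffle_sign n A"
proof -
  let ?l = "sorted_list_of_set ({1..n} - A) @ sorted_list_of_set A"
  have fin: "finite A" using assms finite_subset by blast
  have a: "sorted_list_of_set (insert (Suc n) A) = sorted_list_of_set A @ [Suc n]"
    by (rule sorted_list_of_set_insert_greatest) (use assms fin in auto)
  have b: "{1..Suc n} - insert (Suc n) A = {1..n} - A" by auto
  have len: "length ?l = n"
    using fin assms by (simp add: card_Diff_subset card_mono) (metis assms card_mono card_atLeastAtMost diff_Suc_1 finite_atLeastAtMost le_add_diff_inverse2)
  have "shuffle_perm (Suc n) (insert (Suc n) A) = shuffle_perm n A"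
  proof
    fix i
    consider "i \<in> {1..n}" | "i = Suc n" | "i \<notin> {1..Suc n}" by force
    then show "shuffle_perm (Suc n) (insert (Suc n) A) i = shuffle_perm n A i"
    proof cases
      case 1
      then have "i - 1 < length ?l" using len by auto
      then have "(?l @ [Suc n]) ! (i - 1) = ?l ! (i - 1)" by (metis nth_append)
      with 1 show ?thesis by (simp add: shuffle_perm_def a b del: One_nat_def)
    next
      case 2
      have "(?l @ [Suc n]) ! n = Suc n" using len by (metis nth_append_length)
      with 2 show ?thesis by (simp add: shuffle_perm_def a b del: One_nat_def)
    next
      case 3
      then show ?thesis by (auto simp: shuffle_perm_def)
    qed
  qed
  then show ?thesis by (simp add: shuffle_sign_def)
qed

definition rot_perm :: "nat \<Rightarrow> nat \<Rightarrow> nat \<Rightarrow> nat" where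
  "rot_perm a m i = (if i = a then a + m else if a < i \<and> i \<le> a + m then i - 1 else i)"

lemma rot_perm: "permutation (rot_perm a m) \<and> sign (rot_perm a m) = (-1) ^ m"
proof (induction m)
  case 0
  have "rot_perm a 0 = id" by (auto simp: rot_perm_def fun_eq_iff)
  then show ?case by simp
next
  case (Suc m)
  have eq: "rot_perm a (Suc m) = transpose (a + m) (a + Suc m) \<circ> rot_perm a m"
    by (auto simp: rot_perm_def fun_eq_iff transpose_def)
  note perm = permutation_swap_id[of "a + m" "a + Suc m"] conjunct1[OF Suc]
  have "sign (rot_perm a (Suc m)) = (-1) ^ Suc m"
    unfolding eq sign_compose[OF perm] sign_swap_id conjunct2[OF Suc] by simp
  then show ?case
    using permutation_compose[OF perm] unfolding eq by blast
qed

lemma shuffle_sign_keep: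
  assumes "A \<subseteq> {1..n}"
  shows "shuffle_sign (Suc n) A = (-1) ^ card A * shuffle_sign n A"
proof -
  let ?B = "sorted_list_of_set ({1..n} - A)" and ?A = "sorted_list_of_set A"
  let ?k = "n - card A"
  have fin: "finite A" using assms finite_subset by blast
  have cA: "card A \<le> n" using assms by (metis card_mono card_atLeastAtMost diff_Suc_1 finite_atLeastAtMost)
  have lB: "length ?B = ?k" using fin assms by (simp add: card_Diff_subset)
  have lA: "length ?A = card A" by simp
  have b: "{1..Suc n} - A = insert (Suc n) ({1..n} - A)" using assms by auto
  have a: "sorted_list_of_set ({1..Suc n} - A) = ?B @ [Suc n]"
    unfolding b by (rule sorted_list_of_set_insert_greatest) auto
  have "shuffle_perm (Suc n) A = shuffle_perm n A \<circ> rot_perm (Suc ?k) (card A)"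
  proof
    fix i
    have nk: "Suc ?k + card A = Suc n" using cA by simp
    consider "i \<in> {1..?k}" | "i = Suc ?k" | "Suc ?k < i" "i \<le> Suc n" | "i = 0" | "Suc n < i"
      by force
    then show "shuffle_perm (Suc n) A i = (shuffle_perm n A \<circ> rot_perm (Suc ?k) (card A)) i"
    proof cases
      case 1
      then have "rot_perm (Suc ?k) (card A) i = i" by (auto simp: rot_perm_def)
      moreover have "i - 1 < length ?B" using 1 lB by auto
      ultimately show ?thesis using 1 by (auto simp: shuffle_perm_def a nth_append simp del: One_nat_def)
    next
      case 2
      then have "rot_perm (Suc ?k) (card A) i = Suc n" using nk by (simp add: rot_perm_def)
      moreover have "shuffle_perm (Suc n) A i = Suc n"
        using 2 lB by (simp add: shuffle_perm_def a nth_append del: One_nat_def)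
      ultimately show ?thesis by (simp add: shuffle_perm_def)
    next
      case 3
      then have r: "rot_perm (Suc ?k) (card A) i = i - 1" using nk by (simp add: rot_perm_def)
      have "shuffle_perm (Suc n) A i = ?A ! (i - Suc (Suc ?k))"
      proof -
        have "\<not> i - 1 < ?k" "i - 1 - ?k = Suc (i - Suc (Suc ?k))" "i \<in> {1..Suc n}" using 3 by auto
        then show ?thesis using lB by (simp add: shuffle_perm_def a nth_append del: One_nat_def)
      qed
      moreover have "shuffle_perm n A (i - 1) = ?A ! (i - Suc (Suc ?k))"
      proof -
        have "i - 1 \<in> {1..n}" "\<not> i - 1 - 1 < ?k" "i - 1 - 1 - ?k = i - Suc (Suc ?k)" using 3 by auto
        then show ?thesis using lB by (simp add: shuffle_perm_def nth_append del: One_nat_def)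
      qed
      ultimately show ?thesis using r by simp
    next
      case 4
      then show ?thesis by (simp add: shuffle_perm_def rot_perm_def)
    next
      case 5
      then show ?thesis using cA by (simp add: shuffle_perm_def rot_perm_def)
    qed
  qed
  moreover have "permutation (shuffle_perm n A)"
    using shuffle_perm_permutes[OF assms] permutation_permutes by blast
  ultimately show ?thesis
    using rot_perm[of "Suc ?k" "card A"] by (simp add: shuffle_sign_def sign_compose mult.commute)
qed

lemma shuffle_sign_empty [simp]: "shuffle_sign 0 {} = 1"
proof -
  have "shuffle_perm 0 {} = id" by (auto simp: shuffle_perm_def fun_eq_iff)
  then show ?thesis by (simp add: shuffle_sign_def)
qed

subsection \<open>The coproduct\<close>

lemma foldr_face:
  fixes z :: "'x::rack symbol"
  assumes "\<And>i w. i \<in> {1..symdeg w} \<Longrightarrow> symdeg (F i w) = symdeg w - 1"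
  assumes "sorted_wrt (<) bs" "set bs \<subseteq> {1..symdeg z}"
  shows "symdeg (foldr F bs z) = symdeg z - length bs
    \<and> (\<forall>x. (\<forall>i w. i \<in> {1..symdeg w} \<longrightarrow> F i (snoc w x) = snoc (F i w) x)
        \<longrightarrow> foldr F bs (snoc z x) = snoc (foldr F bs z) x)
    \<and> (\<forall>x. (\<forall>i w. i \<in> {1..symdeg w} \<longrightarrow> F i (act w x) = act (F i w) x)
        \<longrightarrow> foldr F bs (act z x) = act (foldr F bs z) x)"
  using assms(2,3)
proof (induction bs)
  case Nil
  then show ?case by simp
next
  case (Cons b bs)
  have IH: "symdeg (foldr F bs z) = symdeg z - length bs"
    using Cons by auto
  have "set bs \<subseteq> {Suc b..symdeg z}" using Cons.prems by (auto simp: Suc_le_eq)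
  then have "card (set bs) \<le> symdeg z - b"
    by (metis card_mono card_atLeastAtMost finite_atLeastAtMost diff_Suc_Suc)
  moreover have "card (set bs) = length bs"
    using Cons.prems by (simp add: distinct_card strict_sorted_iff)
  ultimately have b: "b \<in> {1..symdeg (foldr F bs z)}" using Cons.prems IH by auto
  have *: "sorted_wrt (<) bs" "set bs \<subseteq> {1..symdeg z}" using Cons.prems by auto
  show ?case
  proof (intro conjI allI impI)
    show "symdeg (foldr F (b # bs) z) = symdeg z - length (b # bs)"
      using assms(1)[OF b] IH by simp
  next
    fix x
    assume "\<forall>i w. i \<in> {1..symdeg w} \<longrightarrow> F i (snoc w x) = snoc (F i w) x"
    then show "foldr F (b # bs) (snoc z x) = snoc (foldr F (b # bs) z) x"
      using Cons.IH[OF *] b by (metis foldr_Cons comp_apply)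
  next
    fix x
    assume "\<forall>i w. i \<in> {1..symdeg w} \<longrightarrow> F i (act w x) = act (F i w) x"
    then show "foldr F (b # bs) (act z x) = act (foldr F (b # bs) z) x"
      using Cons.IH[OF *] b by (metis foldr_Cons comp_apply)
  qed
qed

lemma face_set:
  assumes "A \<subseteq> {1..symdeg z}"
  shows "symdeg (face0_set A z) = symdeg z - card A" "symdeg (face1_set A z) = symdeg z - card A"
    "face0_set A (snoc z x) = snoc (face0_set A z) x" "face1_set A (snoc z x) = snoc (face1_set A z) x"
    "face0_set A (act z x) = act (face0_set A z) x" "face1_set A (act z x) = act (face1_set A z) x"
proof -
  have fin: "finite A" using assms finite_subset by blast
  have "sorted_wrt (<) (sorted_list_of_set A)" "set (sorted_list_of_set A) \<subseteq> {1..symdeg z}"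
    using assms fin by auto
  note * = foldr_face[where F = face0, OF _ this] foldr_face[where F = face1, OF _ this]
  show "symdeg (face0_set A z) = symdeg z - card A" "symdeg (face1_set A z) = symdeg z - card A"
    "face0_set A (snoc z x) = snoc (face0_set A z) x" "face1_set A (snoc z x) = snoc (face1_set A z) x"
    "face0_set A (act z x) = act (face0_set A z) x" "face1_set A (act z x) = act (face1_set A z) x"
    unfolding face0_set_def face1_set_def using * by (simp_all add: face_snoc face_act)
qed

lemma face_set_insert:
  assumes "A \<subseteq> {1..symdeg z}"
  shows "face0_set (insert (Suc (symdeg z)) A) (snoc z x) = face0_set A z"
    "face1_set (insert (Suc (symdeg z)) A) (snoc z x) = act (face1_set A z) x"
proof -
  have fin: "finite A" using assms finite_subset by blast
  have a: "sorted_list_of_set (insert (Suc (symdeg z)) A) = sorted_list_of_set A @ [Suc (symdeg z)]"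
    by (rule sorted_list_of_set_insert_greatest) (use assms fin in auto)
  show "face0_set (insert (Suc (symdeg z)) A) (snoc z x) = face0_set A z"
    by (simp add: face0_set_def a face_snoc_last)
  show "face1_set (insert (Suc (symdeg z)) A) (snoc z x) = act (face1_set A z) x"
    using face_set(6)[OF assms, of x] by (simp add: face1_set_def a face_snoc_last)
qed

definition coproduct ::
  "('x::rack symbol \<Rightarrow> 'x symbol \<Rightarrow> 'k::comm_ring_1) \<Rightarrow> 'x symbol \<Rightarrow> 'k" where
  "coproduct H z =
     (\<Sum>A\<in>Pow {1..symdeg z}. (-1) ^ ((symdeg z - card A) * card A) * of_int (shuffle_sign (symdeg z) A)
         * H (face0_set A z) (face1_set ({1..symdeg z} - A) z))"

lemma cochain_cup_eq: "cochain_cup f g z = coproduct (\<lambda>l r. f l * g r) z"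
  by (simp add: cochain_cup_def coproduct_def Let_def mult.assoc)

lemma coproduct_0: "symdeg z = 0 \<Longrightarrow> coproduct H z = H z z"
  by (simp add: coproduct_def face0_set_def face1_set_def)

lemma coproduct_cong:
  assumes "\<And>l r. symdeg l + symdeg r = symdeg z \<Longrightarrow> H l r = K l r"
  shows "coproduct H z = coproduct K z"
proof -
  have "H (face0_set A z) (face1_set ({1..symdeg z} - A) z) = K (face0_set A z) (face1_set ({1..symdeg z} - A) z)"
    if "A \<subseteq> {1..symdeg z}" for A
  proof (rule assms)
    have fin: "finite A" using that finite_subset by blast
    have "card A \<le> card {1..symdeg z}" using that by (intro card_mono) auto
    then have "card A \<le> symdeg z" by simp
    moreover have "card ({1..symdeg z} - A) = symdeg z - card A" using fin that by (simp add: card_Diff_subset)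
    ultimately show "symdeg (face0_set A z) + symdeg (face1_set ({1..symdeg z} - A) z) = symdeg z"
      using face_set(1)[OF that] face_set(2)[of "{1..symdeg z} - A" z] by simp
  qed
  then show ?thesis unfolding coproduct_def by (intro sum.cong refl) auto
qed

lemma coproduct_add: "coproduct (\<lambda>l r. H l r + K l r) z = coproduct H z + coproduct K z"
  by (simp add: coproduct_def sum.distrib[symmetric] algebra_simps)

lemma coproduct_cmul: "coproduct (\<lambda>l r. c * H l r) z = c * coproduct H z"
  by (simp add: coproduct_def sum_distrib_left algebra_simps)

lemma coproduct_act: "coproduct H (act z x) = coproduct (\<lambda>l r. H (act l x) (act r x)) z"
  unfolding coproduct_def symdeg_act by (intro sum.cong refl) (simp add: face_set)

lemma coproduct_snoc:
  fixes H :: "'x::rack symbol \<Rightarrow> 'x symbol \<Rightarrow> 'k::comm_ring_1"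
  shows
  "coproduct H (snoc z x) =
     coproduct (\<lambda>l r. (-1) ^ symdeg l * H l (snoc r x) + H (snoc l x) (act r x)) z"
proof -
  let ?n = "symdeg z"
  let ?t = "\<lambda>A. (-1) ^ ((Suc ?n - card A) * card A) * of_int (shuffle_sign (Suc ?n) A)
         * H (face0_set A (snoc z x)) (face1_set ({1..Suc ?n} - A) (snoc z x))"
  let ?c = "\<lambda>A. (-1) ^ ((?n - card A) * card A) * of_int (shuffle_sign ?n A)"
  have P: "Pow {1..Suc ?n} = Pow {1..?n} \<union> insert (Suc ?n) ` Pow {1..?n}"
    using Pow_insert[of "Suc ?n" "{1..?n}"] by (simp add: atLeastAtMostSuc_conv)
  have inj: "inj_on (insert (Suc ?n)) (Pow {1..?n})"
    by (rule inj_onI) (metis Pow_iff atLeastAtMost_iff insert_ident not_less_eq_eq order_refl subset_iff)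
  have "coproduct H (snoc z x) = (\<Sum>A\<in>Pow {1..Suc ?n}. ?t A)"
    by (simp add: coproduct_def)
  also have "\<dots> = (\<Sum>A\<in>Pow {1..?n}. ?t A) + (\<Sum>A\<in>Pow {1..?n}. ?t (insert (Suc ?n) A))"
    unfolding P by (subst sum.union_disjoint) (auto simp: sum.reindex[OF inj] o_def simp del: One_nat_def)
  also have "\<dots> = (\<Sum>A\<in>Pow {1..?n}. ?t A + ?t (insert (Suc ?n) A))"
    by (simp add: sum.distrib)
  also have "\<dots> = (\<Sum>A\<in>Pow {1..?n}. ?c A *
      ((-1) ^ symdeg (face0_set A z) * H (face0_set A z) (snoc (face1_set ({1..?n} - A) z) x)
        + H (snoc (face0_set A z) x) (act (face1_set ({1..?n} - A) z) x)))"
  proof (rule sum.cong[OF refl])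
    fix A assume "A \<in> Pow {1..?n}"
    then have A: "A \<subseteq> {1..?n}" by simp
    have fin: "finite A" using A finite_subset by blast
    have "card A \<le> card {1..?n}" using A by (intro card_mono) auto
    then have cA: "card A \<le> ?n" by simp
    have nA: "Suc ?n \<notin> A" using A by auto
    have B: "{1..Suc ?n} - A = insert (Suc ?n) ({1..?n} - A)" using nA by auto
    have B': "{1..Suc ?n} - insert (Suc ?n) A = {1..?n} - A" by auto
    have s1: "(-1) ^ ((Suc ?n - card A) * card A) * of_int (shuffle_sign (Suc ?n) A) = (?c A :: 'k)"
    proof -
      have e: "(Suc ?n - card A) * card A = (?n - card A) * card A + card A"
        using cA by (simp add: Suc_diff_le)
      have "(-1 :: 'k) ^ card A * (-1) ^ card A = 1"
        by (simp add: power_mult_distrib[symmetric])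
      then show ?thesis
        unfolding e shuffle_sign_keep[OF A] by (simp add: power_add algebra_simps)
    qed
    have s2: "(-1) ^ ((Suc ?n - card (insert (Suc ?n) A)) * card (insert (Suc ?n) A))
        * of_int (shuffle_sign (Suc ?n) (insert (Suc ?n) A)) = (?c A * (-1) ^ (?n - card A) :: 'k)"
    proof -
      have e: "(Suc ?n - card (insert (Suc ?n) A)) * card (insert (Suc ?n) A)
          = (?n - card A) * card A + (?n - card A)"
        using nA fin by simp
      show ?thesis
        unfolding e shuffle_sign_insert[OF A] by (simp add: power_add algebra_simps)
    qed
    have f: "face0_set A (snoc z x) = snoc (face0_set A z) x"
      "face1_set ({1..Suc ?n} - A) (snoc z x) = act (face1_set ({1..?n} - A) z) x"
      "face0_set (insert (Suc ?n) A) (snoc z x) = face0_set A z"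
      "face1_set ({1..Suc ?n} - insert (Suc ?n) A) (snoc z x) = snoc (face1_set ({1..?n} - A) z) x"
      unfolding B B' using A by (auto simp: face_set face_set_insert)
    show "?t A + ?t (insert (Suc ?n) A) = ?c A *
      ((-1) ^ symdeg (face0_set A z) * H (face0_set A z) (snoc (face1_set ({1..?n} - A) z) x)
        + H (snoc (face0_set A z) x) (act (face1_set ({1..?n} - A) z) x))"
      unfolding s1 s2 f face_set(1)[OF A] by (simp add: algebra_simps)
  qed
  also have "\<dots> = coproduct (\<lambda>l r. (-1) ^ symdeg l * H l (snoc r x) + H (snoc l x) (act r x)) z"
    by (simp add: coproduct_def)
  finally show ?thesis .
qed

definition tensor_coboundary ::
  "('x::rack symbol \<Rightarrow> 'x symbol \<Rightarrow> 'k::comm_ring_1) \<Rightarrow> 'x symbol \<Rightarrow> 'x symbol \<Rightarrow> 'k" where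
  "tensor_coboundary H l r =
     (-1) ^ symdeg r * rack_coboundary (\<lambda>w. H w r) l + rack_coboundary (H l) r"

lemma rack_coboundary_coproduct:
  fixes H :: "'x::rack symbol \<Rightarrow> 'x symbol \<Rightarrow> 'k::comm_ring_1"
  shows
  "rack_coboundary (coproduct H) z = coproduct (tensor_coboundary H) z"
proof (induction z arbitrary: H rule: symbol_snoc_induct)
  case (Nil z)
  then show ?case by (simp add: coproduct_0 rack_coboundary_eq tensor_coboundary_def)
next
  case (snoc z x)
  let ?T = "\<lambda>H l r. (-1) ^ symdeg l * H l (snoc r x) + H (snoc l x) (act r x)"
  have "rack_coboundary (coproduct H) (snoc z x) =
      rack_coboundary (coproduct (?T H)) z + (-1) ^ Suc (symdeg z) * (coproduct H z - coproduct H (act z x))"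
    by (simp add: rack_coboundary_snoc coproduct_snoc[abs_def])
  also have "\<dots> = coproduct (\<lambda>l r. tensor_coboundary (?T H) l r
      + (-1) ^ Suc (symdeg z) * (H l r + (-1) * H (act l x) (act r x))) z"
    unfolding snoc coproduct_add coproduct_cmul coproduct_act by (simp add: algebra_simps)
  also have "\<dots> = coproduct (?T (tensor_coboundary H)) z"
  proof (rule coproduct_cong)
    fix l r :: "'x symbol" assume n: "symdeg l + symdeg r = symdeg z"
    have sq: "(-1 :: 'k) ^ i * ((-1) ^ i * a) = a" for i a
      by (simp add: mult.assoc[symmetric] power_mult_distrib[symmetric])
    have 1: "rack_coboundary (\<lambda>w. ?T H w r) l =
        - ((-1) ^ symdeg l * rack_coboundary (\<lambda>w. H w (snoc r x)) l)
          + rack_coboundary (\<lambda>w. H (snoc w x) (act r x)) l"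
      by (simp add: rack_coboundary_add rack_coboundary_alternate)
    have 2: "rack_coboundary (?T H l) r =
        (-1) ^ symdeg l * rack_coboundary (\<lambda>w. H l (snoc w x)) r
          + rack_coboundary (H (snoc l x)) (act r x)"
      by (simp add: rack_coboundary_add rack_coboundary_cmul rack_coboundary_act)
    show "tensor_coboundary (?T H) l r + (-1) ^ Suc (symdeg z) * (H l r + (-1) * H (act l x) (act r x))
        = ?T (tensor_coboundary H) l r"
      unfolding tensor_coboundary_def 1 2 n[symmetric]
      by (simp add: rack_coboundary_snoc power_add algebra_simps sq)
  qed
  finally show ?case by (simp add: coproduct_snoc)
qed

lemma tensor_coboundary_product:
  "tensor_coboundary (\<lambda>l r. f l * g r) l r =
     (-1) ^ symdeg r * (rack_coboundary f l * g r) + f l * rack_coboundary g r"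
  using rack_coboundary_cmul[of "g r" f l]
  by (simp add: tensor_coboundary_def rack_coboundary_cmul mult.commute[of _ "g r"])

lemma cochain_cup_closed:
  assumes "rack_coboundary f = 0" "rack_coboundary g = 0"
  shows "rack_coboundary (cochain_cup f g) = 0"
proof -
  have eq: "cochain_cup f g = coproduct (\<lambda>l r. f l * g r)"
    by (simp add: fun_eq_iff cochain_cup_eq)
  have "tensor_coboundary (\<lambda>l r. f l * g r) = (\<lambda>l r. 0)"
    by (intro ext) (simp add: tensor_coboundary_product assms)
  then show ?thesis
    unfolding eq by (intro ext) (simp add: rack_coboundary_coproduct, simp add: coproduct_def)
qed

lemma cochain_cup_exact_left:
  assumes "rack_coboundary g = 0"
  shows "cochain_cup (rack_coboundary h) g =
    rack_coboundary (cochain_cup h (\<lambda>w. (-1) ^ symdeg w * g w))"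
proof
  fix z
  have sq: "(-1 :: 'b) ^ i * ((-1) ^ i * a) = a" for i a
    by (simp add: mult.assoc[symmetric] power_mult_distrib[symmetric])
  let ?H = "\<lambda>l r. h l * ((-1) ^ symdeg r * g r)"
  have eq: "cochain_cup h (\<lambda>w. (-1) ^ symdeg w * g w) = coproduct ?H"
    by (simp add: fun_eq_iff cochain_cup_eq)
  have "tensor_coboundary ?H = (\<lambda>l r. rack_coboundary h l * g r)"
    by (intro ext, subst tensor_coboundary_product)
      (simp add: rack_coboundary_alternate assms mult.left_commute[of "rack_coboundary h _"] sq)
  then show "cochain_cup (rack_coboundary h) g z =
    rack_coboundary (cochain_cup h (\<lambda>w. (-1) ^ symdeg w * g w)) z"
    unfolding eq rack_coboundary_coproduct by (simp add: cochain_cup_eq)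
qed

lemma cochain_cup_exact_right:
  assumes "rack_coboundary f = 0"
  shows "cochain_cup f (rack_coboundary h) = rack_coboundary (cochain_cup f h)"
proof
  fix z
  have eq: "cochain_cup f h = coproduct (\<lambda>l r. f l * h r)"
    by (simp add: fun_eq_iff cochain_cup_eq)
  have "tensor_coboundary (\<lambda>l r. f l * h r) = (\<lambda>l r. f l * rack_coboundary h r)"
    by (intro ext) (simp add: tensor_coboundary_product assms)
  then show "cochain_cup f (rack_coboundary h) z = rack_coboundary (cochain_cup f h) z"
    unfolding eq rack_coboundary_coproduct by (simp add: cochain_cup_eq)
qed

subsection \<open>The operator P\<close>

lemma rack_coboundary_cochain_P: "rack_coboundary (cochain_P f) = cochain_P (rack_coboundary f)"
proof
  fix z :: "'a symbol"
  show "rack_coboundary (cochain_P f) z = cochain_P (rack_coboundary f) z"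
  proof (cases "snd z")
    case Nil
    then show ?thesis by (simp add: rack_coboundary_eq cochain_P_def)
  next
    case (Cons x xs)
    then obtain y where z: "z = (y, x # xs)" by (metis prod.collapse)
    let ?n = "length xs"
    let ?F = "\<lambda>i. (-1) ^ i * (cochain_P f (face0 i z) - cochain_P f (face1 i z))"
    have F1: "?F 1 = 0" by (simp add: z face0_def face1_def cochain_P_def)
    have "rack_coboundary (cochain_P f) z = (\<Sum>i = 1..Suc ?n. ?F i)"
      by (simp add: rack_coboundary_eq z)
    also have "\<dots> = ?F 1 + (\<Sum>i = Suc 1..Suc ?n. ?F i)"
      by (rule sum.atLeast_Suc_atMost) simp
    also have "\<dots> = (\<Sum>j = 1..?n. ?F (Suc j))"
      unfolding F1 sum.shift_bounds_cl_Suc_ivl by simp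
    also have "\<dots> = (\<Sum>j = 1..?n. (-1) ^ ?n * ((-1) ^ j * (f (face0 j (x, xs)) - f (face1 j (x, xs)))))"
    proof (rule sum.cong[OF refl])
      fix j assume j: "j \<in> {1..?n}"
      then obtain k where k: "j = Suc k" by (cases j) auto
      obtain n where n: "?n = Suc n" using j by (cases ?n) auto
      have "cochain_P f (face0 (Suc j) z) = (-1) ^ n * f (face0 j (x, xs))"
        "cochain_P f (face1 (Suc j) z) = (-1) ^ n * f (face1 j (x, xs))"
        using j k n by (auto simp: z face0_def face1_def cochain_P_def Let_def min_def)
      then show "?F (Suc j) = (-1) ^ ?n * ((-1) ^ j * (f (face0 j (x, xs)) - f (face1 j (x, xs))))"
        by (simp add: n algebra_simps)
    qed
    also have "\<dots> = cochain_P (rack_coboundary f) z"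
      by (simp add: z cochain_P_def rack_coboundary_eq sum_distrib_left)
    finally show ?thesis .
  qed
qed

section \<open>The cohomology ring\<close>

text \<open>The type \<open>('x, 'k) rack_cohomology\<close> is the direct sum of the cohomology groups: its elements
  are the families of cocycles, almost all of them zero, modulo coboundaries in each degree.\<close>

definition cohomologous ::
  "('x::rack symbol \<Rightarrow> 'k::comm_ring_1) \<Rightarrow> ('x symbol \<Rightarrow> 'k) \<Rightarrow> bool" where
  "cohomologous f g \<longleftrightarrow>
     (\<forall>n. component n f \<in> cocycles n \<and> component n g \<in> cocycles n
        \<and> component n f - component n g \<in> coboundaries n)
     \<and> finite {n. component n f \<noteq> 0} \<and> finite {n. component n g \<noteq> 0}"

lemma component_in_cochains: "component n f \<in> cochains n"
  by (simp add: component_def cochains_def)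

lemma component_cochain: "f \<in> cochains n \<Longrightarrow> component m f = (if m = n then f else 0)"
  by (auto simp: component_def cochains_def fun_eq_iff)

lemma component_minus: "component n (f - g :: 'x symbol \<Rightarrow> 'k::ab_group_add) = component n f - component n g"
  by (auto simp: component_def fun_eq_iff)

lemma rack_coboundary_component:
  "rack_coboundary (component n f) z = (if symdeg z = Suc n then rack_coboundary f z else 0)"
proof (cases "symdeg z = Suc n")
  case True
  then show ?thesis by (auto intro: rack_coboundary_cong simp: component_def)
next
  case False
  then have "rack_coboundary (component n f) z = rack_coboundary 0 z"
    by (intro rack_coboundary_cong) (auto simp: component_def)
  with False show ?thesis by simp
qed

lemma rack_coboundary_deg_0: "symdeg z = 0 \<Longrightarrow> rack_coboundary f z = 0"
  by (simp add: rack_coboundary_eq)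

lemma all_cocycles_iff: "(\<forall>n. component n f \<in> cocycles n) \<longleftrightarrow> rack_coboundary f = 0"
proof
  assume *: "\<forall>n. component n f \<in> cocycles n"
  show "rack_coboundary f = 0"
  proof
    fix z
    show "rack_coboundary f z = 0 z"
    proof (cases "symdeg z")
      case 0
      then show ?thesis by (simp add: rack_coboundary_deg_0)
    next
      case (Suc n)
      have "rack_coboundary (component n f) z = 0" using * by (simp add: cocycles_def)
      then show ?thesis using Suc by (simp add: rack_coboundary_component)
    qed
  qed
next
  assume "rack_coboundary f = 0"
  then show "\<forall>n. component n f \<in> cocycles n"
    by (auto simp: cocycles_def component_in_cochains rack_coboundary_component fun_eq_iff)
qed

lemma all_coboundaries_iff:
  "(\<forall>n. component n f \<in> coboundaries n) \<longleftrightarrow> (\<exists>h. f = rack_coboundary h)"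
proof
  assume *: "\<forall>n. component n f \<in> coboundaries n"
  then have "\<forall>n. \<exists>h. h \<in> cochains n \<and> component (Suc n) f = rack_coboundary h"
    unfolding coboundaries_def
    by (metis (no_types, lifting) diff_Suc_1 image_iff nat.distinct(1))
  then obtain h where h: "\<And>n. component (Suc n) f = rack_coboundary (h n)" by metis
  have "f z = rack_coboundary (\<lambda>w. h (symdeg w) w) z" for z
  proof (cases "symdeg z")
    case 0
    have "component 0 f = 0" using * by (metis coboundaries_def singletonD)
    then show ?thesis using 0 by (metis component_def rack_coboundary_deg_0 zero_fun_apply)
  next
    case (Suc n)
    have "f z = component (Suc n) f z" using Suc by (simp add: component_def)
    also have "\<dots> = rack_coboundary (h n) z" by (simp add: h)
    also have "\<dots> = rack_coboundary (\<lambda>w. h (symdeg w) w) z"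
      by (rule rack_coboundary_cong) (simp add: Suc)
    finally show ?thesis .
  qed
  then show "\<exists>h. f = rack_coboundary h" by blast
next
  assume "\<exists>h. f = rack_coboundary h"
  then obtain h where h: "f = rack_coboundary h" ..
  show "\<forall>n. component n f \<in> coboundaries n"
  proof
    fix n
    show "component n f \<in> coboundaries n"
    proof (cases n)
      case 0
      then show ?thesis
        by (auto simp: h component_def coboundaries_def fun_eq_iff rack_coboundary_deg_0)
    next
      case (Suc m)
      have "component n f = rack_coboundary (component m h)"
        by (auto simp: h component_def Suc fun_eq_iff rack_coboundary_component)
      then show ?thesis using Suc component_in_cochains by (auto simp: coboundaries_def)
    qed
  qed
qed

lemma finite_components_iff:
  "finite {n. component n f \<noteq> 0} \<longleftrightarrow> (\<exists>N. \<forall>z. N \<le> symdeg z \<longrightarrow> f z = 0)"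
proof -
  have "component n f \<noteq> 0 \<longleftrightarrow> (\<exists>z. symdeg z = n \<and> f z \<noteq> 0)" for n
    by (auto simp: component_def fun_eq_iff)
  then show ?thesis
    unfolding finite_nat_set_iff_bounded by (auto simp: not_le[symmetric]) (metis prod.collapse)+
qed

lemma cohomologous_iff:
  "cohomologous f g \<longleftrightarrow>
     rack_coboundary f = 0 \<and> rack_coboundary g = 0 \<and> (\<exists>h. f - g = rack_coboundary h)
     \<and> (\<exists>N. \<forall>z. N \<le> symdeg z \<longrightarrow> f z = 0) \<and> (\<exists>N. \<forall>z. N \<le> symdeg z \<longrightarrow> g z = 0)"
  unfolding cohomologous_def finite_components_iff all_cocycles_iff[symmetric]
    all_coboundaries_iff[symmetric] component_minus by blast

lemma cohomologous_refl_iff: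
  "cohomologous f f \<longleftrightarrow> rack_coboundary f = 0 \<and> (\<exists>N. \<forall>z. N \<le> symdeg z \<longrightarrow> f z = 0)"
  unfolding cohomologous_iff by (metis diff_self rack_coboundary_zero)

lemma cohomologousI:
  assumes "rack_coboundary f = 0" "rack_coboundary g = 0" "f - g = rack_coboundary h"
    "\<And>z. N \<le> symdeg z \<Longrightarrow> f z = 0" "\<And>z. N \<le> symdeg z \<Longrightarrow> g z = 0"
  shows "cohomologous f g"
  unfolding cohomologous_iff using assms by blast

lemma cohomologousE:
  assumes "cohomologous f g"
  obtains h N where "rack_coboundary f = 0" "rack_coboundary g = 0" "f - g = rack_coboundary h"
    "\<And>z. N \<le> symdeg z \<Longrightarrow> f z = 0" "\<And>z. N \<le> symdeg z \<Longrightarrow> g z = 0"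
proof -
  from assms obtain h N M where "rack_coboundary f = 0" "rack_coboundary g = 0"
    "f - g = rack_coboundary h" "\<forall>z. N \<le> symdeg z \<longrightarrow> f z = 0" "\<forall>z. M \<le> symdeg z \<longrightarrow> g z = 0"
    unfolding cohomologous_iff by blast
  then show thesis by (intro that[where h = h and N = "max N M"]) (simp_all del: split_paired_All)
qed

lemma cohomologous_sym: "cohomologous f g \<Longrightarrow> cohomologous g f"
  unfolding cohomologous_iff by (metis minus_diff_eq rack_coboundary_uminus)

lemma cohomologous_trans: "cohomologous f g \<Longrightarrow> cohomologous g h \<Longrightarrow> cohomologous f h"
  unfolding cohomologous_iff by (metis diff_add_cancel add_diff_eq rack_coboundary_plus)

lemma cohomologous_0: "cohomologous 0 0"
  by (simp add: cohomologous_refl_iff)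

quotient_type (overloaded) ('x, 'k) rack_cohomology = "'x::rack symbol \<Rightarrow> 'k::field" / partial: cohomologous
  by (rule part_equivpI)
    (use cohomologous_0 in \<open>auto intro: sympI transpI cohomologous_sym cohomologous_trans\<close>)

lemma cohomologous_plus:
  assumes "cohomologous f f'" "cohomologous g g'"
  shows "cohomologous (f + g) (f' + g')"
proof -
  from assms(1) obtain h N where f: "rack_coboundary f = 0" "rack_coboundary f' = 0"
    "f - f' = rack_coboundary h" "\<And>z. N \<le> symdeg z \<Longrightarrow> f z = 0" "\<And>z. N \<le> symdeg z \<Longrightarrow> f' z = 0"
    by (rule cohomologousE) iprover
  from assms(2) obtain k M where g: "rack_coboundary g = 0" "rack_coboundary g' = 0"
    "g - g' = rack_coboundary k" "\<And>z. M \<le> symdeg z \<Longrightarrow> g z = 0" "\<And>z. M \<le> symdeg z \<Longrightarrow> g' z = 0"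
    by (rule cohomologousE) iprover
  show ?thesis
  proof (rule cohomologousI[where h = "h + k" and N = "max N M"])
    have "f + g - (f' + g') = (f - f') + (g - g')" by simp
    then show "f + g - (f' + g') = rack_coboundary (h + k)"
      by (simp add: f(3) g(3) rack_coboundary_plus)
  qed (use f g in \<open>simp_all add: rack_coboundary_plus\<close>)
qed

lemma cohomologous_scale:
  assumes "cohomologous f g"
  shows "cohomologous (\<lambda>z. c * f z) (\<lambda>z. c * g z)"
proof -
  from assms obtain h N where f: "rack_coboundary f = 0" "rack_coboundary g = 0"
    "f - g = rack_coboundary h" "\<And>z. N \<le> symdeg z \<Longrightarrow> f z = 0" "\<And>z. N \<le> symdeg z \<Longrightarrow> g z = 0"
    by (rule cohomologousE) iprover
  show ?thesis
  proof (rule cohomologousI[where h = "\<lambda>z. c * h z" and N = N])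
    show "(\<lambda>z. c * f z) - (\<lambda>z. c * g z) = rack_coboundary (\<lambda>z. c * h z)"
      by (simp add: rack_coboundary_scale f(3)[symmetric] fun_eq_iff algebra_simps)
  qed (use f in \<open>simp_all add: rack_coboundary_scale fun_eq_iff\<close>)
qed

lemma cohomologous_uminus: "cohomologous f g \<Longrightarrow> cohomologous (- f) (- g)"
  using cohomologous_scale[of f g "-1"] by (simp add: fun_Compl_def)

lemma cohomologous_minus:
  "cohomologous f f' \<Longrightarrow> cohomologous g g' \<Longrightarrow> cohomologous (f - g) (f' - g')"
  using cohomologous_plus[OF _ cohomologous_uminus, of f f' g g'] by simp

lemma cohomologous_one: "cohomologous cochain_one cochain_one"
  unfolding cohomologous_refl_iff
proof (intro conjI exI[of _ 1] allI impI)
  show "rack_coboundary cochain_one = (0 :: 'a symbol \<Rightarrow> 'b)"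
  proof
    fix z :: "'a symbol"
    have "cochain_one (face0 i z) = (cochain_one (face1 i z) :: 'b)" if "i \<in> {1..symdeg z}" for i
      using symdeg_face[OF that] unfolding cochain_one_def by presburger
    then show "rack_coboundary cochain_one z = (0 :: 'a symbol \<Rightarrow> 'b) z"
      by (simp add: rack_coboundary_eq)
  qed
qed (auto simp: cochain_one_def)

lemma cohomologous_P:
  assumes "cohomologous f g"
  shows "cohomologous (cochain_P f) (cochain_P g)"
proof -
  from assms obtain h N where f: "rack_coboundary f = 0" "rack_coboundary g = 0"
    "f - g = rack_coboundary h" "\<And>z. N \<le> symdeg z \<Longrightarrow> f z = 0" "\<And>z. N \<le> symdeg z \<Longrightarrow> g z = 0"
    by (rule cohomologousE) iprover
  show ?thesis
  proof (rule cohomologousI[where h = "cochain_P h" and N = "Suc N"])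
    show "cochain_P f - cochain_P g = rack_coboundary (cochain_P h)"
      by (auto simp: rack_coboundary_cochain_P f(3)[symmetric] cochain_P_def fun_eq_iff
          algebra_simps split: list.splits)
  qed (use f in \<open>auto simp: rack_coboundary_cochain_P cochain_P_def fun_eq_iff split: list.splits\<close>)
qed

lemma cochain_cup_bound:
  assumes "\<And>z. N \<le> symdeg z \<Longrightarrow> f z = 0" "\<And>z. M \<le> symdeg z \<Longrightarrow> g z = 0" "N + M \<le> symdeg z"
  shows "cochain_cup f g z = 0"
proof -
  have "cochain_cup f g z = coproduct (\<lambda>l r. 0) z"
    unfolding cochain_cup_eq
  proof (rule coproduct_cong)
    fix l r :: "'a symbol" assume "symdeg l + symdeg r = symdeg z"
    then have "N \<le> symdeg l \<or> M \<le> symdeg r" using assms(3) by linarith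
    then show "f l * g r = 0" using assms(1)[of l] assms(2)[of r] by auto
  qed
  then show ?thesis by (simp add: coproduct_def)
qed

lemma cohomologous_cup:
  assumes "cohomologous f f'" "cohomologous g g'"
  shows "cohomologous (cochain_cup f g) (cochain_cup f' g')"
proof -
  from assms(1) obtain h N where f: "rack_coboundary f = 0" "rack_coboundary f' = 0"
    "f - f' = rack_coboundary h" "\<And>z. N \<le> symdeg z \<Longrightarrow> f z = 0" "\<And>z. N \<le> symdeg z \<Longrightarrow> f' z = 0"
    by (rule cohomologousE) iprover
  from assms(2) obtain k M where g: "rack_coboundary g = 0" "rack_coboundary g' = 0"
    "g - g' = rack_coboundary k" "\<And>z. M \<le> symdeg z \<Longrightarrow> g z = 0" "\<And>z. M \<le> symdeg z \<Longrightarrow> g' z = 0"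
    by (rule cohomologousE) iprover
  show ?thesis
  proof (rule cohomologousI[where N = "N + M" and
        h = "cochain_cup h (\<lambda>w. (-1) ^ symdeg w * g w) + cochain_cup f' k"])
    have "cochain_cup f g - cochain_cup f' g' = cochain_cup (f - f') g + cochain_cup f' (g - g')"
      by (simp add: fun_eq_iff cochain_cup_def Let_def sum_subtractf[symmetric]
          sum.distrib[symmetric] algebra_simps)
    then show "cochain_cup f g - cochain_cup f' g' = rack_coboundary
        (cochain_cup h (\<lambda>w. (-1) ^ symdeg w * g w) + cochain_cup f' k)"
      by (simp add: f(3) g(3) rack_coboundary_plus cochain_cup_exact_left[OF g(1)]
          cochain_cup_exact_right[OF f(2)])
  next
    fix z :: "'a symbol" assume z: "N + M \<le> symdeg z"
    show "cochain_cup f g z = 0" by (rule cochain_cup_bound[OF f(4) g(4) z])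
    show "cochain_cup f' g' z = 0" by (rule cochain_cup_bound[OF f(5) g(5) z])
  qed (use f g in \<open>auto intro: cochain_cup_closed\<close>)
qed

instantiation rack_cohomology :: (rack, field) ab_group_add
begin

lift_definition zero_rack_cohomology :: "('a, 'b) rack_cohomology" is 0
  by (rule cohomologous_0)

lift_definition plus_rack_cohomology ::
  "('a, 'b) rack_cohomology \<Rightarrow> ('a, 'b) rack_cohomology \<Rightarrow> ('a, 'b) rack_cohomology" is "(+)"
  by (rule cohomologous_plus)

lift_definition uminus_rack_cohomology ::
  "('a, 'b) rack_cohomology \<Rightarrow> ('a, 'b) rack_cohomology" is uminus
  by (rule cohomologous_uminus)

lift_definition minus_rack_cohomology ::
  "('a, 'b) rack_cohomology \<Rightarrow> ('a, 'b) rack_cohomology \<Rightarrow> ('a, 'b) rack_cohomology" is "(-)"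
  by (rule cohomologous_minus)

instance
proof
  fix a b c :: "('a, 'b) rack_cohomology"
  show "a + b + c = a + (b + c)"
    by transfer (simp add: add.assoc cohomologous_plus)
  show "a + b = b + a"
    by transfer (simp add: add.commute cohomologous_plus)
  show "0 + a = a"
    by transfer simp
  show "- a + a = 0"
    by transfer (simp add: cohomologous_0)
  show "a - b = a + - b"
    by transfer (metis cohomologous_minus diff_conv_add_uminus)
qed

end

lift_definition cohomology_scale ::
  "'k::field \<Rightarrow> ('x::rack, 'k) rack_cohomology \<Rightarrow> ('x, 'k) rack_cohomology" is "\<lambda>c f z. c * f z"
  by (rule cohomologous_scale)

interpretation cohomology: vector_space
  "cohomology_scale :: 'k::field \<Rightarrow> ('x::rack, 'k) rack_cohomology \<Rightarrow> ('x, 'k) rack_cohomology"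
proof
  fix a b :: 'k and x y :: "('x, 'k) rack_cohomology"
  show "cohomology_scale a (x + y) = cohomology_scale a x + cohomology_scale a y"
  proof transfer
    fix a :: 'k and f g :: "'x symbol \<Rightarrow> 'k"
    assume "cohomologous f f" "cohomologous g g"
    then have "cohomologous (\<lambda>z. a * (f + g) z) (\<lambda>z. a * (f + g) z)"
      by (intro cohomologous_scale cohomologous_plus)
    then show "cohomologous (\<lambda>z. a * (f + g) z) ((\<lambda>z. a * f z) + (\<lambda>z. a * g z))"
      by (simp add: plus_fun_def algebra_simps)
  qed
  show "cohomology_scale (a + b) x = cohomology_scale a x + cohomology_scale b x"
  proof transfer
    fix a b :: 'k and f :: "'x symbol \<Rightarrow> 'k"
    assume "cohomologous f f"
    then have "cohomologous (\<lambda>z. (a + b) * f z) (\<lambda>z. (a + b) * f z)"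
      by (intro cohomologous_scale)
    then show "cohomologous (\<lambda>z. (a + b) * f z) ((\<lambda>z. a * f z) + (\<lambda>z. b * f z))"
      by (simp add: plus_fun_def algebra_simps)
  qed
  show "cohomology_scale a (cohomology_scale b x) = cohomology_scale (a * b) x"
    by transfer (simp add: mult.assoc[symmetric] cohomologous_scale)
  show "cohomology_scale 1 x = x"
    by transfer simp
qed

instantiation rack_cohomology :: (rack, field) one
begin

lift_definition one_rack_cohomology :: "('a, 'b) rack_cohomology" is cochain_one
  by (rule cohomologous_one)

instance ..

end

lift_definition cup ::
  "('x::rack, 'k::field) rack_cohomology \<Rightarrow> ('x, 'k) rack_cohomology \<Rightarrow> ('x, 'k) rack_cohomology"
  (infixl "\<smile>" 70) is cochain_cup
  by (rule cohomologous_cup)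

lift_definition cohomology_P ::
  "('x::rack, 'k::field) rack_cohomology \<Rightarrow> ('x, 'k) rack_cohomology" is cochain_P
  by (rule cohomologous_P)

definition cohomology_in_degree :: "nat \<Rightarrow> ('x::rack, 'k::field) rack_cohomology set" where
  "cohomology_in_degree n = abs_rack_cohomology ` cocycles n"

text \<open>Only the exponents 0 and 1 are used.\<close>

definition cup_power :: "('x::rack, 'k::field) rack_cohomology \<Rightarrow> nat \<Rightarrow> ('x, 'k) rack_cohomology" where
  "cup_power B e = (if e = 0 then 1 else B)"

fun nested_product ::
  "(nat \<Rightarrow> ('x::rack, 'k::field) rack_cohomology) \<Rightarrow> ('x, 'k) rack_cohomology
    \<Rightarrow> (nat \<times> nat) list \<Rightarrow> ('x, 'k) rack_cohomology" where
  "nested_product A B [] = 1"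
| "nested_product A B [(m, e)] = A m \<smile> cup_power B e"
| "nested_product A B ((m, e) # t # ts) =
     A m \<smile> cup_power B e \<smile> cohomology_P (nested_product A B (t # ts))"

end

theory Submission
  imports Defs
begin

text \<open>
  Write \<open>k\<close> for the field with \<open>p\<close> elements, \<open>C\<close> for the complex \<open>C(X;X;k)\<close> and \<open>H\<close> for its cohomology.
  Put \<open>K = k 1 + P H\<close>; here \<open>1\<close> is independent of \<open>P H\<close> and \<open>P\<close> is injective. The theorem amounts to saying
  that every element of \<open>H\<close> is, in a unique way, a sum of products \<open>(A m \<smile> B^e) \<smile> w\<close> with \<open>w\<close> in \<open>K\<close>:
  expanding the elements of \<open>H\<close> that occur in the factors \<open>w\<close> again and again, which terminates because \<open>P\<close>
  raises the degree, gives the nested products.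

  This decomposition comes from a derivation \<open>\<Theta>\<close> of degree \<open>-2\<close> on \<open>H\<close>. It is surjective, it vanishes on \<open>K\<close>,
  and its kernel is \<open>K + B \<smile> K\<close>, a direct sum, for a class \<open>B\<close> of degree 3 with \<open>\<Theta> B = 0\<close>. Choose \<open>A m\<close>
  with \<open>A 0 = 1\<close> and \<open>\<Theta> A (m + 1) = A m\<close>. Then \<open>\<Theta>\<close> sends \<open>A (m + 1) \<smile> B^e \<smile> w\<close> to \<open>A m \<smile> B^e \<smile> w\<close> for \<open>w\<close> in \<open>K\<close>,
  and kills \<open>B^e \<smile> w\<close>; so both spanning and independence follow by applying \<open>\<Theta>\<close> and arguing by induction.

  To construct \<open>\<Theta>\<close>, let the base point \<open>y\<close> of a symbol range over the dihedral group \<open>D\<close> of order \<open>2 p\<close>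
  instead of \<open>X\<close>, which is a quotient of \<open>D\<close> by a reflection. The resulting cochains form a differential
  graded algebra \<open>M\<close> on which \<open>D\<close> acts from the left by automorphisms: translations \<open>T t\<close> and a reflection.
  The even cochains, those fixed by the reflection, are exactly \<open>C\<close>. Inserting the base point as a new first
  letter is a homotopy \<open>h\<close> with \<open>d h + h d\<close> equal to the projection to odd cochains
  (\<open>dcoboundary_base_insert\<close>), so odd cocycles are coboundaries. Put \<open>\<Delta> = T 1 - T (-1)\<close>, which exchanges
  even and odd cochains, and \<open>N = \<Sum> T t\<close>. As translations permute the base points freely, the kernel of
  \<open>\<Delta>\<close> is the image of \<open>N\<close> and vice versa (\<open>central_diff_kernel\<close>, \<open>orbit_sum_kernel\<close>). An even cochain killed
  by \<open>\<Delta>\<close> does not depend on its base point, and these cochains are \<open>k 1 + P C\<close>; the homotopy \<open>h\<close> also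
  shows that their cohomology \<open>K\<close> embeds in \<open>H\<close> (\<open>P_exact\<close>).

  For a cocycle \<open>f\<close> in \<open>C\<close>, odd acyclicity gives successively odd \<open>a\<close> and \<open>b\<close> with \<open>\<Delta> f = d a\<close> and
  \<open>N a = d b\<close>, and \<open>\<Theta>\<close> sends the class of \<open>f\<close> to that of \<open>\<Delta> b\<close>; with \<open>h\<close> this is the closed formula
  \<open>\<Delta> h N h \<Delta>\<close>. Reading such a zigzag backwards proves surjectivity (\<open>theta_surjective\<close>); continuing it by
  \<open>\<Delta> b = d c\<close> leads to the cocycle \<open>N c\<close> of \<open>K\<close>, and \<open>B\<close> is a class for which \<open>N c = 1\<close>
  (\<open>zigzag_to_one_exists\<close>, \<open>theta_kernel\<close>, \<open>kernel_unique\<close>). As the translations are algebra automorphisms,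
  zigzags of two cocycles combine to one of their product (\<open>cup_zigzag\<close>), which makes \<open>\<Theta>\<close> a derivation.
\<close>

section \<open>Cochains on the dihedral group\<close>

text \<open>The base point \<open>(y, e)\<close> is an element of the dihedral group: \<open>y\<close> is the point of \<open>X\<close> below it, and \<open>e\<close>
  tells rotations from reflections, so that it is negated by every letter. In a \<open>dcochain\<close> the word is stored in
  reverse: the head of the list is the last letter. The differential and the coproduct are then recursive
  in the list, by the formulas \<open>rack_coboundary_snoc\<close> and \<open>coproduct_snoc\<close>.\<close>

type_synonym 'p dihedral = "'p mod_ring \<times> bool"
type_synonym 'p dcochain = "'p dihedral \<Rightarrow> 'p mod_ring list \<Rightarrow> 'p mod_ring"

type_synonym 'p xcochain = "'p mod_ring symbol \<Rightarrow> 'p mod_ring"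

definition dact :: "'p::nontriv dihedral \<Rightarrow> 'p mod_ring \<Rightarrow> 'p dihedral" where
  "dact y x = (fst y \<triangleright> x, \<not> snd y)"

fun dcoboundary :: "'p::prime_card dcochain \<Rightarrow> 'p dcochain" where
  "dcoboundary F y [] = 0"
| "dcoboundary F y (x # xs) = dcoboundary (\<lambda>w ys. F w (x # ys)) y xs
     - (-1) ^ length xs * (F y xs - F (dact y x) (map (\<lambda>a. a \<triangleright> x) xs))"

text \<open>In \<open>H u l v r\<close>, \<open>u\<close> and \<open>v\<close> are the base points of the left and right factor, \<open>l\<close> and \<open>r\<close> their words.\<close>

fun dcoproduct :: "('p::prime_card dihedral \<Rightarrow> 'p mod_ring list \<Rightarrow> 'p dcochain) \<Rightarrow> 'p dcochain" where
  "dcoproduct H y [] = H y [] y []"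
| "dcoproduct H y (x # xs) = dcoproduct (\<lambda>u l v r. (-1) ^ length l * H u l v (x # r)
     + H u (x # l) (dact v x) (map (\<lambda>a. a \<triangleright> x) r)) y xs"

definition dcup :: "'p::prime_card dcochain \<Rightarrow> 'p dcochain \<Rightarrow> 'p dcochain" (infixl "\<star>" 70) where
  "F \<star> G = dcoproduct (\<lambda>u l v r. F u l * G v r)"

definition signed :: "'p::prime_card dcochain \<Rightarrow> 'p dcochain" where
  "signed F = (\<lambda>y xs. (-1) ^ length xs * F y xs)"

subsection \<open>Comparison with the rack complex\<close>

definition pullback :: "('p::prime_card mod_ring symbol \<Rightarrow> 'p mod_ring) \<Rightarrow> 'p dcochain" where
  "pullback f = (\<lambda>y xs. f (fst y, rev xs))"

text \<open>Projecting the base points from the dihedral group to \<open>X\<close> respects faces, hence the pullback of cochains is a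
  map of differential graded algebras.\<close>

lemma dcoboundary_pullback: "dcoboundary (pullback f) = pullback (rack_coboundary f)"
proof -
  have "dcoboundary (pullback f) y xs = rack_coboundary f (fst y, rev xs)" for y xs
  proof (induction xs arbitrary: f)
    case Nil
    then show ?case by (simp add: rack_coboundary_eq)
  next
    case (Cons x xs)
    have "(\<lambda>w ys. pullback f w (x # ys)) = pullback (\<lambda>z. f (snoc z x))"
      by (simp add: pullback_def snoc_def)
    then have "dcoboundary (\<lambda>w ys. pullback f w (x # ys)) y xs
        = rack_coboundary (\<lambda>z. f (snoc z x)) (fst y, rev xs)"
      by (simp only: Cons)
    moreover have "rack_coboundary f (fst y, rev (x # xs)) = rack_coboundary f (snoc (fst y, rev xs) x)"
      by (simp add: snoc_def)
    ultimately show ?case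
      unfolding rack_coboundary_snoc by (simp add: act_def pullback_def dact_def rev_map)
  qed
  then show ?thesis by (simp add: pullback_def fun_eq_iff)
qed

lemma dcoproduct_pullback:
  "dcoproduct (\<lambda>u l v r. H (fst u, rev l) (fst v, rev r)) y xs = coproduct H (fst y, rev xs)"
proof (induction xs arbitrary: H)
  case Nil
  then show ?case by (simp add: coproduct_0)
next
  case (Cons x xs)
  have "coproduct H (snoc (fst y, rev xs) x) =
    coproduct (\<lambda>l r. (-1) ^ symdeg l * H l (snoc r x) + H (snoc l x) (act r x)) (fst y, rev xs)"
    by (rule coproduct_snoc)
  then show ?case
    by (simp add: Cons[symmetric] snoc_def act_def dact_def rev_map)
qed

lemma cup_pullback: "pullback f \<star> pullback g = pullback (cochain_cup f g)"
  using dcoproduct_pullback[of "\<lambda>l r. f l * g r"]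
  by (simp add: dcup_def fun_eq_iff pullback_def cochain_cup_eq)

lemma additive_pullback: "additive pullback"
  by unfold_locales (simp add: pullback_def fun_eq_iff)

interpretation pullback: additive pullback by (rule additive_pullback)

subsection \<open>The differential and the Leibniz rule\<close>

lemma dcoboundary_add_at:
  "dcoboundary (\<lambda>w ys. F w ys + G w ys) y xs = dcoboundary F y xs + dcoboundary G y xs"
proof (induction xs arbitrary: F G)
  case (Cons x xs)
  show ?case
    by (simp only: dcoboundary.simps Cons) (simp add: right_diff_distrib distrib_left)
qed simp

lemma dcoboundary_cmul_at:
  "dcoboundary (\<lambda>w ys. c * F w ys) y xs = c * dcoboundary F y xs"
proof (induction xs arbitrary: F)
  case (Cons x xs)
  show ?case
    using Cons[of "\<lambda>w ys. F w (x # ys)"] by (simp add: right_diff_distrib mult.left_commute)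
qed simp

lemma dcoboundary_cong_length:
  assumes "\<And>w ys. Suc (length ys) = length xs \<Longrightarrow> F w ys = G w ys"
  shows "dcoboundary F y xs = dcoboundary G y xs"
  using assms
proof (induction xs arbitrary: F G)
  case (Cons x xs)
  have "dcoboundary (\<lambda>w ys. F w (x # ys)) y xs = dcoboundary (\<lambda>w ys. G w (x # ys)) y xs"
    by (rule Cons.IH) (simp add: Cons.prems)
  then show ?case by (simp add: Cons.prems)
qed simp

lemma additive_dcoboundary: "additive dcoboundary"
  by unfold_locales (simp add: fun_eq_iff plus_fun_def dcoboundary_add_at)

interpretation dcoboundary: additive dcoboundary by (rule additive_dcoboundary)

lemma dact_dact: "dact (dact y b) (a \<triangleright> b) = dact (dact y a) b"
  by (simp add: dact_def rack_distrib[symmetric])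

lemma dcoboundary_act:
  "dcoboundary (\<lambda>w ys. F (dact w x) (map (\<lambda>a. a \<triangleright> x) ys)) y xs
     = dcoboundary F (dact y x) (map (\<lambda>a. a \<triangleright> x) xs)"
proof (induction xs arbitrary: F)
  case (Cons z xs)
  show ?case
    using Cons[of "\<lambda>v zs. F v ((z \<triangleright> x) # zs)"]
    by (simp add: dact_dact rack_distrib[symmetric] o_def)
qed simp

lemma dcoboundary_signed_at:
  "dcoboundary (\<lambda>w ys. (-1) ^ length ys * F w ys) y xs = - ((-1) ^ length xs * dcoboundary F y xs)"
proof (cases xs)
  case (Cons x zs)
  have "dcoboundary (\<lambda>w ys. (-1) ^ length ys * F w ys) y xs = dcoboundary (\<lambda>w ys. (-1) ^ length zs * F w ys) y xs"
    by (rule dcoboundary_cong_length) (simp add: Cons)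
  then show ?thesis by (simp add: dcoboundary_cmul_at Cons)
qed simp

lemma dcoboundary_signed: "dcoboundary (signed F) = - signed (dcoboundary F)"
  unfolding signed_def by (intro ext) (simp add: dcoboundary_signed_at)

lemma signed_signed [simp]: "signed (signed F) = F"
  by (simp add: signed_def fun_eq_iff)

lemma additive_signed: "additive signed"
  by unfold_locales (simp add: signed_def fun_eq_iff algebra_simps)

interpretation signed: additive signed by (rule additive_signed)

lemma dcoproduct_act:
  "dcoproduct H (dact y x) (map (\<lambda>a. a \<triangleright> x) xs) =
     dcoproduct (\<lambda>u l v r. H (dact u x) (map (\<lambda>a. a \<triangleright> x) l) (dact v x) (map (\<lambda>a. a \<triangleright> x) r)) y xs"
proof (induction xs arbitrary: H)
  case (Cons z xs)
  show ?case
    unfolding dcoproduct.simps list.map Cons by (simp add: dact_dact rack_distrib[symmetric] o_def)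
qed simp

lemma dcoproduct_add:
  "dcoproduct (\<lambda>u l v r. H u l v r + K u l v r) y xs = dcoproduct H y xs + dcoproduct K y xs"
proof (induction xs arbitrary: H K)
  case (Cons x xs)
  show ?case
    by (simp only: dcoproduct.simps Cons[symmetric] distrib_left add_ac)
qed simp

lemma dcoproduct_cmul:
  "dcoproduct (\<lambda>u l v r. c * H u l v r) y xs = c * dcoproduct H y xs"
proof (induction xs arbitrary: H)
  case (Cons x xs)
  show ?case
    by (simp only: dcoproduct.simps Cons[symmetric] distrib_left mult.left_commute)
qed simp

lemma dcoproduct_cong:
  assumes "\<And>u l v r. length l + length r = length xs \<Longrightarrow> H u l v r = K u l v r"
  shows "dcoproduct H y xs = dcoproduct K y xs"
  using assms
proof (induction xs arbitrary: H K)
  case (Cons x xs)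
  show ?case
    unfolding dcoproduct.simps by (rule Cons.IH) (simp add: Cons.prems)
qed simp

definition tensor_dcoboundary ::
  "('p::prime_card dihedral \<Rightarrow> 'p mod_ring list \<Rightarrow> 'p dcochain) \<Rightarrow> ('p dihedral \<Rightarrow> 'p mod_ring list \<Rightarrow> 'p dcochain)" where
  "tensor_dcoboundary H u l v r = (-1) ^ length r * dcoboundary (\<lambda>w ys. H w ys v r) u l + dcoboundary (H u l) v r"

text \<open>The total differential of \<open>M \<otimes> M\<close>, dual to the differential of a tensor product of chains, corresponds to
  that of \<open>M\<close>: on adding a last letter both sides satisfy the same recursion.\<close>

lemma dcoboundary_dcoproduct:
  "dcoboundary (dcoproduct H) y xs = dcoproduct (tensor_dcoboundary H) y xs"
proof (induction xs arbitrary: H)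
  case Nil
  then show ?case by (simp add: tensor_dcoboundary_def)
next
  case (Cons x xs)
  let ?a = "map (\<lambda>a. a \<triangleright> x)"
  let ?T = "\<lambda>H u l v r. (-1) ^ length l * H u l v (x # r) + H u (x # l) (dact v x) (?a r)"
  have "dcoboundary (dcoproduct H) y (x # xs) = dcoproduct (tensor_dcoboundary (?T H)) y xs
      - (-1) ^ length xs * (dcoproduct H y xs - dcoproduct (\<lambda>u l v r. H (dact u x) (?a l) (dact v x) (?a r)) y xs)"
    unfolding dcoboundary.simps dcoproduct.simps Cons dcoproduct_act ..
  also have "\<dots> = dcoproduct (\<lambda>u l v r. tensor_dcoboundary (?T H) u l v r
      + (- ((-1) ^ length xs)) * (H u l v r + (-1) * H (dact u x) (?a l) (dact v x) (?a r))) y xs"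
    unfolding dcoproduct_add dcoproduct_cmul by (simp add: algebra_simps)
  also have "\<dots> = dcoproduct (?T (tensor_dcoboundary H)) y xs"
  proof (rule dcoproduct_cong)
    fix u v :: "'a dihedral" and l r :: "'a mod_ring list"
    assume n: "length l + length r = length xs"
    have sq: "(-1 :: 'a mod_ring) ^ i * ((-1) ^ i * a) = a" for i a
      by (rule left_minus_one_mult_self)
    have 1: "dcoboundary (\<lambda>w ys. ?T H w ys v r) u l =
        - ((-1) ^ length l * dcoboundary (\<lambda>w ys. H w ys v (x # r)) u l)
          + dcoboundary (\<lambda>w ys. H w (x # ys) (dact v x) (?a r)) u l"
      by (simp add: dcoboundary_add_at dcoboundary_signed_at)
    have 2: "dcoboundary (?T H u l) v r =
        (-1) ^ length l * dcoboundary (\<lambda>w ys. H u l w (x # ys)) v r + dcoboundary (H u (x # l)) (dact v x) (?a r)"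
      by (simp add: dcoboundary_add_at dcoboundary_cmul_at dcoboundary_act)
    show "tensor_dcoboundary (?T H) u l v r
      + (- ((-1) ^ length xs)) * (H u l v r + (-1) * H (dact u x) (?a l) (dact v x) (?a r))
      = ?T (tensor_dcoboundary H) u l v r"
      unfolding tensor_dcoboundary_def 1 2 n[symmetric]
      by (simp add: power_add algebra_simps sq)
  qed
  finally show ?case by simp
qed

lemma cup_Leibniz:
  "dcoboundary (F \<star> G) = dcoboundary F \<star> signed G + F \<star> dcoboundary G"
proof -
  have "tensor_dcoboundary (\<lambda>u l v r. F u l * G v r) =
      (\<lambda>u l v r. dcoboundary F u l * signed G v r + F u l * dcoboundary G v r)"
  proof (intro ext)
    fix u l v r
    have "dcoboundary (\<lambda>w ys. F w ys * G v r) u l = G v r * dcoboundary F u l"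
      using dcoboundary_cmul_at[of "G v r" F u l] by (simp add: mult.commute)
    then show "tensor_dcoboundary (\<lambda>u l v r. F u l * G v r) u l v r
        = dcoboundary F u l * signed G v r + F u l * dcoboundary G v r"
      by (simp add: tensor_dcoboundary_def dcoboundary_cmul_at signed_def)
  qed
  then show ?thesis unfolding dcup_def by (intro ext) (simp add: dcoboundary_dcoproduct dcoproduct_add)
qed

lemma additive_cup_left: "additive (\<lambda>F. F \<star> G)"
  by unfold_locales (simp add: dcup_def fun_eq_iff dcoproduct_add[symmetric] algebra_simps)

lemma additive_cup_right: "additive (\<lambda>G. F \<star> G)"
  by unfold_locales (simp add: dcup_def fun_eq_iff dcoproduct_add[symmetric] algebra_simps)

interpretation cupl: additive "\<lambda>F. F \<star> G" for G by (rule additive_cup_left)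
interpretation cupr: additive "\<lambda>G. F \<star> G" for F by (rule additive_cup_right)

lemma dcoboundary_dcoboundary [simp]: "dcoboundary (dcoboundary F) = 0"
proof -
  have "dcoboundary (dcoboundary F) y xs = 0" for y xs
  proof (induction xs arbitrary: F)
    case (Cons x xs)
    have "dcoboundary (\<lambda>w ys. dcoboundary F w (x # ys)) y xs
       = dcoboundary (\<lambda>w ys. dcoboundary (\<lambda>v zs. F v (x # zs)) w ys
         + (-1) * ((-1) ^ length ys * (F w ys + (-1) * F (dact w x) (map (\<lambda>a. a \<triangleright> x) ys)))) y xs"
      by simp
    also have "\<dots> = (-1) ^ length xs * (dcoboundary F y xs - dcoboundary F (dact y x) (map (\<lambda>a. a \<triangleright> x) xs))"
      unfolding dcoboundary_add_at dcoboundary_cmul_at dcoboundary_signed_at Cons dcoboundary_act by (simp add: algebra_simps)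
    finally show ?case by simp
  qed simp
  then show ?thesis by (simp add: fun_eq_iff)
qed

section \<open>Symmetries and contraction\<close>

text \<open>Left multiplication by elements of the dihedral group. It commutes with the letters, which act from the right.
  The sign in \<open>translate\<close> is what makes left translations commute with reflections of \<open>X\<close>.\<close>

definition translate :: "'p::prime_card mod_ring \<Rightarrow> 'p dcochain \<Rightarrow> 'p dcochain" where
  "translate t F = (\<lambda>y xs. F (fst y + (if snd y then t else - t), snd y) xs)"

definition reflect :: "'p::prime_card dcochain \<Rightarrow> 'p dcochain" where
  "reflect F = (\<lambda>y xs. F (fst y, \<not> snd y) xs)"

definition orbit_sum :: "'p::prime_card dcochain \<Rightarrow> 'p dcochain" where
  "orbit_sum F = (\<Sum>t\<in>UNIV. translate t F)"

definition central_diff :: "'p::prime_card dcochain \<Rightarrow> 'p dcochain" where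
  "central_diff F = translate 1 F - translate (-1) F"

text \<open>The base point is appended to the reversed word, so it becomes the first letter. The factor normalizes
  the identity \<open>dcoboundary_base_insert\<close>.\<close>

definition base_insert :: "'p::prime_card dcochain \<Rightarrow> 'p dcochain" where
  "base_insert F = (\<lambda>y xs. - (1 / 2) * F y (xs @ [fst y]))"

definition even_part :: "'p::prime_card dcochain \<Rightarrow> 'p dcochain" where
  "even_part F = (\<lambda>y xs. (1 / 2) * (F y xs + reflect F y xs))"

definition odd_part :: "'p::prime_card dcochain \<Rightarrow> 'p dcochain" where
  "odd_part F = F - even_part F"

lemma additive_translate: "additive (translate t)"
  by unfold_locales (simp add: translate_def fun_eq_iff)
interpretation translate: additive "translate t" for t by (rule additive_translate)

lemma additive_reflect: "additive reflect"
  by unfold_locales (simp add: reflect_def fun_eq_iff)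
interpretation reflect: additive reflect by (rule additive_reflect)

lemma additive_orbit_sum: "additive orbit_sum"
  by unfold_locales (simp add: orbit_sum_def translate.add sum.distrib)
interpretation orbit_sum: additive orbit_sum by (rule additive_orbit_sum)

lemma additive_central_diff: "additive central_diff"
  by unfold_locales (simp add: central_diff_def translate.add)
interpretation central_diff: additive central_diff by (rule additive_central_diff)

lemma additive_base_insert: "additive base_insert"
  by unfold_locales (simp add: base_insert_def fun_eq_iff distrib_left)
interpretation base_insert: additive base_insert by (rule additive_base_insert)

lemma additive_even_part: "additive even_part"
  by unfold_locales (simp add: even_part_def reflect_def fun_eq_iff distrib_left)
interpretation even_part: additive even_part by (rule additive_even_part)

lemma additive_odd_part: "additive odd_part"
  by unfold_locales (simp add: odd_part_def even_part.add)
interpretation odd_part: additive odd_part by (rule additive_odd_part)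

lemma translate_translate: "translate t (translate u F) = translate (t + u) F"
  by (simp add: translate_def fun_eq_iff algebra_simps)

lemma translate_0 [simp]: "translate 0 F = F"
  by (simp add: translate_def fun_eq_iff)

lemma reflect_reflect [simp]: "reflect (reflect F) = F"
  by (simp add: reflect_def fun_eq_iff)

lemma reflect_translate: "reflect (translate t F) = translate (- t) (reflect F)"
  by (simp add: reflect_def translate_def fun_eq_iff)

text \<open>Every map of base points that commutes with the letters induces an automorphism of the differential
  graded algebra.\<close>

lemma dcoboundary_base:
  assumes "\<And>y x. dact (\<phi> y) x = \<phi> (dact y x)"
  shows "dcoboundary (\<lambda>w. F (\<phi> w)) y xs = dcoboundary F (\<phi> y) xs"
proof (induction xs arbitrary: F)
  case (Cons x xs)
  show ?case
    using Cons[of "\<lambda>w ys. F w (x # ys)"] by (simp add: assms)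
qed simp

lemma dcoproduct_base:
  assumes "\<And>y x. dact (\<phi> y) x = \<phi> (dact y x)"
  shows "dcoproduct (\<lambda>u l v r. H (\<phi> u) l (\<phi> v) r) y xs = dcoproduct H (\<phi> y) xs"
proof (induction xs arbitrary: H)
  case (Cons x xs)
  show ?case
    unfolding dcoproduct.simps
    by (subst Cons[symmetric]) (simp add: assms)
qed simp

lemma dact_translate:
  "dact (fst y + (if snd y then t else - t), snd y) x
     = (\<lambda>y. (fst y + (if snd y then t else - t), snd y)) (dact y x)"
  by (simp add: dact_def rack_op_mod_ring_def)

lemma dact_reflect:
  "dact (fst y, \<not> snd y) x = (\<lambda>y. (fst y, \<not> snd y)) (dact y x)"
  by (simp add: dact_def)

lemma dcoboundary_translate: "dcoboundary (translate t F) = translate t (dcoboundary F)"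
  unfolding translate_def
  using dcoboundary_base[of "\<lambda>y. (fst y + (if snd y then t else - t), snd y)" F, OF dact_translate]
  by (intro ext) simp

lemma dcoboundary_reflect: "dcoboundary (reflect F) = reflect (dcoboundary F)"
  unfolding reflect_def
  using dcoboundary_base[of "\<lambda>y. (fst y, \<not> snd y)" F, OF dact_reflect]
  by (intro ext) simp

lemma translate_cup: "translate t (F \<star> G) = translate t F \<star> translate t G"
  unfolding translate_def dcup_def
  by (intro ext dcoproduct_base[symmetric, OF dact_translate])

lemma reflect_cup: "reflect (F \<star> G) = reflect F \<star> reflect G"
  unfolding reflect_def dcup_def
  by (intro ext dcoproduct_base[symmetric, OF dact_reflect])

lemma signed_translate: "signed (translate t F) = translate t (signed F)"
  by (simp add: signed_def translate_def)

lemma dcoboundary_orbit_sum: "dcoboundary (orbit_sum F) = orbit_sum (dcoboundary F)"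
  by (simp add: orbit_sum_def dcoboundary.sum dcoboundary_translate)

lemma dcoboundary_central_diff: "dcoboundary (central_diff F) = central_diff (dcoboundary F)"
  by (simp add: central_diff_def dcoboundary.diff dcoboundary_translate)

lemma dcoboundary_even_part: "dcoboundary (even_part F) = even_part (dcoboundary F)"
proof -
  have "dcoboundary (even_part F) y xs = even_part (dcoboundary F) y xs" for y xs
    unfolding even_part_def dcoboundary_cmul_at dcoboundary_add_at by (simp add: dcoboundary_reflect)
  then show ?thesis by (simp add: fun_eq_iff)
qed

lemma dcoboundary_odd_part: "dcoboundary (odd_part F) = odd_part (dcoboundary F)"
  by (simp add: odd_part_def dcoboundary.diff dcoboundary_even_part)

lemma translate_orbit_sum: "translate t (orbit_sum F) = orbit_sum F"
  unfolding orbit_sum_def translate.sum translate_translate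
  by (rule sum.reindex_bij_witness[of _ "\<lambda>u. u - t" "\<lambda>u. t + u"]) auto

lemma orbit_sum_translate: "orbit_sum (translate t F) = orbit_sum F"
  unfolding orbit_sum_def translate_translate
  by (rule sum.reindex_bij_witness[of _ "\<lambda>u. u - t" "\<lambda>u. u + t"]) auto

lemma central_diff_orbit_sum [simp]: "central_diff (orbit_sum F) = 0"
  by (simp add: central_diff_def translate_orbit_sum)

lemma orbit_sum_central_diff [simp]: "orbit_sum (central_diff F) = 0"
  by (simp add: central_diff_def orbit_sum.diff orbit_sum_translate)

lemma signed_central_diff: "signed (central_diff F) = central_diff (signed F)"
  by (simp add: central_diff_def signed.diff signed_translate)

lemma reflect_central_diff: "reflect (central_diff F) = - central_diff (reflect F)"
  by (simp add: central_diff_def reflect.diff reflect_translate)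

lemma reflect_orbit_sum: "reflect (orbit_sum F) = orbit_sum (reflect F)"
  unfolding orbit_sum_def reflect.sum reflect_translate
  by (rule sum.reindex_bij_witness[of _ uminus uminus]) auto

lemma reflect_base_insert: "reflect (base_insert F) = base_insert (reflect F)"
  by (simp add: reflect_def base_insert_def)

lemma even_part_odd:
  fixes F :: "'p::prime_card dcochain" shows "reflect F = - F \<Longrightarrow> even_part F = 0"
  by (simp add: even_part_def fun_eq_iff)

lemma odd_part_odd:
  fixes F :: "'p::prime_card dcochain" shows "reflect F = - F \<Longrightarrow> odd_part F = F"
  by (simp add: odd_part_def even_part_odd)

lemma reflect_even_part: "reflect (even_part F) = even_part (F :: 'p::prime_card dcochain)"
  by (simp add: even_part_def reflect_def fun_eq_iff algebra_simps)

lemma even_part_odd_decomp: "F = even_part F + odd_part (F :: 'p::prime_card dcochain)"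
  by (simp add: odd_part_def)

context
  assumes odd_card: "odd CARD('p::prime_card)"
begin

lemma two_nonzero [simp]: "(2 :: 'p mod_ring) \<noteq> 0"
proof
  assume "(2 :: 'p mod_ring) = 0"
  then have "of_nat 2 = (0 :: 'p mod_ring)" by simp
  then have "CARD('p) dvd 2" by (rule of_nat_0_mod_ring_dvd)
  then have "CARD('p) \<le> 2" by (rule dvd_imp_le) simp
  moreover have "2 \<le> CARD('p)" by (rule prime_ge_2_nat[OF prime_card])
  ultimately have "CARD('p) = 2" by (rule antisym)
  with odd_card show False by simp
qed

lemma half_add_half: "(1 / 2) * (x + x) = (x :: 'p mod_ring)"
  using two_nonzero by (simp add: field_simps mult_2[symmetric])

lemma even_part_even:
  fixes F :: "'p dcochain" shows "reflect F = F \<Longrightarrow> even_part F = F"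
  by (simp add: even_part_def half_add_half)

lemma odd_part_even:
  fixes F :: "'p dcochain" shows "reflect F = F \<Longrightarrow> odd_part F = 0"
  by (simp add: odd_part_def even_part_even)

lemma reflect_odd_part: "reflect (odd_part F) = - odd_part (F :: 'p dcochain)"
proof -
  have "even_part F + even_part F = F + reflect F"
    by (simp add: even_part_def fun_eq_iff distrib_left[symmetric] field_simps)
  then have "reflect F = even_part F + even_part F - F" by (simp add: algebra_simps)
  then show ?thesis by (simp add: odd_part_def reflect.diff reflect_even_part)
qed

lemma central_diff_even_part:
  "central_diff (even_part F) = odd_part (central_diff (F :: 'p dcochain))"
proof -
  have "odd_part (central_diff (even_part F + odd_part F)) = central_diff (even_part F)"
    unfolding central_diff.add odd_part.add
    by (simp add: odd_part_odd odd_part_even reflect_central_diff reflect_even_part reflect_odd_part central_diff.minus)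
  then show ?thesis using even_part_odd_decomp[of F] by metis
qed

lemma central_diff_odd_part:
  "central_diff (odd_part F) = even_part (central_diff (F :: 'p dcochain))"
  by (simp add: odd_part_def central_diff.diff central_diff_even_part)

lemma orbit_sum_even_part: "orbit_sum (even_part F) = even_part (orbit_sum (F :: 'p dcochain))"
proof -
  have "even_part (orbit_sum (even_part F + odd_part F)) = orbit_sum (even_part F)"
    unfolding orbit_sum.add even_part.add
    by (simp add: even_part_odd even_part_even reflect_orbit_sum reflect_even_part
        reflect_odd_part orbit_sum.minus)
  then show ?thesis using even_part_odd_decomp[of F] by metis
qed

lemma orbit_sum_odd_part: "orbit_sum (odd_part F) = odd_part (orbit_sum (F :: 'p dcochain))"
  by (simp add: odd_part_def orbit_sum.diff orbit_sum_even_part)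

text \<open>Let the base point \<open>y\<close> be inserted as the first letter. Since \<open>y \<triangleright> y = y\<close>, the two faces that remove this letter
  give \<open>F\<close> and its reflection. The action of the other letters moves \<open>y\<close> as base point and as letter alike, so
  that all other faces cancel.\<close>

lemma dcoboundary_base_insert:
  fixes F :: "'p dcochain"
  shows "dcoboundary (base_insert F) = odd_part F - base_insert (dcoboundary F)"
proof -
  let ?h = "\<lambda>F y xs. F y (xs @ [fst y]) :: 'p mod_ring"
  have "dcoboundary (?h F) y xs + dcoboundary F y (xs @ [fst y]) = reflect F y xs - F y xs" for y xs
  proof (induction xs arbitrary: F)
    case Nil
    then show ?case by (simp add: reflect_def dact_def rack_op_mod_ring_def)
  next
    case (Cons x xs)
    show ?case
      using Cons[of "\<lambda>w ys. F w (x # ys)"]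
      by (simp add: reflect_def dact_def algebra_simps)
  qed
  then have *: "dcoboundary (?h F) y xs = reflect F y xs - F y xs - dcoboundary F y (xs @ [fst y])"
    for y xs
    by (simp add: algebra_simps)
  show ?thesis
  proof (intro ext)
    fix y xs
    have "dcoboundary (base_insert F) y xs = - (1 / 2) * (reflect F y xs - F y xs - dcoboundary F y (xs @ [fst y]))"
      unfolding base_insert_def dcoboundary_cmul_at * ..
    then show "dcoboundary (base_insert F) y xs = (odd_part F - base_insert (dcoboundary F)) y xs"
      using two_nonzero by (simp add: odd_part_def even_part_def base_insert_def field_simps)
  qed
qed

lemma odd_cocycle_exact:
  fixes F :: "'p dcochain"
  assumes "reflect F = - F" "dcoboundary F = 0"
  shows "F = dcoboundary (base_insert F)"
  using dcoboundary_base_insert[of F] by (simp add: assms odd_part_odd base_insert.zero)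

end

section \<open>Exactness of translations\<close>

text \<open>Multiplication by the indicator function of the base points above 0, a fundamental domain for the
  translations.\<close>

definition restrict_base :: "'p::prime_card dcochain \<Rightarrow> 'p dcochain" where
  "restrict_base F = (\<lambda>y xs. if fst y = 0 then F y xs else 0)"

context
  assumes odd_card: "odd CARD('p::prime_card)"
begin

text \<open>As \<open>p\<close> is odd, \<open>T 2\<close> generates all translations. This turns \<open>orbit_sum\<close> into a sum of its powers, and lets
  \<open>T t - 1\<close> be divided by \<open>T 2 - 1\<close>, which differs from \<open>central_diff\<close> by the translation \<open>T 1\<close>.\<close>

lemma bij_double: "bij_betw (\<lambda>j. 2 * of_nat j :: 'p mod_ring) {..<CARD('p)} UNIV"
proof -
  have surj: "(\<lambda>j. 2 * of_nat j :: 'p mod_ring) ` {..<CARD('p)} = UNIV"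
  proof -
    have "x \<in> (\<lambda>j. 2 * of_nat j) ` {..<CARD('p)}" for x :: "'p mod_ring"
    proof -
      obtain j where "j < CARD('p)" "x / 2 = of_nat j" using surj_of_nat_mod_ring by blast
      moreover have "x = 2 * (x / 2)" using two_nonzero[OF odd_card] by simp
      ultimately show ?thesis by (metis image_eqI lessThan_iff)
    qed
    then show ?thesis by blast
  qed
  then have "inj_on (\<lambda>j. 2 * of_nat j :: 'p mod_ring) {..<CARD('p)}"
    by (intro eq_card_imp_inj_on) (simp_all only: finite_lessThan card_lessThan CARD_mod_ring)
  with surj show ?thesis by (simp add: bij_betw_def)
qed

lemma orbit_sum_nat:
  "orbit_sum F = (\<Sum>j<CARD('p). translate (2 * of_nat j) (F :: 'p dcochain))"
  unfolding orbit_sum_def by (rule sum.reindex_bij_betw[OF bij_double, symmetric])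

lemma diff_add_diff: "(x - z) + (y - x) = y - (z :: 'x :: ab_group_add)"
  by simp

lemma translate_minus_telescope:
  "translate (2 * of_nat n) F - F = central_diff (\<Sum>j<n. translate (2 * of_nat j + 1) (F :: 'p dcochain))"
proof (induction n)
  case (Suc n)
  have "central_diff (translate (2 * of_nat n + 1) F) = translate (2 * of_nat (Suc n)) F - translate (2 * of_nat n) F"
    by (simp add: central_diff_def translate_translate algebra_simps)
  then have "central_diff (\<Sum>j<Suc n. translate (2 * of_nat j + 1) F)
      = (translate (2 * of_nat n) F - F) + (translate (2 * of_nat (Suc n)) F - translate (2 * of_nat n) F)"
    by (simp only: sum.lessThan_Suc central_diff.add Suc)
  also have "\<dots> = translate (2 * of_nat (Suc n)) F - F" by (rule diff_add_diff)
  finally show ?case by (rule sym)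
qed (simp only: of_nat_0 mult_zero_right translate_0 diff_self lessThan_0 sum.empty central_diff.zero)

lemma translate_minus_image: "\<exists>G. translate t F - F = central_diff (G :: 'p dcochain)"
proof -
  obtain j where "t = 2 * of_nat j"
    using bij_double unfolding bij_betw_def by (metis UNIV_I imageE)
  then show ?thesis using translate_minus_telescope by blast
qed

lemma translate_invariant:
  fixes F :: "'p dcochain" assumes "central_diff F = 0" shows "translate t F = F"
proof -
  have step: "translate 2 F = F"
  proof -
    have "translate 1 F = translate (-1) F" using assms by (simp add: central_diff_def)
    then have "translate 1 (translate 1 F) = translate 1 (translate (-1) F)" by simp
    then show ?thesis by (simp add: translate_translate)
  qed
  have "translate (2 * of_nat j) F = F" for j
  proof (induction j)
    case (Suc j)
    have "translate (2 * of_nat (Suc j)) F = translate 2 (translate (2 * of_nat j) F)"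
      by (simp add: translate_translate algebra_simps)
    then show ?case by (simp add: Suc step)
  qed simp
  moreover obtain j where "t = 2 * of_nat j"
    using bij_double unfolding bij_betw_def by (metis UNIV_I imageE)
  ultimately show ?thesis by simp
qed

lemma sum_dcochain_apply:
  "(\<Sum>t\<in>T. F t) y xs = (\<Sum>t\<in>T. (F t :: 'p dcochain) y xs)"
  by (induction T rule: infinite_finite_induct) auto

lemma base_partition:
  "(\<Sum>t\<in>UNIV. translate (- t) (restrict_base (translate t F))) = (F :: 'p dcochain)"
proof (intro ext)
  fix y :: "'p dihedral" and xs
  let ?c = "if snd y then fst y else - fst y"
  have "translate (- t) (restrict_base (translate t F)) y xs = (if t = ?c then F y xs else 0)" for t
    by (cases y) (auto simp: translate_def restrict_base_def add_eq_0_iff)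
  then have "(\<Sum>t\<in>UNIV. translate (- t) (restrict_base (translate t F)) y xs) = F y xs"
    by simp
  then show "(\<Sum>t\<in>UNIV. translate (- t) (restrict_base (translate t F))) y xs = F y xs"
    by (simp only: sum_dcochain_apply)
qed

lemma central_diff_kernel:
  fixes F :: "'p dcochain" assumes "central_diff F = 0" shows "\<exists>G. F = orbit_sum G"
proof -
  have "F = (\<Sum>t\<in>UNIV. translate (- t) (restrict_base F))"
    using base_partition[of F] by (simp add: translate_invariant[OF assms])
  also have "\<dots> = orbit_sum (restrict_base F)"
    unfolding orbit_sum_def by (rule sum.reindex_bij_witness[of _ uminus uminus]) auto
  finally show ?thesis by blast
qed

text \<open>Cut \<open>F\<close> into its parts above the points of \<open>X\<close> and translate all of them to 0. The sum of the translated parts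
  is the part of \<open>orbit_sum F\<close> above 0, hence vanishes; so \<open>F\<close> is a sum of differences \<open>T t G - G\<close>.\<close>

lemma orbit_sum_kernel:
  fixes F :: "'p dcochain" assumes "orbit_sum F = 0" shows "\<exists>G. F = central_diff G"
proof -
  let ?X = "\<lambda>t. restrict_base (translate t F)"
  have "\<forall>t. \<exists>G. translate (- t) (?X t) - ?X t = central_diff G"
    by (intro allI translate_minus_image)
  then obtain Y where Y: "\<And>t. translate (- t) (?X t) - ?X t = central_diff (Y t)"
    by (auto dest: choice)
  have add: "restrict_base (A + B) = restrict_base A + restrict_base B" for A B
    by (simp add: restrict_base_def fun_eq_iff)
  have "(\<Sum>t\<in>T. ?X t) = restrict_base (\<Sum>t\<in>T. translate t F)" for T
    by (induction T rule: infinite_finite_induct) (auto simp: add, auto simp: restrict_base_def fun_eq_iff)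
  then have "(\<Sum>t\<in>UNIV. ?X t) = restrict_base (orbit_sum F)" by (simp add: orbit_sum_def)
  then have 0: "(\<Sum>t\<in>UNIV. ?X t) = 0" by (simp add: assms restrict_base_def fun_eq_iff)
  have "F = (\<Sum>t\<in>UNIV. translate (- t) (?X t)) - (\<Sum>t\<in>UNIV. ?X t)"
    unfolding 0 base_partition by simp
  also have "\<dots> = central_diff (\<Sum>t\<in>UNIV. Y t)"
    by (simp add: sum_subtractf[symmetric] Y central_diff.sum)
  finally show ?thesis by blast
qed

end

section \<open>Even cochains and cochains on X\<close>

text \<open>The inverse of \<open>pullback\<close> on even cochains, see \<open>pullback_pushdown\<close> and \<open>pushdown_pullback\<close>.\<close>

definition pushdown :: "'p::prime_card dcochain \<Rightarrow> 'p mod_ring symbol \<Rightarrow> 'p mod_ring" where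
  "pushdown F z = (1 / 2) * (F (fst z, True) (rev (snd z)) + F (fst z, False) (rev (snd z)))"

lemma additive_pushdown: "additive pushdown"
  by unfold_locales (simp add: pushdown_def fun_eq_iff distrib_left)

interpretation pushdown: additive pushdown by (rule additive_pushdown)

lemma pullback_pushdown: "pullback (pushdown F) = even_part F"
proof (intro ext)
  fix y xs show "pullback (pushdown F) y xs = even_part F y xs"
    by (cases y; cases "snd y") (simp_all add: pullback_def pushdown_def even_part_def reflect_def add.commute)
qed

lemma reflect_pullback [simp]: "reflect (pullback f) = pullback f"
  by (simp add: reflect_def pullback_def)

context
  assumes odd_card: "odd CARD('p::prime_card)"
begin

lemma pushdown_pullback [simp]:
  "pushdown (pullback f) = (f :: 'p mod_ring symbol \<Rightarrow> 'p mod_ring)"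
  unfolding pushdown_def pullback_def fst_conv snd_conv rev_rev_ident prod.collapse
  by (intro ext half_add_half[OF odd_card])

lemma pullback_inject:
  "pullback f = pullback g \<longleftrightarrow> f = (g :: 'p mod_ring symbol \<Rightarrow> 'p mod_ring)"
  by (metis pushdown_pullback)

lemma pushdown_dcoboundary:
  "pushdown (dcoboundary (F :: 'p dcochain)) = rack_coboundary (pushdown F)"
proof -
  have "pullback (pushdown (dcoboundary F)) = pullback (rack_coboundary (pushdown F))"
    by (simp add: pullback_pushdown dcoboundary_pullback[symmetric] dcoboundary_even_part)
  then show ?thesis by (simp only: pullback_inject)
qed

lemma even_eq_pullback:
  fixes F :: "'p dcochain"
  assumes "reflect F = F" shows "pullback (pushdown F) = F"
  by (simp add: pullback_pushdown even_part_even[OF odd_card] assms)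

end

section \<open>Cochains independent of the base point\<close>

definition base_independent :: "'p::prime_card xcochain \<Rightarrow> bool" where
  "base_independent f \<longleftrightarrow> (\<forall>y y' xs. f (y, xs) = f (y', xs))"

text \<open>Inserting the base point as first letter: up to sign a left inverse of \<open>cochain_P\<close>, see \<open>repeat_base_P\<close>.\<close>

definition repeat_base :: "'p::prime_card xcochain \<Rightarrow> 'p xcochain" where
  "repeat_base f = (\<lambda>z. f (fst z, fst z # snd z))"

definition alternate :: "'p::prime_card xcochain \<Rightarrow> 'p xcochain" where
  "alternate f = (\<lambda>z. (-1) ^ symdeg z * f z)"

lemma alternate_alternate [simp]: "alternate (alternate f) = f"
  by (simp add: alternate_def fun_eq_iff)

lemma rack_coboundary_alternate':
  "rack_coboundary (alternate f) = - alternate (rack_coboundary f)"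
  unfolding alternate_def by (intro ext) (simp add: rack_coboundary_alternate)

lemma pullback_alternate: "pullback (alternate f) = signed (pullback f)"
  by (simp add: pullback_def alternate_def signed_def)

text \<open>The value of a base-independent cochain on \<open>(y; x, \<dots>)\<close> may be computed with base point \<open>x\<close>.\<close>

lemma base_independent_decomp:
  assumes "base_independent f"
  shows "f = (\<lambda>z. f (0, []) * cochain_one z) + cochain_P (alternate (repeat_base f))"
proof (intro ext)
  fix z :: "'a mod_ring symbol"
  obtain y xs where z: "z = (y, xs)" by (cases z)
  have *: "f (y, xs) = f (y', xs)" for y' xs using assms unfolding base_independent_def by blast
  show "f z = ((\<lambda>z. f (0, []) * cochain_one z) + cochain_P (alternate (repeat_base f))) z"
    by (cases xs) (use * in \<open>auto simp: z cochain_one_def cochain_P_def alternate_def repeat_base_def\<close>)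
qed

lemma base_independent_P: "base_independent (cochain_P f)"
  by (simp add: base_independent_def cochain_P_def)

lemma base_independent_one: "base_independent (\<lambda>z. c * cochain_one z)"
  by (simp add: base_independent_def cochain_one_def)

lemma repeat_base_P: "alternate (repeat_base (cochain_P f)) = f"
  by (simp add: alternate_def repeat_base_def cochain_P_def fun_eq_iff)

lemma central_diff_base_independent:
  "base_independent f \<Longrightarrow> central_diff (pullback f) = 0"
  unfolding base_independent_def central_diff_def pullback_def translate_def by (intro ext) simp

context
  assumes odd_card: "odd CARD('p::prime_card)"
begin

lemma base_independent_iff:
  "base_independent f \<longleftrightarrow> central_diff (pullback (f :: 'p xcochain)) = 0"
proof
  assume "central_diff (pullback f) = 0"
  then have *: "translate t (pullback f) = pullback f" for t by (rule translate_invariant[OF odd_card])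
  show "base_independent f"
    unfolding base_independent_def
  proof (intro allI)
    fix y y' xs
    have "translate (y' - y) (pullback f) (y, True) (rev xs) = pullback f (y, True) (rev xs)"
      by (simp add: *)
    then show "f (y, xs) = f (y', xs)" by (simp add: pullback_def translate_def)
  qed
qed (rule central_diff_base_independent)

text \<open>This is \<open>dcoboundary_base_insert\<close> for even cochains, which have no odd part.\<close>

lemma rack_coboundary_repeat_base:
  "rack_coboundary (repeat_base f) = - repeat_base (rack_coboundary (f :: 'p xcochain))"
proof -
  have *: "base_insert (pullback g) = pullback (\<lambda>z. - (1 / 2) * repeat_base g z)"
    for g :: "'p xcochain"
    by (simp add: base_insert_def pullback_def repeat_base_def)
  have "pullback (rack_coboundary (\<lambda>z. - (1 / 2) * repeat_base f z))
      = pullback (- (\<lambda>z. - (1 / 2) * repeat_base (rack_coboundary f) z))"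
    using dcoboundary_base_insert[OF odd_card, of "pullback f"]
    unfolding dcoboundary_pullback * pullback.minus
    by (simp only: odd_part_even[OF odd_card] reflect_pullback diff_0)
  then have "rack_coboundary (\<lambda>z. - (1 / 2) * repeat_base f z)
      = - (\<lambda>z. - (1 / 2) * repeat_base (rack_coboundary f) z)"
    by (simp only: pullback_inject[OF odd_card])
  then have "- (1 / 2) * rack_coboundary (repeat_base f) z
      = - (1 / 2) * (- repeat_base (rack_coboundary f) z)" for z
    unfolding rack_coboundary_scale by (drule_tac x = z in fun_cong) (simp only: uminus_apply minus_mult_right)
  moreover have "- (1 / 2) \<noteq> (0 :: 'p mod_ring)" using two_nonzero[OF odd_card] by simp
  ultimately show ?thesis unfolding mult_left_cancel[OF \<open>- (1 / 2) \<noteq> 0\<close>] by (intro ext) simp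
qed

text \<open>Injectivity of \<open>P\<close> on cohomology: \<open>repeat_base\<close> is a left inverse that commutes with the differential up to
  sign. A nonzero constant is not a coboundary because there are none in degree 0.\<close>

lemma P_exact:
  fixes u v :: "'p xcochain"
  assumes "(\<lambda>z. c * cochain_one z) + cochain_P v = rack_coboundary u"
  shows "c = 0" "v = rack_coboundary (alternate (repeat_base u))"
proof -
  have "((\<lambda>z. c * cochain_one z) + cochain_P v) (0, []) = 0"
    by (simp add: assms rack_coboundary_eq)
  then show c: "c = 0" by (simp add: cochain_one_def cochain_P_def)
  have "v = alternate (repeat_base (cochain_P v))" by (simp add: repeat_base_P)
  also have "cochain_P v = rack_coboundary u" using assms c by (simp add: zero_fun_def[symmetric])
  also have "alternate (repeat_base (rack_coboundary u)) = rack_coboundary (alternate (repeat_base u))"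
    unfolding rack_coboundary_alternate' rack_coboundary_repeat_base by (simp add: alternate_def fun_eq_iff)
  finally show "v = rack_coboundary (alternate (repeat_base u))" .
qed

text \<open>The cohomology of the base-independent cochains embeds in that of all cochains.\<close>

lemma base_independent_exact:
  fixes f u :: "'p xcochain"
  assumes "base_independent f" "f = rack_coboundary u"
  shows "\<exists>w. base_independent w \<and> f = rack_coboundary w"
proof -
  let ?v = "alternate (repeat_base f)"
  have d: "f = (\<lambda>z. f (0, []) * cochain_one z) + cochain_P ?v"
    by (rule base_independent_decomp[OF assms(1)])
  then have e: "(\<lambda>z. f (0, []) * cochain_one z) + cochain_P ?v = rack_coboundary u"
    using assms(2) by simp
  have "f = cochain_P ?v" using d P_exact(1)[OF e] by (simp add: zero_fun_def[symmetric])
  also have "?v = rack_coboundary (alternate (repeat_base u))" by (rule P_exact(2)[OF e])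
  finally show ?thesis using base_independent_P by (metis rack_coboundary_cochain_P)
qed

text \<open>Translations act trivially on the cohomology: \<open>T t F - F\<close> is a translate of the odd cocycle
  \<open>T (t / 2) F - T (- t / 2) F\<close>, hence a coboundary. So the orbit sum of a cocycle \<open>F\<close> is cohomologous to
  \<open>p F = 0\<close>.\<close>

lemma orbit_sum_exact:
  fixes f :: "'p xcochain"
  assumes "rack_coboundary f = 0"
  shows "\<exists>u. orbit_sum (pullback f) = pullback (rack_coboundary u)"
proof -
  let ?F = "pullback f"
  have cF: "dcoboundary ?F = 0" by (simp add: dcoboundary_pullback assms pullback.zero)
  have "\<exists>V. translate t ?F = ?F + dcoboundary V" for t
  proof -
    let ?O = "translate (t / 2) ?F - translate (- (t / 2)) ?F"
    have "?O = dcoboundary (base_insert ?O)"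
      by (rule odd_cocycle_exact[OF odd_card])
        (simp_all add: reflect.diff reflect_translate dcoboundary.diff dcoboundary_translate cF translate.zero)
    then have "translate (t / 2) ?O = dcoboundary (translate (t / 2) (base_insert ?O))"
      by (simp add: dcoboundary_translate)
    moreover have "t / 2 + t / 2 = t"
      using half_add_half[OF odd_card, of t] by (simp add: distrib_left)
    then have "translate (t / 2) ?O = translate t ?F - ?F"
      by (simp add: translate.diff translate_translate)
    ultimately show ?thesis by (metis add_diff_cancel_left' add.commute diff_add_cancel)
  qed
  then have "\<forall>t. \<exists>V. translate t ?F = ?F + dcoboundary V" by blast
  then obtain V where V: "\<And>t. translate t ?F = ?F + dcoboundary (V t)" by (auto dest: choice)
  have "(\<Sum>t\<in>(UNIV :: 'p mod_ring set). ?F) y xs = 0" for y xs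
    by (simp add: sum_dcochain_apply)
  then have "(\<Sum>t\<in>(UNIV :: 'p mod_ring set). ?F) = 0" by (simp add: fun_eq_iff)
  then have s: "orbit_sum ?F = dcoboundary (\<Sum>t\<in>UNIV. V t)"
    unfolding orbit_sum_def V sum.distrib dcoboundary.sum by simp
  have "orbit_sum ?F = even_part (orbit_sum ?F)"
    by (simp add: even_part_even[OF odd_card] reflect_orbit_sum)
  also have "\<dots> = pullback (rack_coboundary (pushdown (\<Sum>t\<in>UNIV. V t)))"
    unfolding s pullback_pushdown[symmetric] pushdown_dcoboundary[OF odd_card] ..
  finally show ?thesis by blast
qed

end

section \<open>The operator theta on cochains and its Leibniz rule\<close>

text \<open>A map of complexes of degree \<open>-2\<close>: the error terms of the two homotopies contain
  \<open>central_diff (orbit_sum F)\<close> or \<open>orbit_sum (central_diff F)\<close>, which vanish.\<close>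

definition dtheta :: "'p::prime_card dcochain \<Rightarrow> 'p dcochain" where
  "dtheta F = central_diff (base_insert (orbit_sum (base_insert (central_diff F))))"

lemma additive_dtheta: "additive dtheta"
  by unfold_locales (simp add: dtheta_def central_diff.add base_insert.add orbit_sum.add)

interpretation dtheta: additive dtheta by (rule additive_dtheta)

definition theta :: "'p::prime_card xcochain \<Rightarrow> 'p xcochain" where
  "theta f = pushdown (dtheta (pullback f))"

lemma theta_add: "theta (f + g) = theta f + theta g"
  by (simp add: theta_def pullback.add dtheta.add pushdown.add)

lemma theta_base_independent: "base_independent f \<Longrightarrow> theta f = 0"
  by (simp add: theta_def dtheta_def central_diff_base_independent base_insert.zero orbit_sum.zero central_diff.zero pushdown.zero)

text \<open>Two rearrangements of sums over a triangle, used to compute with the term \<open>W\<close> in \<open>cup_zigzag\<close>: two triangles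
  fill a rectangle, and moving a triangle along its diagonal changes only its edges.\<close>

lemma double_sum_square:
  fixes g :: "nat \<Rightarrow> nat \<Rightarrow> 'a::comm_monoid_add"
  shows "(\<Sum>i<n. \<Sum>j<i. g i (Suc j) + g j i) = (\<Sum>i<n. \<Sum>j\<in>{1..<n}. g i j)"
proof (induction n)
  case (Suc n)
  show ?case
  proof (cases n)
    case (Suc m)
    have 1: "(\<Sum>j\<in>{1..<Suc n}. g n j) = (\<Sum>j<n. g n (Suc j))"
      by (rule sum.reindex_bij_witness[of _ Suc "\<lambda>j. j - 1"]) auto
    have 2: "(\<Sum>i<n. \<Sum>j\<in>{1..<Suc n}. g i j) = (\<Sum>i<n. \<Sum>j\<in>{1..<n}. g i j) + (\<Sum>i<n. g i n)"
      unfolding sum.distrib[symmetric] using Suc by (intro sum.cong) simp_all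
    show ?thesis
      unfolding sum.lessThan_Suc[of _ n] Suc.IH 1 2 sum.distrib[of _ "\<lambda>j. g j n" "{..<n}"]
      by (simp only: sum.distrib add_ac)
  qed simp
qed simp

lemma double_sum_shift:
  fixes h :: "nat \<Rightarrow> nat \<Rightarrow> 'a::ab_group_add"
  shows "(\<Sum>i<n. \<Sum>j<i. h (Suc i) (Suc (Suc j))) - (\<Sum>i<n. \<Sum>j<i. h i (Suc j))
    = (\<Sum>j<n. h n (Suc j)) - (\<Sum>i<n. h (Suc i) 1)"
proof (induction n)
  case (Suc n)
  have "(\<Sum>j<Suc n. h (Suc n) (Suc j)) = h (Suc n) 1 + (\<Sum>j<n. h (Suc n) (Suc (Suc j)))"
    by (subst sum.lessThan_Suc_shift) simp
  then show ?case using Suc by (simp add: algebra_simps)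
qed simp

context
  assumes odd_card: "odd CARD('p::prime_card)"
begin

lemma dcoboundary_dtheta: "dcoboundary (dtheta (F :: 'p dcochain)) = dtheta (dcoboundary F)"
  unfolding dtheta_def
  by (simp add: dcoboundary_central_diff dcoboundary_orbit_sum dcoboundary_base_insert[OF odd_card] central_diff.diff orbit_sum.diff base_insert.diff
      central_diff_even_part[OF odd_card, symmetric] orbit_sum_odd_part[OF odd_card, symmetric] central_diff_odd_part[OF odd_card]
      central_diff.zero base_insert.zero orbit_sum.zero
      central_diff.minus base_insert.minus orbit_sum.minus central_diff.add)

lemma reflect_dtheta: "reflect F = F \<Longrightarrow> reflect (dtheta F) = dtheta F"
  by (simp add: dtheta_def reflect_central_diff reflect_base_insert reflect_orbit_sum
      base_insert.minus orbit_sum.minus central_diff.minus)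

text \<open>Any zigzag from \<open>F\<close> computes the class of \<open>dtheta F\<close>, not only the one given by the homotopy: two choices of
  \<open>a\<close>, made odd, differ by an odd cocycle, which is a coboundary, and then the same holds for \<open>b\<close>.\<close>

lemma dtheta_zigzag:
  fixes F :: "'p dcochain"
  assumes "reflect F = F" "dcoboundary F = 0" "central_diff F = dcoboundary a" "orbit_sum a = dcoboundary b"
  shows "\<exists>u. dtheta F = even_part (central_diff b) - dcoboundary u"
proof -
  define a' where "a' = base_insert (central_diff F)"
  define b' where "b' = base_insert (orbit_sum a')"
  have ra: "reflect a' = - a'"
    by (simp add: a'_def reflect_base_insert reflect_central_diff assms(1) base_insert.minus)
  have da: "dcoboundary a' = central_diff F"
    by (simp add: a'_def dcoboundary_base_insert[OF odd_card] dcoboundary_central_diff[symmetric] assms(1,2) odd_part_odd reflect_central_diff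
       base_insert.zero central_diff.zero dcoboundary.zero)
       (simp add: dcoboundary_central_diff assms(2) central_diff.zero base_insert.zero)
  have db: "dcoboundary b' = orbit_sum a'"
    unfolding b'_def
    by (rule odd_cocycle_exact[OF odd_card, symmetric])
      (simp_all add: reflect_orbit_sum ra orbit_sum.minus dcoboundary_orbit_sum da)
  have rb: "reflect b' = - b'"
    by (simp add: b'_def reflect_base_insert reflect_orbit_sum ra orbit_sum.minus base_insert.minus)
  define v where "v = base_insert (odd_part a - a')"
  have v: "odd_part a - a' = dcoboundary v"
    unfolding v_def
    by (rule odd_cocycle_exact[OF odd_card])
      (simp_all add: reflect_odd_part[OF odd_card] reflect.diff ra dcoboundary.diff dcoboundary_odd_part da assms(3)[symmetric]
        odd_part_odd reflect_central_diff assms(1))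
  have rv: "reflect v = - v"
    by (simp add: v_def reflect_base_insert reflect.diff reflect_odd_part[OF odd_card] ra base_insert.diff base_insert.minus)
  define w where "w = base_insert (odd_part b - b' - orbit_sum v)"
  have w: "odd_part b - b' - orbit_sum v = dcoboundary w"
    unfolding w_def
  proof (rule odd_cocycle_exact[OF odd_card])
    show "reflect (odd_part b - b' - orbit_sum v) = - (odd_part b - b' - orbit_sum v)"
      by (simp add: reflect_odd_part[OF odd_card] reflect.diff rb reflect_orbit_sum rv orbit_sum.minus)
    show "dcoboundary (odd_part b - b' - orbit_sum v) = 0"
      by (simp add: dcoboundary.diff dcoboundary_odd_part db dcoboundary_orbit_sum v[symmetric] orbit_sum.diff
          assms(4)[symmetric] orbit_sum_odd_part[OF odd_card])
  qed
  have "dtheta F = central_diff b'" by (simp add: dtheta_def b'_def a'_def)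
  also have "b' = odd_part b - orbit_sum v - dcoboundary w" using w by (simp add: algebra_simps)
  also have "central_diff \<dots> = even_part (central_diff b) - dcoboundary (central_diff w)"
    by (simp add: central_diff.diff central_diff_odd_part[OF odd_card] dcoboundary_central_diff)
  finally show ?thesis by blast
qed

text \<open>The Leibniz rule for \<open>\<Theta>\<close>. Write \<open>T\<close> and \<open>S\<close> for the translations by 1 and \<open>-1\<close>. Since they are algebra
  automorphisms, \<open>\<Delta> (f1 f2) = (\<Delta> f1) (T f2) + (S f1) (\<Delta> f2)\<close>, which suggests \<open>a\<close>. In the orbit sum of \<open>a\<close>, replace the
  translates of \<open>f1\<close> and \<open>f2\<close> by \<open>f1\<close> and \<open>f2\<close> themselves; the differences are the coboundaries of partial orbit
  sums of \<open>a1\<close> and \<open>a2\<close>. They contribute the term \<open>W\<close> of \<open>b\<close>, a sum over a triangle of products of translates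
  of \<open>a1\<close> and \<open>a2\<close>. What remains is a product with the factor \<open>d (N a1) = d (d b1) = 0\<close>.
  Applying \<open>\<Delta>\<close> to \<open>W\<close> only leaves the edges of the triangle, where one of the factors has become
  an orbit sum.\<close>

lemma cup_zigzag:
  fixes f1 f2 a1 a2 b1 b2 :: "'p dcochain"
  assumes f: "dcoboundary f1 = 0" "dcoboundary f2 = 0"
    and a: "central_diff f1 = dcoboundary a1" "central_diff f2 = dcoboundary a2"
    and b: "orbit_sum a1 = dcoboundary b1" "orbit_sum a2 = dcoboundary b2"
  shows "\<exists>a b c. central_diff (f1 \<star> f2) = dcoboundary a \<and> orbit_sum a = dcoboundary b
    \<and> central_diff b = central_diff b1 \<star> f2 + f1 \<star> central_diff b2 + dcoboundary c"
proof -
  let ?p = "CARD('p)" and ?T = "translate 1 :: 'p dcochain \<Rightarrow> _" and ?S = "translate (-1) :: 'p dcochain \<Rightarrow> _"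
  define x where "x i = translate (2 * of_nat i) a1" for i :: nat
  define y where "y i = translate (2 * of_nat i) a2" for i :: nat
  define W where "W = (\<Sum>i<?p. \<Sum>j<i. x i \<star> signed (y (Suc j)))"
  define a where "a = a1 \<star> signed (?T f2) + ?S f1 \<star> a2"
  define b where "b = b1 \<star> ?T f2 + ?S f1 \<star> b2 - W"
  define c where "c = ?T b1 \<star> ?T a2 + ?S a1 \<star> signed (?S b2)"
  have sx: "(\<Sum>i<?p. x i) = dcoboundary b1" and sy: "(\<Sum>i<?p. y i) = dcoboundary b2"
    using b by (simp_all add: x_def y_def orbit_sum_nat[OF odd_card])
  have T_inv: "?T (dcoboundary b1) = dcoboundary b1" "?S (dcoboundary b2) = dcoboundary b2" "translate 2 (dcoboundary b2) = dcoboundary b2"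
      "translate 2 (dcoboundary b1) = dcoboundary b1" "?S (dcoboundary b1) = dcoboundary b1"
    by (simp_all add: b[symmetric] translate_orbit_sum)
  have 1: "central_diff (f1 \<star> f2) = dcoboundary a"
  proof -
    have "central_diff (f1 \<star> f2) = central_diff f1 \<star> ?T f2 + ?S f1 \<star> central_diff f2"
      by (simp add: central_diff_def translate_cup cupl.diff cupr.diff)
    then show ?thesis
      by (simp add: a a_def dcoboundary.add cup_Leibniz dcoboundary_signed dcoboundary_translate f signed.zero translate.zero
          cupl.zero cupr.zero)
  qed
  have f2_shift: "translate (2 * of_nat i) (?T f2) = ?T f2 + (\<Sum>j<i. dcoboundary (y (Suc j)))" for i
  proof -
    have "central_diff (translate (2 * of_nat j + 1) (?T f2)) = dcoboundary (y (Suc j))" for j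
    proof -
      have "central_diff (translate (2 * of_nat j + 1) (?T f2)) = translate (2 * of_nat (Suc j)) (central_diff f2)"
        by (simp add: central_diff_def translate_translate translate.diff algebra_simps)
      then show ?thesis by (simp add: a y_def dcoboundary_translate)
    qed
    then show ?thesis
      using translate_minus_telescope[OF odd_card, of i "?T f2"]
      by (simp add: central_diff.sum diff_eq_eq add.commute)
  qed
  have f1_shift: "translate (2 * of_nat i) (?S f1) = ?S f1 + (\<Sum>j<i. dcoboundary (x j))" for i
  proof -
    have "central_diff (translate (2 * of_nat j + 1) (?S f1)) = dcoboundary (x j)" for j
    proof -
      have "central_diff (translate (2 * of_nat j + 1) (?S f1)) = translate (2 * of_nat j) (central_diff f1)"
        by (simp add: central_diff_def translate_translate translate.diff algebra_simps)
      then show ?thesis by (simp add: a x_def dcoboundary_translate)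
    qed
    then show ?thesis
      using translate_minus_telescope[OF odd_card, of i "?S f1"]
      by (simp add: central_diff.sum diff_eq_eq add.commute)
  qed
  \<comment> \<open>moves \<open>d\<close> from the second factor to the first, at the cost of a coboundary\<close>
  have swap: "x i \<star> signed (dcoboundary (y j)) = dcoboundary (x i) \<star> y j - dcoboundary (x i \<star> signed (y j))"
    for i j
    by (simp add: cup_Leibniz dcoboundary_signed cupr.minus)
  have 2: "orbit_sum a = dcoboundary b"
  proof -
    have "orbit_sum a = (\<Sum>i<?p. x i \<star> signed (translate (2 * of_nat i) (?T f2))
        + translate (2 * of_nat i) (?S f1) \<star> y i)"
      by (simp add: orbit_sum_nat[OF odd_card] a_def translate.add translate_cup signed_translate x_def y_def)
    also have "\<dots> = (\<Sum>i<?p. x i \<star> signed (?T f2)) + (\<Sum>i<?p. ?S f1 \<star> y i)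
        + (\<Sum>i<?p. \<Sum>j<i. dcoboundary (x i) \<star> y (Suc j) + dcoboundary (x j) \<star> y i) - dcoboundary W"
      unfolding f1_shift f2_shift W_def
      by (simp add: signed.add signed.sum cupr.add cupl.add cupr.sum cupl.sum sum.distrib swap
          sum_subtractf dcoboundary.sum)
    also have "(\<Sum>i<?p. x i \<star> signed (?T f2)) = dcoboundary b1 \<star> signed (?T f2)"
      by (simp add: cupl.sum[symmetric] sx)
    also have "(\<Sum>i<?p. ?S f1 \<star> y i) = ?S f1 \<star> dcoboundary b2"
      by (simp add: cupr.sum[symmetric] sy)
    also have "(\<Sum>i<?p. \<Sum>j<i. dcoboundary (x i) \<star> y (Suc j) + dcoboundary (x j) \<star> y i) = 0"
    proof -
      have "(\<Sum>i<?p. \<Sum>j<i. dcoboundary (x i) \<star> y (Suc j) + dcoboundary (x j) \<star> y i)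
          = (\<Sum>i<?p. \<Sum>j\<in>{1..<?p}. dcoboundary (x i) \<star> y j)"
        by (rule double_sum_square)
      also have "\<dots> = dcoboundary (\<Sum>i<?p. x i) \<star> (\<Sum>j\<in>{1..<?p}. y j)"
        by (simp only: dcoboundary.sum cupl.sum cupr.sum) (rule sum.swap)
      finally show ?thesis by (simp only: sx dcoboundary_dcoboundary cupl.zero)
    qed
    also have "dcoboundary b1 \<star> signed (?T f2) + ?S f1 \<star> dcoboundary b2 + 0 - dcoboundary W = dcoboundary b"
      by (simp add: b_def dcoboundary.add dcoboundary.diff cup_Leibniz dcoboundary_translate f translate.zero cupl.zero cupr.zero)
    finally show ?thesis .
  qed
  have W: "central_diff W = ?S a1 \<star> signed (dcoboundary b2) - dcoboundary b1 \<star> signed (?T a2)"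
  proof -
    let ?h = "\<lambda>i j. x i \<star> signed (y j)"
    have "translate 2 W = (\<Sum>i<?p. \<Sum>j<i. ?h (Suc i) (Suc (Suc j)))"
      unfolding W_def translate.sum translate_cup signed_translate[symmetric]
      by (simp add: x_def y_def translate_translate distrib_left)
    then have "translate 2 W - W = (\<Sum>j<?p. ?h ?p (Suc j)) - (\<Sum>i<?p. ?h (Suc i) 1)"
      unfolding W_def using double_sum_shift[of ?h ?p] by simp
    also have "(\<Sum>j<?p. ?h ?p (Suc j)) = a1 \<star> signed (dcoboundary b2)"
    proof -
      \<comment> \<open>\<open>x p\<close> is the translate of \<open>a1\<close> by \<open>2 p = 0\<close>\<close>
      have "x ?p = a1" by (simp add: x_def)
      moreover have "(\<Sum>j<?p. y (Suc j)) = dcoboundary b2"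
      proof -
        have "(\<Sum>j<?p. y (Suc j)) = translate 2 (\<Sum>j<?p. y j)"
          by (simp add: y_def translate_translate distrib_left translate.sum)
        then show ?thesis by (simp only: sy T_inv)
      qed
      ultimately show ?thesis by (simp add: cupr.sum[symmetric] signed.sum[symmetric])
    qed
    also have "(\<Sum>i<?p. ?h (Suc i) 1) = dcoboundary b1 \<star> signed (translate 2 a2)"
    proof -
      have "(\<Sum>i<?p. x (Suc i)) = dcoboundary b1"
      proof -
        have "(\<Sum>i<?p. x (Suc i)) = translate 2 (\<Sum>i<?p. x i)"
          by (simp add: x_def translate_translate distrib_left translate.sum)
        then show ?thesis by (simp only: sx T_inv)
      qed
      then show ?thesis by (simp add: cupl.sum[symmetric] y_def)
    qed
    finally have "?S (translate 2 W - W) = ?S (a1 \<star> signed (dcoboundary b2) - dcoboundary b1 \<star> signed (translate 2 a2))"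
      by (rule arg_cong)
    then show ?thesis
      by (simp add: translate.diff translate_translate central_diff_def translate_cup signed_translate[symmetric] T_inv)
  qed
  have 3: "central_diff b = central_diff b1 \<star> f2 + f1 \<star> central_diff b2 + dcoboundary c"
  proof -
    have e2: "translate 2 f2 = f2 + dcoboundary (?T a2)"
    proof -
      have "?T (central_diff f2) = translate 2 f2 - f2"
        by (simp add: central_diff_def translate.diff translate_translate)
      then show ?thesis by (simp add: a dcoboundary_translate)
    qed
    have e1: "translate (-2) f1 = f1 - dcoboundary (?S a1)"
    proof -
      have "?S (central_diff f1) = f1 - translate (-2) f1"
        by (simp add: central_diff_def translate.diff translate_translate)
      then show ?thesis by (simp add: a dcoboundary_translate)
    qed
    have "central_diff b = (?T b1 \<star> translate 2 f2 - ?S b1 \<star> f2)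
        + (f1 \<star> ?T b2 - translate (-2) f1 \<star> ?S b2) - central_diff W"
      by (simp add: b_def central_diff_def translate.add translate.diff translate_cup translate_translate)
    also have "\<dots> = central_diff b1 \<star> f2 + f1 \<star> central_diff b2
        + (dcoboundary b1 \<star> signed (?T a2) + ?T b1 \<star> dcoboundary (?T a2))
        + (dcoboundary (?S a1) \<star> ?S b2 - ?S a1 \<star> signed (dcoboundary b2))"
      unfolding e1 e2 W by (simp add: central_diff_def cupl.diff cupr.diff cupl.add cupr.add)
    also have "dcoboundary b1 \<star> signed (?T a2) + ?T b1 \<star> dcoboundary (?T a2) = dcoboundary (?T b1 \<star> ?T a2)"
      by (simp add: cup_Leibniz dcoboundary_translate[of _ b1] T_inv)
    also have "dcoboundary (?S a1) \<star> ?S b2 - ?S a1 \<star> signed (dcoboundary b2) = dcoboundary (?S a1 \<star> signed (?S b2))"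
      by (simp add: cup_Leibniz dcoboundary_signed dcoboundary_translate[of _ b2] T_inv cupr.minus)
    finally show ?thesis by (simp only: c_def dcoboundary.add add.assoc)
  qed
  from 1 2 3 show ?thesis by blast
qed

text \<open>A zigzag is extended to the left, from \<open>\<Delta> b\<close> to a cocycle \<open>f\<close>, with exactness of translations in each step.
  The candidate for \<open>f\<close> has a base-independent coboundary, and \<open>base_independent_exact\<close> allows to correct it
  by a base-independent cochain, which \<open>\<Delta>\<close> does not see.\<close>

lemma lift_zigzag:
  fixes b :: "'p dcochain"
  assumes "dcoboundary (central_diff b) = 0"
  shows "\<exists>f a. rack_coboundary f = 0 \<and> central_diff (pullback f) = dcoboundary a \<and> orbit_sum a = dcoboundary (odd_part b)"
proof -
  obtain a0 where a0: "dcoboundary b = orbit_sum a0"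
    using central_diff_kernel[OF odd_card, of "dcoboundary b"] assms by (auto simp: dcoboundary_central_diff)
  have "orbit_sum (dcoboundary a0) = 0" by (simp add: dcoboundary_orbit_sum[symmetric] a0[symmetric])
  then obtain F0 where F0: "dcoboundary a0 = central_diff F0" using orbit_sum_kernel[OF odd_card] by blast
  define f0 where "f0 = pushdown F0"
  have f0: "pullback f0 = even_part F0" by (simp add: f0_def pullback_pushdown)
  define a where "a = odd_part a0"
  have 1: "central_diff (pullback f0) = dcoboundary a"
    by (simp add: f0 central_diff_even_part[OF odd_card] F0[symmetric] a_def dcoboundary_odd_part)
  have 2: "orbit_sum a = dcoboundary (odd_part b)"
    by (simp add: a_def orbit_sum_odd_part[OF odd_card] a0[symmetric] dcoboundary_odd_part)
  have "base_independent (rack_coboundary f0)"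
    by (simp add: base_independent_iff[OF odd_card] dcoboundary_pullback[symmetric] dcoboundary_central_diff[symmetric] 1)
  then obtain w where w: "base_independent w" "rack_coboundary f0 = rack_coboundary w"
    using base_independent_exact[OF odd_card] by blast
  have "rack_coboundary (f0 - w) = 0" by (simp add: rack_coboundary_minus w)
  moreover have "central_diff (pullback (f0 - w)) = dcoboundary a"
    by (simp add: pullback.diff central_diff.diff 1 central_diff_base_independent[OF w(1)])
  ultimately show ?thesis using 2 by blast
qed

lemma pullback_theta: "pullback (theta (f :: 'p xcochain)) = dtheta (pullback f)"
  by (simp add: theta_def even_eq_pullback[OF odd_card] reflect_dtheta)

lemma rack_coboundary_theta:
  "rack_coboundary (theta (f :: 'p xcochain)) = theta (rack_coboundary f)"
  by (simp add: theta_def pushdown_dcoboundary[OF odd_card, symmetric] dcoboundary_dtheta dcoboundary_pullback)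

lemma canonical_zigzag:
  fixes f :: "'p xcochain"
  assumes "rack_coboundary f = 0"
  shows "\<exists>a b. central_diff (pullback f) = dcoboundary a \<and> orbit_sum a = dcoboundary b \<and> central_diff b = pullback (theta f)"
proof -
  define a where "a = base_insert (central_diff (pullback f))"
  have 1: "central_diff (pullback f) = dcoboundary a"
    unfolding a_def
    by (rule odd_cocycle_exact[OF odd_card])
      (simp_all add: reflect_central_diff dcoboundary_central_diff dcoboundary_pullback assms pullback.zero central_diff.zero)
  have "orbit_sum a = dcoboundary (base_insert (orbit_sum a))"
    by (rule odd_cocycle_exact[OF odd_card])
      (simp_all add: reflect_orbit_sum a_def reflect_base_insert reflect_central_diff base_insert.minus orbit_sum.minus
        dcoboundary_orbit_sum 1[unfolded a_def, symmetric])
  with 1 show ?thesis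
    by (intro exI[of _ a] exI[of _ "base_insert (orbit_sum a)"]) (simp add: pullback_theta dtheta_def a_def)
qed

lemma theta_zigzag:
  fixes f :: "'p xcochain"
  assumes "rack_coboundary f = 0" "central_diff (pullback f) = dcoboundary a" "orbit_sum a = dcoboundary b"
  shows "\<exists>u. theta f = pushdown (central_diff b) + rack_coboundary u"
proof -
  have "dcoboundary (pullback f) = 0" by (simp add: dcoboundary_pullback assms(1) pullback.zero)
  from dtheta_zigzag[OF _ this assms(2,3)]
  obtain u where "dtheta (pullback f) = even_part (central_diff b) - dcoboundary u" by auto
  then have "theta f = pushdown (even_part (central_diff b)) - pushdown (dcoboundary u)"
    by (simp add: theta_def pushdown.diff)
  also have "\<dots> = pushdown (central_diff b) + rack_coboundary (- pushdown u)"
    by (simp add: pullback_pushdown[symmetric] pushdown_pullback[OF odd_card]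
      pushdown_dcoboundary[OF odd_card] rack_coboundary_uminus)
  finally show ?thesis by blast
qed

lemma theta_cup:
  fixes f g :: "'p xcochain"
  assumes "rack_coboundary f = 0" "rack_coboundary g = 0"
  shows "\<exists>u. theta (cochain_cup f g) = cochain_cup (theta f) g + cochain_cup f (theta g) + rack_coboundary u"
proof -
  obtain a1 b1 where 1: "central_diff (pullback f) = dcoboundary a1" "orbit_sum a1 = dcoboundary b1" "central_diff b1 = pullback (theta f)"
    using canonical_zigzag[OF assms(1)] by blast
  obtain a2 b2 where 2: "central_diff (pullback g) = dcoboundary a2" "orbit_sum a2 = dcoboundary b2" "central_diff b2 = pullback (theta g)"
    using canonical_zigzag[OF assms(2)] by blast
  have c: "dcoboundary (pullback f) = 0" "dcoboundary (pullback g) = 0"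
    by (simp_all add: dcoboundary_pullback assms pullback.zero)
  from cup_zigzag[OF c 1(1) 2(1) 1(2) 2(2)]
  obtain a b c where 3: "central_diff (pullback f \<star> pullback g) = dcoboundary a" "orbit_sum a = dcoboundary b"
    "central_diff b = central_diff b1 \<star> pullback g + pullback f \<star> central_diff b2 + dcoboundary c" by blast
  have "rack_coboundary (cochain_cup f g) = 0" by (rule cochain_cup_closed[OF assms])
  from theta_zigzag[OF this 3(1)[unfolded cup_pullback] 3(2)]
  obtain u where "theta (cochain_cup f g) = pushdown (central_diff b) + rack_coboundary u" by blast
  also have "pushdown (central_diff b) = cochain_cup (theta f) g + cochain_cup f (theta g) + rack_coboundary (pushdown c)"
    unfolding 3(3) 1(3) 2(3) cup_pullback
    by (simp add: pushdown.add pushdown_pullback[OF odd_card] pushdown_dcoboundary[OF odd_card])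
  finally show ?thesis by (metis add.assoc rack_coboundary_plus)
qed

text \<open>By \<open>orbit_sum_exact\<close>, the cocycle \<open>g\<close> may be changed by a coboundary to make its orbit sum vanish. Then it is
  of the form \<open>\<Delta> b\<close> and \<open>lift_zigzag\<close> applies.\<close>

lemma theta_surjective:
  fixes g :: "'p xcochain"
  assumes "rack_coboundary g = 0"
  shows "\<exists>f u. rack_coboundary f = 0 \<and> theta f = g + rack_coboundary u"
proof -
  obtain u' where u': "orbit_sum (pullback g) = pullback (rack_coboundary u')"
    using orbit_sum_exact[OF odd_card assms] by blast
  then have "base_independent (rack_coboundary u')" unfolding base_independent_iff[OF odd_card] by (metis central_diff_orbit_sum)
  then obtain w where w: "base_independent w" "rack_coboundary u' = rack_coboundary w" using base_independent_exact[OF odd_card] by blast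
  obtain W where W: "pullback w = orbit_sum W" using central_diff_kernel[OF odd_card] central_diff_base_independent[OF w(1)] by blast
  have "orbit_sum (pullback g - dcoboundary W) = 0"
    by (simp add: orbit_sum.diff u' w(2) dcoboundary_orbit_sum[symmetric] W[symmetric] dcoboundary_pullback)
  then obtain b where b: "pullback g - dcoboundary W = central_diff b" using orbit_sum_kernel[OF odd_card] by blast
  have "dcoboundary (central_diff b) = 0"
    by (simp add: b[symmetric] dcoboundary.diff dcoboundary_pullback assms pullback.zero)
  from lift_zigzag[OF this] obtain f a where
    f: "rack_coboundary f = 0" "central_diff (pullback f) = dcoboundary a" "orbit_sum a = dcoboundary (odd_part b)" by blast
  from theta_zigzag[OF f] obtain u where "theta f = pushdown (central_diff (odd_part b)) + rack_coboundary u"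
    by blast
  also have "pushdown (central_diff (odd_part b)) = pushdown (central_diff b)"
    by (simp add: central_diff_odd_part[OF odd_card] pullback_pushdown[symmetric] pushdown_pullback[OF odd_card])
  also have "\<dots> = g - rack_coboundary (pushdown W)"
    by (simp add: b[symmetric] pushdown.diff pushdown_pullback[OF odd_card] pushdown_dcoboundary[OF odd_card])
  also have "\<dots> + rack_coboundary u = g + rack_coboundary (u - pushdown W)"
    by (simp add: rack_coboundary_minus)
  finally show ?thesis using f(1) by blast
qed

end

section \<open>The kernel of theta\<close>

text \<open>A zigzag that starts at \<open>B\<close>, passes through \<open>\<theta> B \<sim> 0\<close> and arrives at the unit: it exhibits \<open>B\<close> as the element
  of the kernel of \<open>\<Theta>\<close> that corresponds to \<open>1\<close>.\<close>

definition zigzag_to_one :: "'p::prime_card xcochain \<Rightarrow> 'p dcochain \<Rightarrow> 'p dcochain \<Rightarrow> 'p dcochain \<Rightarrow> bool" where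
  "zigzag_to_one B a b c \<longleftrightarrow> rack_coboundary B = 0 \<and> central_diff (pullback B) = dcoboundary a \<and> orbit_sum a = dcoboundary b
     \<and> central_diff b = dcoboundary c \<and> orbit_sum c = pullback cochain_one"

lemma cochain_cup_one_left: "cochain_cup cochain_one f = f"
proof -
  have 1: "coproduct (\<lambda>l r. if symdeg l = 0 then G r else 0) z = G z"
    for G :: "'a symbol \<Rightarrow> 'b" and z
  proof (induction z arbitrary: G rule: symbol_snoc_induct)
    case (snoc z x)
    have "(\<lambda>l r. (-1) ^ symdeg l * (if symdeg l = 0 then G (snoc r x) else 0)
        + (if symdeg (snoc l x) = 0 then G (act r x) else 0))
      = (\<lambda>l r. if symdeg l = 0 then (\<lambda>r. G (snoc r x)) r else 0)" for x :: 'a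
      by (simp add: fun_eq_iff)
    with snoc[of "\<lambda>r. G (snoc r x)"] show ?case by (simp only: coproduct_snoc)
  qed (simp add: coproduct_0)
  have 2: "(\<lambda>l r. cochain_one l * f r) = (\<lambda>l r. if symdeg l = 0 then f r else 0)"
    by (simp add: cochain_one_def fun_eq_iff)
  show ?thesis by (intro ext) (simp only: cochain_cup_eq 1 2)
qed

lemma cochain_cup_one_right: "cochain_cup f cochain_one = f"
proof -
  have 1: "coproduct (\<lambda>l r. if symdeg r = 0 then G l else 0) z = G z"
    for G :: "'a symbol \<Rightarrow> 'b" and z
  proof (induction z arbitrary: G rule: symbol_snoc_induct)
    case (snoc z x)
    have "(\<lambda>l r. (-1) ^ symdeg l * (if symdeg (snoc r x) = 0 then G l else 0)
        + (if symdeg (act r x) = 0 then G (snoc l x) else 0))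
      = (\<lambda>l r. if symdeg r = 0 then (\<lambda>l. G (snoc l x)) l else 0)" for x :: 'a
      by (simp add: fun_eq_iff)
    with snoc[of "\<lambda>l. G (snoc l x)"] show ?case by (simp only: coproduct_snoc)
  qed (simp add: coproduct_0)
  have 2: "(\<lambda>l r. f l * cochain_one r) = (\<lambda>l r. if symdeg r = 0 then f l else 0)"
    by (simp add: cochain_one_def fun_eq_iff)
  show ?thesis by (intro ext) (simp only: cochain_cup_eq 1 2)
qed

lemma rack_coboundary_one: "rack_coboundary cochain_one = 0"
  using cohomologous_one unfolding cohomologous_refl_iff by blast

context
  assumes odd_card: "odd CARD('p::prime_card)"
begin

text \<open>Start from the 0-cochain that is 1 above the point 0 of \<open>X\<close>, whose orbit sum is \<open>1\<close>, and lift.\<close>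

lemma zigzag_to_one_exists: "\<exists>(B :: 'p xcochain) a b c. zigzag_to_one B a b c"
proof -
  define c0 :: "'p dcochain" where "c0 = restrict_base (pullback cochain_one)"
  have inv: "base_independent (cochain_one :: 'p xcochain)" using base_independent_one[of 1] by simp
  have "orbit_sum c0 = pullback cochain_one"
  proof -
    have "(\<Sum>t\<in>UNIV. translate (- t) c0) = pullback cochain_one"
      using base_partition[OF odd_card, of "pullback cochain_one"]
      by (simp add: c0_def translate_invariant[OF odd_card central_diff_base_independent[OF inv]])
    moreover have "orbit_sum c0 = (\<Sum>t\<in>UNIV. translate (- t) c0)"
      unfolding orbit_sum_def by (rule sum.reindex_bij_witness[of _ uminus uminus]) auto
    ultimately show ?thesis by simp
  qed
  moreover have "rack_coboundary cochain_one = (0 :: 'p xcochain)"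
    using cohomologous_one unfolding cohomologous_refl_iff by blast
  ultimately have "orbit_sum (dcoboundary c0) = 0"
    by (simp add: dcoboundary_orbit_sum[symmetric] dcoboundary_pullback pullback.zero)
  then obtain b where b: "dcoboundary c0 = central_diff b" using orbit_sum_kernel[OF odd_card] by blast
  have "dcoboundary (central_diff b) = 0" by (simp add: b[symmetric])
  from lift_zigzag[OF odd_card this] obtain B a where
    B: "rack_coboundary B = 0" "central_diff (pullback B) = dcoboundary a" "orbit_sum a = dcoboundary (odd_part b)" by blast
  have "central_diff (odd_part b) = dcoboundary (even_part c0)"
    by (simp add: central_diff_odd_part[OF odd_card] b[symmetric] dcoboundary_even_part)
  moreover have "orbit_sum (even_part c0) = pullback cochain_one"
    by (simp add: orbit_sum_even_part[OF odd_card] \<open>orbit_sum c0 = _\<close> even_part_even[OF odd_card])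
  ultimately show ?thesis using B unfolding zigzag_to_one_def by blast
qed

lemma cup_invariant_right:
  fixes F V :: "'p dcochain"
  assumes "central_diff V = 0"
  shows "central_diff (F \<star> V) = central_diff F \<star> V" "orbit_sum (F \<star> V) = orbit_sum F \<star> V"
  unfolding central_diff_def orbit_sum_def
  by (simp_all add: translate_cup translate_invariant[OF odd_card assms] cupl.diff cupl.sum)

text \<open>Multiplying the zigzag from the right by a translation-invariant cocycle \<open>W\<close> is compatible with all maps in it.
  The signs in the Leibniz rule alternate \<open>W\<close> with \<open>signed W\<close>.\<close>

lemma zigzag_to_one_cup:
  fixes W :: "'p dcochain"
  assumes "zigzag_to_one B a b c" "dcoboundary W = 0" "central_diff W = 0" "W = pullback w"
  shows "central_diff (pullback B \<star> signed W) = dcoboundary (a \<star> W)"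
    "orbit_sum (a \<star> W) = dcoboundary (b \<star> signed W)"
    "central_diff (b \<star> signed W) = dcoboundary (c \<star> W)"
    "orbit_sum (c \<star> W) = W"
proof -
  have sW: "dcoboundary (signed W) = 0" "central_diff (signed W) = 0"
    using assms(2,3) by (simp_all add: dcoboundary_signed signed_central_diff[symmetric] signed.zero)
  note B = assms(1)[unfolded zigzag_to_one_def]
  show "central_diff (pullback B \<star> signed W) = dcoboundary (a \<star> W)"
    using B by (simp add: cup_invariant_right sW cup_Leibniz assms(2) cupr.zero)
  show "orbit_sum (a \<star> W) = dcoboundary (b \<star> signed W)"
    using B by (simp add: cup_invariant_right assms(3) cup_Leibniz sW cupr.zero)
  show "central_diff (b \<star> signed W) = dcoboundary (c \<star> W)"
    using B by (simp add: cup_invariant_right sW cup_Leibniz assms(2) cupr.zero)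
  show "orbit_sum (c \<star> W) = W"
    using B by (simp add: cup_invariant_right assms(3), simp add: assms(4) cup_pullback cochain_cup_one_left)
qed

text \<open>If \<open>\<theta> f = d v\<close>, the zigzag of \<open>f\<close> continues to the base-independent cocycle \<open>W = N v\<close>. Subtracting the zigzag of
  \<open>B\<close> times \<open>W\<close> makes \<open>N v\<close> vanish. Then exactness of translations can be applied three times, from right to
  left, and shows that \<open>f - B w\<close> is base-independent up to a coboundary.\<close>

lemma theta_kernel:
  fixes f v B :: "'p xcochain"
  assumes B: "zigzag_to_one B a b c" and f: "rack_coboundary f = 0" "theta f = rack_coboundary v"
  shows "\<exists>w0 w u. base_independent w0 \<and> base_independent w \<and> rack_coboundary w = 0 \<and> rack_coboundary w0 = 0 \<and>
     f = w0 + cochain_cup B w + rack_coboundary u"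
proof -
  obtain a0 b0 where z: "central_diff (pullback f) = dcoboundary a0" "orbit_sum a0 = dcoboundary b0" "central_diff b0 = pullback (theta f)"
    using canonical_zigzag[OF odd_card f(1)] by blast
  have cb0: "central_diff b0 = dcoboundary (pullback v)" by (simp add: z f(2) dcoboundary_pullback)
  define w' where "w' = pushdown (orbit_sum (pullback v))"
  define W where "W = orbit_sum (pullback v)"
  have W: "W = pullback w'"
    by (simp add: w'_def W_def even_eq_pullback[OF odd_card] reflect_orbit_sum)
  have cW: "dcoboundary W = 0" by (simp add: W_def dcoboundary_orbit_sum cb0[symmetric])
  have dW: "central_diff W = 0" by (simp add: W_def)
  define w where "w = alternate w'"
  have w: "pullback w = signed W" by (simp add: w_def W pullback_alternate)
  note BW = zigzag_to_one_cup[OF B cW dW W]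
  have "orbit_sum (pullback v - c \<star> W) = 0" by (simp add: orbit_sum.diff BW W_def[symmetric])
  then obtain q3 where q3: "pullback v - c \<star> W = central_diff q3" using orbit_sum_kernel[OF odd_card] by blast
  \<comment> \<open>from here on, each step moves one place to the left in the zigzag\<close>
  have "central_diff (b0 - b \<star> signed W - dcoboundary q3) = 0"
    by (simp add: central_diff.diff cb0 BW dcoboundary_central_diff[symmetric] q3[symmetric] dcoboundary.diff)
  then obtain q2 where q2: "b0 - b \<star> signed W - dcoboundary q3 = orbit_sum q2" using central_diff_kernel[OF odd_card] by blast
  have "orbit_sum (a0 - a \<star> W - dcoboundary q2) = 0"
    by (simp add: orbit_sum.diff z BW dcoboundary_orbit_sum[symmetric] q2[symmetric] dcoboundary.diff)
  then obtain q1 where q1: "a0 - a \<star> W - dcoboundary q2 = central_diff q1" using orbit_sum_kernel[OF odd_card] by blast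
  define X where "X = pullback f - pullback B \<star> signed W - dcoboundary q1"
  have X: "central_diff X = 0"
    by (simp add: X_def central_diff.diff z BW dcoboundary_central_diff[symmetric] q1[symmetric] dcoboundary.diff)
  have "pushdown X = f - cochain_cup B w - rack_coboundary (pushdown q1)"
    by (simp add: X_def pushdown.diff w[symmetric] cup_pullback pushdown_pullback[OF odd_card] pushdown_dcoboundary[OF odd_card])
  then have eq: "f = pushdown X + cochain_cup B w + rack_coboundary (pushdown q1)"
    by (simp only: algebra_simps)
  have b1: "base_independent (pushdown X)"
    by (simp add: base_independent_iff[OF odd_card] pullback_pushdown central_diff_even_part[OF odd_card] X odd_part.zero)
  have b2: "base_independent w"
    by (simp add: base_independent_iff[OF odd_card] w signed_central_diff[symmetric] dW signed.zero)
  have "pullback (rack_coboundary w) = pullback 0"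
    by (simp add: dcoboundary_pullback[symmetric] w dcoboundary_signed cW signed.zero pullback.zero)
  then have c2: "rack_coboundary w = 0" by (simp only: pullback_inject[OF odd_card])
  have "rack_coboundary (cochain_cup B w) = 0"
    using B by (intro cochain_cup_closed c2) (simp add: zigzag_to_one_def)
  then have "rack_coboundary (pushdown X) = 0"
    using arg_cong[OF eq, of rack_coboundary] by (simp add: rack_coboundary_plus f(1))
  with b1 b2 c2 eq show ?thesis by blast
qed

text \<open>Here a zigzag of the coboundary \<open>d u\<close> ends in \<open>W\<close>. Comparing it with the trivial zigzag of \<open>d u\<close>, step by step as in
  \<open>dtheta_zigzag\<close>, shows that \<open>W\<close> is the orbit sum of a cocycle, which is exact by \<open>orbit_sum_exact\<close>.\<close>

lemma kernel_unique:
  fixes w0 w u B :: "'p xcochain"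
  assumes B: "zigzag_to_one B a b c" and w: "base_independent w0" "base_independent w" "rack_coboundary w = 0"
    and eq: "w0 + cochain_cup B w = rack_coboundary u"
  shows "\<exists>u1 u2. w = rack_coboundary u1 \<and> w0 = rack_coboundary u2"
proof -
  define W where "W = pullback (alternate w)"
  have sW: "signed W = pullback w" by (simp add: W_def pullback_alternate)
  have cW: "dcoboundary W = 0"
    by (simp add: W_def pullback_alternate dcoboundary_signed dcoboundary_pullback w pullback.zero signed.zero)
  have dW: "central_diff W = 0"
    by (simp add: W_def pullback_alternate signed_central_diff[symmetric] central_diff_base_independent[OF w(2)] signed.zero)
  note BW = zigzag_to_one_cup[OF B cW dW W_def]
  have "pullback w0 + pullback B \<star> signed W = dcoboundary (pullback u)"
    by (simp add: sW cup_pullback dcoboundary_pullback pullback.add[symmetric] eq)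
  then have "central_diff (pullback w0 + pullback B \<star> signed W) = central_diff (dcoboundary (pullback u))"
    by (rule arg_cong)
  then have 1: "dcoboundary (a \<star> W) = dcoboundary (central_diff (pullback u))"
    by (simp add: central_diff.add central_diff_base_independent[OF w(1)] BW dcoboundary_central_diff)
  define X where "X = odd_part (a \<star> W - central_diff (pullback u))"
  define q1 where "q1 = base_insert X"
  have q1: "X = dcoboundary q1"
    unfolding q1_def
    by (rule odd_cocycle_exact[OF odd_card])
      (simp_all add: X_def reflect_odd_part[OF odd_card] dcoboundary_odd_part dcoboundary.diff 1 odd_part.zero)
  have 2: "orbit_sum X = odd_part (dcoboundary (b \<star> signed W))"
    by (simp add: X_def orbit_sum_odd_part[OF odd_card] orbit_sum.diff BW)
  define Y where "Y = odd_part (b \<star> signed W - orbit_sum q1)"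
  define q2 where "q2 = base_insert Y"
  have q2: "Y = dcoboundary q2"
    unfolding q2_def
  proof (rule odd_cocycle_exact[OF odd_card])
    show "reflect Y = - Y" unfolding Y_def by (rule reflect_odd_part[OF odd_card])
    show "dcoboundary Y = 0"
      by (simp add: Y_def dcoboundary_odd_part dcoboundary.diff dcoboundary_orbit_sum q1[symmetric] 2 odd_part.diff
          odd_part_odd reflect_odd_part[OF odd_card])
  qed
  define x where "x = even_part (c \<star> W) - central_diff q2"
  have "dcoboundary x = 0"
    by (simp add: x_def dcoboundary.diff dcoboundary_even_part dcoboundary_central_diff q2[symmetric] Y_def central_diff_odd_part[OF odd_card]
        central_diff.diff BW)
  then have "rack_coboundary (pushdown x) = 0"
    by (simp add: pushdown_dcoboundary[OF odd_card, symmetric] pushdown.zero)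
  from orbit_sum_exact[OF odd_card this] obtain y where
    y: "orbit_sum (pullback (pushdown x)) = pullback (rack_coboundary y)" by blast
  have "orbit_sum (pullback (pushdown x)) = even_part (even_part W)"
    by (simp add: pullback_pushdown orbit_sum_even_part[OF odd_card] x_def orbit_sum.diff BW)
  also have "\<dots> = W" by (simp add: W_def even_part_even[OF odd_card])
  finally have "pullback (alternate w) = pullback (rack_coboundary y)" using y by (simp add: W_def)
  then have "alternate w = rack_coboundary y" by (simp only: pullback_inject[OF odd_card])
  then have "w = alternate (rack_coboundary y)" by (metis alternate_alternate)
  also have "\<dots> = rack_coboundary (- alternate y)"
    by (simp add: rack_coboundary_uminus rack_coboundary_alternate')
  finally have w1: "w = rack_coboundary (- alternate y)" .
  have "cochain_cup B w = rack_coboundary (cochain_cup B (- alternate y))"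
    unfolding w1 using B by (intro cochain_cup_exact_right) (simp add: zigzag_to_one_def)
  then have "w0 = rack_coboundary (u - cochain_cup B (- alternate y))"
    using eq by (simp only: rack_coboundary_minus) (metis add_diff_cancel_right')
  with w1 show ?thesis by blast
qed

end

section \<open>Truncation by degree\<close>

text \<open>Cutting cochains to the degrees in \<open>Q\<close> makes the constructions above homogeneous, respectively bounded, as the
  cohomology only consists of families of cocycles of bounded degree.\<close>

definition restrict_deg :: "(nat \<Rightarrow> bool) \<Rightarrow> ('x symbol \<Rightarrow> 'k::zero) \<Rightarrow> 'x symbol \<Rightarrow> 'k" where
  "restrict_deg Q f z = (if Q (symdeg z) then f z else 0)"

definition restrict_len :: "(nat \<Rightarrow> bool) \<Rightarrow> 'p::prime_card dcochain \<Rightarrow> 'p dcochain" where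
  "restrict_len Q F = (\<lambda>y xs. if Q (length xs) then F y xs else 0)"

lemma restrict_deg_add:
  fixes f g :: "'x symbol \<Rightarrow> 'k::monoid_add"
  shows "restrict_deg Q (f + g) = restrict_deg Q f + restrict_deg Q g"
  by (simp add: restrict_deg_def fun_eq_iff)

lemma restrict_deg_coboundary:
  "restrict_deg Q (rack_coboundary f) = rack_coboundary (restrict_deg (\<lambda>n. Q (Suc n)) f)"
proof
  fix z
  have "rack_coboundary (restrict_deg (\<lambda>n. Q (Suc n)) f) z
      = rack_coboundary (if Q (symdeg z) then f else 0) z"
    by (rule rack_coboundary_cong) (simp add: restrict_deg_def)
  then show "restrict_deg Q (rack_coboundary f) z = rack_coboundary (restrict_deg (\<lambda>n. Q (Suc n)) f) z"
    by (simp add: restrict_deg_def)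
qed

lemma restrict_deg_cup:
  assumes "f \<in> cochains k"
  shows "restrict_deg Q (cochain_cup f g) = cochain_cup f (restrict_deg (\<lambda>n. Q (k + n)) g)"
proof
  fix z
  have "cochain_cup f (restrict_deg (\<lambda>n. Q (k + n)) g) z
      = coproduct (\<lambda>l r. (if Q (symdeg z) then 1 else 0) * (f l * g r)) z"
    unfolding cochain_cup_eq
  proof (rule coproduct_cong)
    fix l r :: "'a symbol" assume "symdeg l + symdeg r = symdeg z"
    moreover have "f l = 0" if "symdeg l \<noteq> k" using assms that unfolding cochains_def by blast
    ultimately show "f l * restrict_deg (\<lambda>n. Q (k + n)) g r = (if Q (symdeg z) then 1 else 0) * (f l * g r)"
      by (cases "symdeg l = k") (auto simp: restrict_deg_def)
  qed
  then show "restrict_deg Q (cochain_cup f g) z = cochain_cup f (restrict_deg (\<lambda>n. Q (k + n)) g) z"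
    unfolding coproduct_cmul by (simp add: restrict_deg_def cochain_cup_eq)
qed

lemma restrict_len_pullback: "restrict_len Q (pullback f) = pullback (restrict_deg Q f)"
  by (simp add: restrict_len_def pullback_def restrict_deg_def fun_eq_iff)

lemma restrict_len_dcoboundary:
  "restrict_len Q (dcoboundary F) = dcoboundary (restrict_len (\<lambda>n. Q (Suc n)) F)"
proof (intro ext)
  fix y xs
  have "dcoboundary (restrict_len (\<lambda>n. Q (Suc n)) F) y xs = dcoboundary (if Q (length xs) then F else 0) y xs"
    by (rule dcoboundary_cong_length) (simp add: restrict_len_def)
  then show "restrict_len Q (dcoboundary F) y xs = dcoboundary (restrict_len (\<lambda>n. Q (Suc n)) F) y xs"
    by (simp add: restrict_len_def dcoboundary.zero)
qed

lemma restrict_len_translate: "restrict_len Q (translate t F) = translate t (restrict_len Q F)"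
  by (simp add: restrict_len_def translate_def)

lemma additive_restrict_len: "additive (restrict_len Q)"
  by unfold_locales (simp add: restrict_len_def fun_eq_iff)

interpretation restrict_len: additive "restrict_len Q" for Q by (rule additive_restrict_len)

lemma restrict_len_central_diff:
  "restrict_len Q (central_diff F) = central_diff (restrict_len Q F)"
  by (simp add: central_diff_def restrict_len.diff restrict_len_translate)

lemma restrict_len_orbit_sum: "restrict_len Q (orbit_sum F) = orbit_sum (restrict_len Q F)"
  by (simp add: orbit_sum_def restrict_len.sum restrict_len_translate)

lemma base_insert_restrict_len:
  "base_insert (restrict_len Q F) = restrict_len (\<lambda>n. Q (Suc n)) (base_insert F)"
  by (simp add: base_insert_def restrict_len_def fun_eq_iff)

lemma theta_restrict:
  "theta (restrict_deg Q f) = restrict_deg (\<lambda>n. Q (Suc (Suc n))) (theta f)"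
proof -
  have "dtheta (pullback (restrict_deg Q f)) = restrict_len (\<lambda>n. Q (Suc (Suc n))) (dtheta (pullback f))"
    unfolding dtheta_def restrict_len_pullback[symmetric] restrict_len_central_diff[symmetric]
      restrict_len_orbit_sum[symmetric] base_insert_restrict_len ..
  then show ?thesis
    by (simp add: theta_def pushdown_def restrict_len_def restrict_deg_def fun_eq_iff)
qed

lemma base_independent_restrict:
  "base_independent f \<Longrightarrow> base_independent (restrict_deg Q f)"
  by (simp add: base_independent_def restrict_deg_def)

lemma zigzag_to_one_restrict:
  assumes "zigzag_to_one B a b c"
  shows "zigzag_to_one (restrict_deg (\<lambda>n. n = 3) B) (restrict_len (\<lambda>n. n = 2) a)
    (restrict_len (\<lambda>n. n = 1) b) (restrict_len (\<lambda>n. n = 0) c)"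
proof -
  note B = assms[unfolded zigzag_to_one_def]
  have dcoboundary: "dcoboundary (restrict_len (\<lambda>n. n = 2) F) = restrict_len (\<lambda>n. n = 3) (dcoboundary F)"
    "dcoboundary (restrict_len (\<lambda>n. n = 1) F) = restrict_len (\<lambda>n. n = 2) (dcoboundary F)"
    "dcoboundary (restrict_len (\<lambda>n. n = 0) F) = restrict_len (\<lambda>n. n = 1) (dcoboundary F)" for F :: "'a dcochain"
    using restrict_len_dcoboundary[of "\<lambda>n. n = 3" F] restrict_len_dcoboundary[of "\<lambda>n. n = 2" F]
      restrict_len_dcoboundary[of "\<lambda>n. n = 1" F] by (simp_all add: numeral_2_eq_2 numeral_3_eq_3)
  have "rack_coboundary (restrict_deg (\<lambda>n. n = 3) B) = restrict_deg (\<lambda>n. n = 4) (rack_coboundary B)"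
    unfolding restrict_deg_coboundary by simp
  then have "rack_coboundary (restrict_deg (\<lambda>n. n = 3) B) = 0"
    using B by (simp add: restrict_deg_def fun_eq_iff)
  moreover have "central_diff (pullback (restrict_deg (\<lambda>n. n = 3) B)) = dcoboundary (restrict_len (\<lambda>n. n = 2) a)"
    unfolding restrict_len_pullback[symmetric] restrict_len_central_diff[symmetric] dcoboundary using B by simp
  moreover have "orbit_sum (restrict_len (\<lambda>n. n = 2) a) = dcoboundary (restrict_len (\<lambda>n. n = 1) b)"
    unfolding restrict_len_orbit_sum[symmetric] dcoboundary using B by simp
  moreover have "central_diff (restrict_len (\<lambda>n. n = 1) b) = dcoboundary (restrict_len (\<lambda>n. n = 0) c)"
    unfolding restrict_len_central_diff[symmetric] dcoboundary using B by simp
  moreover have "orbit_sum (restrict_len (\<lambda>n. n = 0) c) = pullback cochain_one"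
  proof -
    have "restrict_len (\<lambda>n. n = 0) (pullback cochain_one) = (pullback cochain_one :: 'a dcochain)"
      by (simp add: restrict_len_def pullback_def cochain_one_def fun_eq_iff)
    then show ?thesis unfolding restrict_len_orbit_sum[symmetric] using B by simp
  qed
  ultimately show ?thesis unfolding zigzag_to_one_def by blast
qed

section \<open>The derivation Theta on cohomology\<close>

type_synonym 'p dihedral_cohomology = "('p mod_ring, 'p mod_ring) rack_cohomology"

abbreviation coh_class :: "'p::prime_card xcochain \<Rightarrow> 'p dihedral_cohomology" where
  "coh_class \<equiv> abs_rack_cohomology"

text \<open>The value does not depend on the representative: see \<open>Theta_class\<close>.\<close>

definition Theta :: "'p::prime_card dihedral_cohomology \<Rightarrow> 'p dihedral_cohomology" where
  "Theta x = coh_class (theta (rep_rack_cohomology x))"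

definition bounded_class :: "nat \<Rightarrow> 'p::prime_card dihedral_cohomology \<Rightarrow> bool" where
  "bounded_class N x \<longleftrightarrow> (\<exists>f. rack_coboundary f = 0 \<and> (\<forall>z. N \<le> symdeg z \<longrightarrow> f z = 0) \<and> x = coh_class f)"

text \<open>The kernel of \<open>\<Theta>\<close> is the direct sum of \<open>K\<close> and \<open>B \<smile> K\<close>, where \<open>K = k 1 + P H\<close>. The degree bounds
  record that \<open>P\<close> raises degrees by 1 and \<open>B\<close> by 3; the induction for spanning relies on them.\<close>

definition kernel_generator :: "'p::prime_card dihedral_cohomology \<Rightarrow> bool" where
  "kernel_generator B \<longleftrightarrow>
     (\<forall>N x. bounded_class N x \<and> Theta x = 0 \<longrightarrow>
        (\<exists>k v k' v'. x = cohomology_scale k 1 + cohomology_P v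
            + B \<smile> (cohomology_scale k' 1 + cohomology_P v')
          \<and> bounded_class (N - 1) v \<and> bounded_class (N - 4) v' \<and> (0 < N \<or> k = 0) \<and> (3 < N \<or> k' = 0)))
     \<and> (\<forall>k v k' v'. cohomology_scale k 1 + cohomology_P v
            + B \<smile> (cohomology_scale k' 1 + cohomology_P v') = 0
        \<longrightarrow> k = 0 \<and> v = 0 \<and> k' = 0 \<and> v' = 0)"

lemma cohomologous_reflI:
  "rack_coboundary f = 0 \<Longrightarrow> (\<And>z. N \<le> symdeg z \<Longrightarrow> f z = 0) \<Longrightarrow> cohomologous f f"
  unfolding cohomologous_refl_iff by blast

lemma coh_class_eq_iff:
  assumes "cohomologous f f" "cohomologous g g"
  shows "coh_class f = coh_class g \<longleftrightarrow> (\<exists>h. f - g = rack_coboundary h)"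
proof -
  have "coh_class f = coh_class g \<longleftrightarrow> cohomologous f g"
    using Quotient_rel[OF Quotient_rack_cohomology] assms by blast
  then show ?thesis using assms unfolding cohomologous_iff by blast
qed

lemma coh_class_cases:
  obtains f where "cohomologous f f" "x = coh_class f"
  using Quotient_abs_rep[OF Quotient_rack_cohomology] Quotient_rep_reflp[OF Quotient_rack_cohomology]
  by metis

lemma coh_class_0_iff:
  assumes "cohomologous f f"
  shows "coh_class f = 0 \<longleftrightarrow> (\<exists>h. f = rack_coboundary h)"
  using coh_class_eq_iff[OF assms cohomologous_0] by (simp add: zero_rack_cohomology_def)

lemma bounded_class_exists: "\<exists>N. bounded_class N x"
proof -
  obtain f where f: "cohomologous f f" "x = coh_class f" by (rule coh_class_cases)
  then show ?thesis unfolding bounded_class_def cohomologous_refl_iff by blast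
qed

lemma bounded_class_mono:
  "bounded_class N x \<Longrightarrow> N \<le> M \<Longrightarrow> bounded_class M x"
  unfolding bounded_class_def by (metis (no_types, lifting) le_trans)

lemma bounded_class_0: "bounded_class 0 x \<longleftrightarrow> x = 0"
proof -
  have "(\<forall>z. f z = 0) \<longleftrightarrow> f = (0 :: 'a xcochain)"
    for f by (auto simp: fun_eq_iff)
  then show ?thesis unfolding bounded_class_def zero_rack_cohomology_def by auto
qed

lemma bounded_class_add:
  assumes "bounded_class N x" "bounded_class N y" shows "bounded_class N (x + y)"
proof -
  obtain f g where f: "rack_coboundary f = 0" "\<And>z. N \<le> symdeg z \<Longrightarrow> f z = 0" "x = coh_class f"
    and g: "rack_coboundary g = 0" "\<And>z. N \<le> symdeg z \<Longrightarrow> g z = 0" "y = coh_class g"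
    using assms unfolding bounded_class_def by blast
  have "x + y = coh_class (f + g)"
    unfolding f(3) g(3) using f(1,2) g(1,2) by (intro plus_rack_cohomology.abs_eq cohomologous_reflI)
  then show ?thesis
    unfolding bounded_class_def using f(1,2) g(1,2)
    by (intro exI[of _ "f + g"]) (simp add: rack_coboundary_plus)
qed

lemma bounded_class_scale:
  assumes "bounded_class N x" shows "bounded_class N (cohomology_scale c x)"
proof -
  obtain f where f: "rack_coboundary f = 0" "\<And>z. N \<le> symdeg z \<Longrightarrow> f z = 0" "x = coh_class f"
    using assms unfolding bounded_class_def by blast
  have "cohomology_scale c x = coh_class (\<lambda>z. c * f z)"
    unfolding f(3) using f(1,2) by (intro cohomology_scale.abs_eq cohomologous_reflI)
  then show ?thesis
    unfolding bounded_class_def using f(1,2)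
    by (intro exI[of _ "\<lambda>z. c * f z"]) (simp add: rack_coboundary_scale fun_eq_iff)
qed

lemma in_degree_iff:
  fixes x :: "'p::prime_card dihedral_cohomology"
  shows "x \<in> cohomology_in_degree n \<longleftrightarrow> (\<exists>f. rack_coboundary f = 0 \<and> f \<in> cochains n \<and> x = coh_class f)"
  unfolding cohomology_in_degree_def cocycles_def by blast

lemma cochains_zero:
  "f \<in> cochains n \<Longrightarrow> Suc n \<le> symdeg z \<Longrightarrow> f z = 0"
  unfolding cochains_def mem_Collect_eq by (metis not_less_eq_eq order_refl)

lemma in_degree_bounded:
  assumes "x \<in> cohomology_in_degree n" "n < N" shows "bounded_class N x"
proof -
  obtain f where f: "rack_coboundary f = 0" "f \<in> cochains n" "x = coh_class f"
    using assms(1) unfolding in_degree_iff by blast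
  have "f z = 0" if "N \<le> symdeg z" for z
    using cochains_zero[OF f(2)] that assms(2) by simp
  with f show ?thesis unfolding bounded_class_def by blast
qed

lemma in_degree_one: "(1 :: 'p::prime_card dihedral_cohomology) \<in> cohomology_in_degree 0"
proof -
  have "(1 :: 'p dihedral_cohomology) = coh_class cochain_one" by (simp add: one_rack_cohomology_def)
  moreover have "cochain_one \<in> cochains 0" by (simp add: cochains_def cochain_one_def)
  ultimately show ?thesis unfolding in_degree_iff using rack_coboundary_one by blast
qed

lemma in_degree_P:
  fixes x :: "'p::prime_card dihedral_cohomology"
  assumes "x \<in> cohomology_in_degree n" shows "cohomology_P x \<in> cohomology_in_degree (Suc n)"
proof -
  obtain f where f: "rack_coboundary f = 0" "f \<in> cochains n" "x = coh_class f"
    using assms unfolding in_degree_iff by blast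
  have "cohomology_P x = coh_class (cochain_P f)"
    unfolding f(3) using f(1) cochains_zero[OF f(2)] by (intro cohomology_P.abs_eq cohomologous_reflI)
  moreover have "cochain_P f \<in> cochains (Suc n)"
    using f(2) by (auto simp: cochains_def cochain_P_def split: list.splits)
  moreover have "rack_coboundary (cochain_P f) = 0"
    by (simp add: rack_coboundary_cochain_P f(1)) (simp add: cochain_P_def fun_eq_iff split: list.splits)
  ultimately show ?thesis unfolding in_degree_iff by blast
qed

lemma cochains_cup:
  assumes "f \<in> cochains n" "g \<in> cochains m" shows "cochain_cup f g \<in> cochains (n + m)"
proof -
  have "cochain_cup f g z = 0" if "symdeg z \<noteq> n + m" for z
  proof -
    have "cochain_cup f g z = coproduct (\<lambda>l r. 0 * (f l * g r)) z"
      unfolding cochain_cup_eq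
    proof (rule coproduct_cong)
      fix l r :: "'a symbol" assume "symdeg l + symdeg r = symdeg z"
      then have "symdeg l \<noteq> n \<or> symdeg r \<noteq> m" using that by auto
      then show "f l * g r = 0 * (f l * g r)" using assms unfolding cochains_def by fastforce
    qed
    then show ?thesis unfolding coproduct_cmul by simp
  qed
  then show ?thesis unfolding cochains_def by blast
qed

lemma in_degree_cup:
  fixes x y :: "'p::prime_card dihedral_cohomology"
  assumes "x \<in> cohomology_in_degree n" "y \<in> cohomology_in_degree m"
  shows "x \<smile> y \<in> cohomology_in_degree (n + m)"
proof -
  obtain f g where f: "rack_coboundary f = 0" "f \<in> cochains n" "x = coh_class f"
    and g: "rack_coboundary g = 0" "g \<in> cochains m" "y = coh_class g"
    using assms unfolding in_degree_iff by blast
  have "x \<smile> y = coh_class (cochain_cup f g)"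
    unfolding f(3) g(3) using f(1) g(1) cochains_zero[OF f(2)] cochains_zero[OF g(2)]
    by (intro cup.abs_eq cohomologous_reflI)
  then show ?thesis
    unfolding in_degree_iff using cochains_cup[OF f(2) g(2)] cochain_cup_closed[OF f(1) g(1)] by blast
qed

text \<open>The scalars are multiples of 1, so additive maps are linear.\<close>

lemma additive_cohomology_scale:
  fixes \<phi> :: "'p::prime_card dihedral_cohomology \<Rightarrow> 'p dihedral_cohomology"
  assumes "additive \<phi>" shows "\<phi> (cohomology_scale c x) = cohomology_scale c (\<phi> x)"
proof -
  interpret additive \<phi> by fact
  obtain n where "c = of_nat n" using surj_of_nat_mod_ring by blast
  moreover have "\<phi> (cohomology_scale (of_nat n) x) = cohomology_scale (of_nat n) (\<phi> x)"
    by (induction n) (simp_all add: zero add cohomology.scale_left_distrib)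
  ultimately show ?thesis by simp
qed

lemma additive_P:
  "additive (cohomology_P :: 'p::prime_card dihedral_cohomology \<Rightarrow> _)"
proof
  fix x y :: "'p dihedral_cohomology"
  obtain f g where f: "cohomologous f f" "x = coh_class f" and g: "cohomologous g g" "y = coh_class g"
    by (metis coh_class_cases)
  have "cochain_P (f + g) = cochain_P f + cochain_P g"
    by (simp add: cochain_P_def fun_eq_iff distrib_left split: list.splits)
  then show "cohomology_P (x + y) = cohomology_P x + cohomology_P y"
    by (simp add: f(2) g(2) plus_rack_cohomology.abs_eq cohomology_P.abs_eq f(1) g(1)
        cohomologous_plus cohomologous_P)
qed

lemma additive_cup: "additive (\<lambda>y :: 'p::prime_card dihedral_cohomology. x \<smile> y)"
proof
  fix y z :: "'p dihedral_cohomology"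
  obtain f where f: "cohomologous f f" "x = coh_class f" by (metis coh_class_cases)
  obtain g h where g: "cohomologous g g" "y = coh_class g" and h: "cohomologous h h" "z = coh_class h"
    by (metis coh_class_cases)
  have "cochain_cup f (g + h) = cochain_cup f g + cochain_cup f h"
    by (intro ext) (simp add: cochain_cup_eq distrib_left coproduct_add)
  then show "x \<smile> (y + z) = x \<smile> y + x \<smile> z"
    by (simp add: f(2) g(2) h(2) plus_rack_cohomology.abs_eq cup.abs_eq f(1) g(1) h(1)
        cohomologous_plus cohomologous_cup)
qed

lemma cup_one_left: "1 \<smile> x = (x :: 'p::prime_card dihedral_cohomology)"
proof -
  obtain f where f: "cohomologous f f" "x = coh_class f" by (metis coh_class_cases)
  show ?thesis
    by (simp add: f(2) one_rack_cohomology_def cup.abs_eq f(1) cohomologous_one cochain_cup_one_left)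
qed

lemma cup_one_right: "x \<smile> 1 = (x :: 'p::prime_card dihedral_cohomology)"
proof -
  obtain f where f: "cohomologous f f" "x = coh_class f" by (metis coh_class_cases)
  show ?thesis
    by (simp add: f(2) one_rack_cohomology_def cup.abs_eq f(1) cohomologous_one cochain_cup_one_right)
qed

lemma cup_zero_left: "0 \<smile> x = (0 :: 'p::prime_card dihedral_cohomology)"
proof -
  obtain f where f: "cohomologous f f" "x = coh_class f" by (metis coh_class_cases)
  have "cochain_cup 0 f = (0 :: 'p xcochain)" by (simp add: fun_eq_iff cochain_cup_def)
  then show ?thesis
    by (simp add: f(2) zero_rack_cohomology_def cup.abs_eq f(1) cohomologous_0)
qed

lemma theta_bounded:
  assumes "\<And>z. N \<le> symdeg z \<Longrightarrow> f z = 0" "N - 2 \<le> symdeg z"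
  shows "theta f z = 0"
proof -
  have "f = restrict_deg (\<lambda>n. n < N) f"
  proof
    fix w show "f w = restrict_deg (\<lambda>n. n < N) f w"
      using assms(1)[of w] by (simp add: restrict_deg_def not_less)
  qed
  then have "theta f = theta (restrict_deg (\<lambda>n. n < N) f)" by (rule arg_cong)
  then have "theta f z = restrict_deg (\<lambda>n. Suc (Suc n) < N) (theta f) z"
    unfolding theta_restrict by (rule fun_cong)
  moreover have "\<not> Suc (Suc (symdeg z)) < N" using assms(2) by linarith
  ultimately show ?thesis by (simp add: restrict_deg_def)
qed

lemma restrict_deg_zero: "restrict_deg Q 0 = 0"
  by (simp add: restrict_deg_def fun_eq_iff)

lemma cocycle_restrict:
  "rack_coboundary f = 0 \<Longrightarrow> rack_coboundary (restrict_deg Q f) = 0"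
proof -
  assume "rack_coboundary f = 0"
  then have "rack_coboundary (restrict_deg Q f) = restrict_deg (\<lambda>n. Q (n - 1)) 0"
    using restrict_deg_coboundary[of "\<lambda>n. Q (n - 1)" f] by simp
  then show ?thesis by (simp only: restrict_deg_zero)
qed

text \<open>The classes of base-independent cocycles make up \<open>K\<close>.\<close>

lemma base_independent_class:
  assumes "odd CARD('p::prime_card)" "base_independent (w :: 'p xcochain)" "rack_coboundary w = 0"
    "\<And>z. M \<le> symdeg z \<Longrightarrow> w z = 0"
  shows "\<exists>k v. coh_class w = cohomology_scale k 1 + cohomology_P v \<and> bounded_class (M - 1) v \<and> (0 < M \<or> k = 0)"
proof -
  let ?k = "w (0, [])" and ?v = "alternate (repeat_base w)"
  have dv: "rack_coboundary ?v = 0"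
    by (simp add: rack_coboundary_alternate' rack_coboundary_repeat_base[OF assms(1)] assms(3))
      (simp add: alternate_def repeat_base_def fun_eq_iff)
  have bv: "?v z = 0" if "M - 1 \<le> symdeg z" for z
  proof -
    have "M \<le> symdeg (fst z, fst z # snd z)" using that by simp
    from assms(4)[OF this] show ?thesis by (simp add: alternate_def repeat_base_def)
  qed
  have cv: "cohomologous ?v ?v" by (rule cohomologous_reflI[OF dv bv])
  have "coh_class w = coh_class ((\<lambda>z. ?k * cochain_one z) + cochain_P ?v)"
    by (simp only: base_independent_decomp[OF assms(2), symmetric])
  also have "\<dots> = cohomology_scale ?k 1 + cohomology_P (coh_class ?v)"
    by (simp add: plus_rack_cohomology.abs_eq cohomology_P.abs_eq cohomology_scale.abs_eq
        one_rack_cohomology_def cohomologous_one cohomologous_P cohomologous_scale cv)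
  finally have "coh_class w = \<dots>" .
  moreover have "bounded_class (M - 1) (coh_class ?v)" unfolding bounded_class_def using dv bv by blast
  moreover have "0 < M \<or> ?k = 0" using assms(4)[of "(0, [])"] by auto
  ultimately show ?thesis by blast
qed

context
  assumes odd_card: "odd CARD('p::prime_card)"
begin

lemma cohomologous_theta:
  assumes "cohomologous f (g :: 'p xcochain)" shows "cohomologous (theta f) (theta g)"
proof -
  from assms obtain h N where f: "rack_coboundary f = 0" "rack_coboundary g = 0"
    "f - g = rack_coboundary h" "\<And>z. N \<le> symdeg z \<Longrightarrow> f z = 0" "\<And>z. N \<le> symdeg z \<Longrightarrow> g z = 0"
    by (rule cohomologousE) iprover
  have zero: "theta (0 :: 'p xcochain) = 0"
    by (rule theta_base_independent) (simp add: base_independent_def)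
  show ?thesis
  proof (rule cohomologousI[where h = "theta h" and N = "N - 2"])
    have "f = g + rack_coboundary h" using f(3) by (metis add_diff_cancel_left' add_diff_eq)
    then show "theta f - theta g = rack_coboundary (theta h)"
      by (simp add: theta_add rack_coboundary_theta[OF odd_card])
    show "theta f z = 0" if "N - 2 \<le> symdeg z" for z by (rule theta_bounded[OF f(4) that])
    show "theta g z = 0" if "N - 2 \<le> symdeg z" for z by (rule theta_bounded[OF f(5) that])
  qed (simp_all add: rack_coboundary_theta[OF odd_card] f zero)
qed

lemma Theta_class:
  assumes "cohomologous f (f :: 'p xcochain)" shows "Theta (coh_class f) = coh_class (theta f)"
proof -
  have "cohomologous (rep_rack_cohomology (coh_class f)) f"
    using Quotient_rep_abs[OF Quotient_rack_cohomology] assms by blast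
  then show ?thesis
    unfolding Theta_def using cohomologous_theta Quotient_rel_abs[OF Quotient_rack_cohomology] by blast
qed

lemma additive_Theta: "additive (Theta :: 'p dihedral_cohomology \<Rightarrow> _)"
proof
  fix x y :: "'p dihedral_cohomology"
  obtain f g where f: "cohomologous f f" "x = coh_class f" and g: "cohomologous g g" "y = coh_class g"
    by (metis coh_class_cases)
  show "Theta (x + y) = Theta x + Theta y"
    by (simp add: f(2) g(2) plus_rack_cohomology.abs_eq Theta_class f(1) g(1)
        cohomologous_plus cohomologous_theta theta_add)
qed

lemma Theta_cup:
  "Theta (x \<smile> y) = Theta x \<smile> y + x \<smile> Theta (y :: 'p dihedral_cohomology)"
proof -
  obtain f g where f: "cohomologous f f" "x = coh_class f" and g: "cohomologous g g" "y = coh_class g"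
    by (metis coh_class_cases)
  have d: "rack_coboundary f = 0" "rack_coboundary g = 0"
    using f(1) g(1) unfolding cohomologous_refl_iff by blast+
  from theta_cup[OF odd_card d] obtain u where
    u: "theta (cochain_cup f g) = cochain_cup (theta f) g + cochain_cup f (theta g) + rack_coboundary u" by blast
  have fg: "cohomologous (theta f) (theta f)" "cohomologous (theta g) (theta g)"
    using f(1) g(1) by (simp_all add: cohomologous_theta)
  have "Theta (x \<smile> y) = coh_class (theta (cochain_cup f g))"
    by (simp add: f g cup.abs_eq Theta_class cohomologous_cup)
  also have "\<dots> = coh_class (cochain_cup (theta f) g + cochain_cup f (theta g))"
  proof (subst coh_class_eq_iff)
    show "cohomologous (theta (cochain_cup f g)) (theta (cochain_cup f g))"
      by (intro cohomologous_theta cohomologous_cup f g)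
    show "cohomologous (cochain_cup (theta f) g + cochain_cup f (theta g))
        (cochain_cup (theta f) g + cochain_cup f (theta g))"
      by (intro cohomologous_plus cohomologous_cup f g fg)
    show "\<exists>h. theta (cochain_cup f g) - (cochain_cup (theta f) g + cochain_cup f (theta g)) = rack_coboundary h"
      unfolding u by (metis add_diff_cancel_left')
  qed
  also have "\<dots> = Theta x \<smile> y + x \<smile> Theta y"
    by (simp add: f(2) g(2) plus_rack_cohomology.abs_eq cup.abs_eq Theta_class f(1) g(1) fg cohomologous_cup)
  finally show ?thesis .
qed

lemma Theta_P: "Theta (cohomology_P x) = (0 :: 'p dihedral_cohomology)"
proof -
  obtain f where f: "cohomologous f f" "x = coh_class f" by (metis coh_class_cases)
  then show ?thesis
    by (simp add: cohomology_P.abs_eq Theta_class cohomologous_P theta_base_independent[OF base_independent_P] zero_rack_cohomology_def)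
qed

lemma Theta_one: "Theta 1 = (0 :: 'p dihedral_cohomology)"
proof -
  have "base_independent (cochain_one :: 'p xcochain)" using base_independent_one[of 1] by simp
  then show ?thesis
    by (simp add: one_rack_cohomology_def Theta_class cohomologous_one theta_base_independent zero_rack_cohomology_def)
qed

lemma Theta_bounded:
  assumes "bounded_class N (x :: 'p dihedral_cohomology)" shows "bounded_class (N - 2) (Theta x)"
proof -
  obtain f where f: "rack_coboundary f = 0" "\<And>z. N \<le> symdeg z \<Longrightarrow> f z = 0" "x = coh_class f"
    using assms unfolding bounded_class_def by blast
  have "cohomologous f f" by (rule cohomologous_reflI[OF f(1,2)])
  then have "Theta x = coh_class (theta f)" "rack_coboundary (theta f) = 0"
    using cohomologous_theta[of f f] by (simp_all add: f(3) Theta_class cohomologous_refl_iff)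
  moreover have "theta f z = 0" if "N - 2 \<le> symdeg z" for z by (rule theta_bounded[OF f(2) that])
  ultimately show ?thesis unfolding bounded_class_def by blast
qed

lemma Theta_surj:
  assumes "(x :: 'p dihedral_cohomology) \<in> cohomology_in_degree n"
  shows "\<exists>y\<in>cohomology_in_degree (Suc (Suc n)). Theta y = x"
proof -
  obtain g where g: "rack_coboundary g = 0" "g \<in> cochains n" "x = coh_class g"
    using assms unfolding in_degree_iff by blast
  from theta_surjective[OF odd_card g(1)] obtain f u where
    f: "rack_coboundary f = 0" "theta f = g + rack_coboundary u" by blast
  define f' where "f' = restrict_deg (\<lambda>m. m = Suc (Suc n)) f"
  have f': "rack_coboundary f' = 0" "f' \<in> cochains (Suc (Suc n))"
    by (simp_all add: f'_def cocycle_restrict f(1), simp add: cochains_def restrict_deg_def)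
  have c: "cohomologous f' f'" by (rule cohomologous_reflI[OF f'(1) cochains_zero[OF f'(2)]])
  have cg: "cohomologous g g" by (rule cohomologous_reflI[OF g(1) cochains_zero[OF g(2)]])
  have "restrict_deg (\<lambda>m. m = n) g = g"
    using g(2) by (auto simp: restrict_deg_def cochains_def fun_eq_iff)
  then have "theta f' = g + rack_coboundary (restrict_deg (\<lambda>m. Suc m = n) u)"
    by (simp add: f'_def theta_restrict f(2) restrict_deg_add restrict_deg_coboundary)
  then have "coh_class (theta f') = coh_class g"
    unfolding coh_class_eq_iff[OF cohomologous_theta[OF c] cg] by (metis add_diff_cancel_left')
  then have "Theta (coh_class f') = x" by (simp add: Theta_class[OF c] g(3))
  moreover have "coh_class f' \<in> cohomology_in_degree (Suc (Suc n))"
    unfolding in_degree_iff by (rule exI[of _ f']) (simp add: f')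
  ultimately show ?thesis by (rule bexI)
qed

text \<open>The zigzag from \<open>B\<close> to the unit is cut to the degrees 3, 2, 1, 0. In \<open>theta_kernel\<close> the two base-independent
  parts are cut to the degrees that can contribute below \<open>N\<close>.\<close>

lemma kernel_generator_exists:
  "\<exists>B :: 'p dihedral_cohomology. B \<in> cohomology_in_degree 3 \<and> Theta B = 0 \<and> kernel_generator B"
proof -
  obtain B0 :: "'p xcochain" and a0 b0 c0 where "zigzag_to_one B0 a0 b0 c0" using zigzag_to_one_exists[OF odd_card] by blast
  from zigzag_to_one_restrict[OF this] obtain B :: "'p xcochain" and a b c where
    B: "zigzag_to_one B a b c" and BB: "B = restrict_deg (\<lambda>n. n = 3) B0" by blast
  have B3: "B \<in> cochains 3" by (simp add: BB cochains_def restrict_deg_def)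
  have dB: "rack_coboundary B = 0" using B by (simp add: zigzag_to_one_def)
  have cB: "cohomologous B B" by (rule cohomologous_reflI[OF dB cochains_zero[OF B3]])
  have 1: "coh_class B \<in> cohomology_in_degree 3" unfolding in_degree_iff by (rule exI[of _ B]) (simp add: B3 dB)
  have 2: "Theta (coh_class B) = 0"
  proof -
    obtain u where "theta B = pushdown (central_diff b) + rack_coboundary u"
      using theta_zigzag[OF odd_card dB] B unfolding zigzag_to_one_def by blast
    also have "pushdown (central_diff b) = rack_coboundary (pushdown c)"
      using B by (simp add: zigzag_to_one_def pushdown_dcoboundary[OF odd_card])
    finally have "theta B = rack_coboundary (pushdown c + u)" by (simp only: rack_coboundary_plus)
    then show ?thesis
      unfolding Theta_class[OF cB] using coh_class_0_iff cohomologous_theta[OF cB] by blast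
  qed
  have 3: "\<exists>k v k' v'. x = cohomology_scale k 1 + cohomology_P v + coh_class B \<smile> (cohomology_scale k' 1 + cohomology_P v')
      \<and> bounded_class (N - 1) v \<and> bounded_class (N - 4) v' \<and> (0 < N \<or> k = 0) \<and> (3 < N \<or> k' = 0)"
    if x: "bounded_class N x" "Theta x = 0" for N x
  proof -
    obtain f where f: "rack_coboundary f = 0" "\<And>z. N \<le> symdeg z \<Longrightarrow> f z = 0" "x = coh_class f"
      using x(1) unfolding bounded_class_def by blast
    have cf: "cohomologous f f" by (rule cohomologous_reflI[OF f(1,2)])
    obtain v where "theta f = rack_coboundary v"
      using x(2) coh_class_0_iff[OF cohomologous_theta[OF cf]] by (auto simp: f(3) Theta_class[OF cf])
    from theta_kernel[OF odd_card B f(1) this] obtain w0 w u where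
      w: "base_independent w0" "base_independent w" "rack_coboundary w = 0" "rack_coboundary w0 = 0"
      and e: "f = w0 + cochain_cup B w + rack_coboundary u" by blast
    let ?v = "restrict_deg (\<lambda>n. n < N) w0" and ?w = "restrict_deg (\<lambda>n. 3 + n < N) w"
      and ?u = "restrict_deg (\<lambda>n. Suc n < N) u"
    have "f = restrict_deg (\<lambda>n. n < N) f"
    proof
      fix z show "f z = restrict_deg (\<lambda>n. n < N) f z"
        using f(2)[of z] by (simp add: restrict_deg_def not_less)
    qed
    also have "\<dots> = ?v + cochain_cup B ?w + rack_coboundary ?u"
      by (subst e) (simp only: restrict_deg_add restrict_deg_cup[OF B3] restrict_deg_coboundary)
    finally have e': "f = ?v + cochain_cup B ?w + rack_coboundary ?u" .
    have d: "rack_coboundary ?v = 0" "rack_coboundary ?w = 0" by (simp_all add: cocycle_restrict w)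
    have b0: "?v z = 0" if "N \<le> symdeg z" for z using that by (simp add: restrict_deg_def)
    have b1: "?w z = 0" if "N - 3 \<le> symdeg z" for z using that by (simp add: restrict_deg_def)
    have c: "cohomologous ?v ?v" "cohomologous ?w ?w"
      by (rule cohomologous_reflI[OF d(1) b0], assumption) (rule cohomologous_reflI[OF d(2) b1])
    have "x = coh_class (?v + cochain_cup B ?w)"
      unfolding f(3)
    proof (subst coh_class_eq_iff)
      show "\<exists>h. f - (?v + cochain_cup B ?w) = rack_coboundary h"
        using e' by (metis add_diff_cancel_left')
    qed (intro cf cohomologous_plus cohomologous_cup c cB)+
    also have "\<dots> = coh_class ?v + coh_class B \<smile> coh_class ?w"
      by (simp add: plus_rack_cohomology.abs_eq cup.abs_eq c cB cohomologous_cup)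
    finally have xe: "x = coh_class ?v + coh_class B \<smile> coh_class ?w" .
    obtain k v where 1: "coh_class ?v = cohomology_scale k 1 + cohomology_P v" "bounded_class (N - 1) v"
      "0 < N \<or> k = 0"
      using base_independent_class[OF odd_card base_independent_restrict[OF w(1)] d(1) b0] by blast
    obtain k' v' where 2: "coh_class ?w = cohomology_scale k' 1 + cohomology_P v'" "bounded_class (N - 3 - 1) v'"
      "0 < N - 3 \<or> k' = 0"
      using base_independent_class[OF odd_card base_independent_restrict[OF w(2)] d(2) b1] by blast
    have "N - 3 - 1 = N - 4" by simp
    with 2 have 3: "bounded_class (N - 4) v'" "3 < N \<or> k' = 0" by (metis, force)
    show ?thesis
      by (rule exI[of _ k], rule exI[of _ v], rule exI[of _ k'], rule exI[of _ v'])
        (use 1(2,3) 3 in \<open>simp add: xe 1(1) 2(1)\<close>)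
  qed
  have 4: "k = 0 \<and> v = 0 \<and> k' = 0 \<and> v' = 0"
    if z: "cohomology_scale k 1 + cohomology_P v + coh_class B \<smile> (cohomology_scale k' 1 + cohomology_P v') = 0"
    for k v k' v'
  proof -
    obtain f f' where f: "cohomologous f f" "v = coh_class f" and f': "cohomologous f' f'" "v' = coh_class f'"
      by (metis coh_class_cases)
    let ?v = "(\<lambda>z. k * cochain_one z) + cochain_P f" and ?w = "(\<lambda>z. k' * cochain_one z) + cochain_P f'"
    have c: "cohomologous ?v ?v" "cohomologous ?w ?w"
      by (intro cohomologous_plus cohomologous_scale cohomologous_one cohomologous_P f f')+
    have "coh_class ?v = cohomology_scale k 1 + cohomology_P v" "coh_class ?w = cohomology_scale k' 1 + cohomology_P v'"
      by (simp_all add: f(2) f'(2) plus_rack_cohomology.abs_eq cohomology_P.abs_eq cohomology_scale.abs_eq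
        one_rack_cohomology_def cohomologous_one cohomologous_P cohomologous_scale f(1) f'(1))
    then have "coh_class (?v + cochain_cup B ?w) = 0"
      using z by (simp add: plus_rack_cohomology.abs_eq[symmetric] cup.abs_eq[symmetric] c cB cohomologous_cup)
    moreover have "cohomologous (?v + cochain_cup B ?w) (?v + cochain_cup B ?w)"
      by (intro cohomologous_plus[OF c(1)] cohomologous_cup c cB)
    ultimately obtain u where u: "?v + cochain_cup B ?w = rack_coboundary u" using coh_class_0_iff by blast
    have b: "base_independent ?v" "base_independent ?w"
      by (simp_all add: base_independent_def cochain_one_def cochain_P_def)
    have "rack_coboundary ?w = 0" using c(2) unfolding cohomologous_refl_iff by blast
    from kernel_unique[OF odd_card B b this u] obtain u1 u2 where
      "?w = rack_coboundary u1" "?v = rack_coboundary u2" by blast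
    from P_exact[OF odd_card this(1)] P_exact[OF odd_card this(2)]
    show ?thesis using coh_class_0_iff[OF f(1)] coh_class_0_iff[OF f'(1)] f(2) f'(2) by blast
  qed
  have "kernel_generator (coh_class B)"
    unfolding kernel_generator_def
    by (intro conjI allI impI, elim conjE, rule 3) (use 4 in blast)+
  with 1 2 show ?thesis by blast
qed

end

section \<open>The basis\<close>

definition exponent_seqs :: "(nat \<times> nat) list set" where
  "exponent_seqs = {s. s \<noteq> [] \<and> (\<forall>(m, e)\<in>set s. e \<in> {0, 1})}"

fun seq_degree :: "(nat \<times> nat) list \<Rightarrow> nat" where
  "seq_degree [] = 0"
| "seq_degree ((m, e) # t) = 2 * m + 3 * e + (if t = [] then 0 else Suc (seq_degree t))"

fun seq_weight :: "(nat \<times> nat) list \<Rightarrow> nat" where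
  "seq_weight [] = 0"
| "seq_weight ((m, e) # t) = Suc m + seq_weight t"

text \<open>On the nested products \<open>raise_head\<close> is a section of \<open>\<Theta>\<close>, by \<open>Theta_raise\<close>.\<close>

fun raise_head :: "(nat \<times> nat) list \<Rightarrow> (nat \<times> nat) list" where
  "raise_head [] = []"
| "raise_head ((m, e) # t) = (Suc m, e) # t"

fun lower_head :: "(nat \<times> nat) list \<Rightarrow> (nat \<times> nat) list" where
  "lower_head [] = []"
| "lower_head ((m, e) # t) = (m - 1, e) # t"

text \<open>The factor from \<open>K\<close> in a nested product whose first exponents are removed; the empty sequence
  stands for \<open>1\<close>.\<close>

definition tail_product ::
  "(nat \<Rightarrow> 'p::prime_card dihedral_cohomology) \<Rightarrow> 'p dihedral_cohomology \<Rightarrow> (nat \<times> nat) list \<Rightarrow> 'p dihedral_cohomology" where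
  "tail_product A B t = (if t = [] then 1 else cohomology_P (nested_product A B t))"

lemma nested_product_Cons:
  "nested_product A B ((m, e) # t) = A m \<smile> cup_power B e \<smile> tail_product A B t"
  by (cases t) (simp_all add: tail_product_def cup_one_right)

lemma exponent_seqs_Cons:
  "(m, e) # t \<in> exponent_seqs \<longleftrightarrow> e \<in> {0, 1} \<and> (t = [] \<or> t \<in> exponent_seqs)"
  by (auto simp: exponent_seqs_def)

lemma exponent_seqs_cases:
  assumes "s \<in> exponent_seqs"
  obtains m e t where "s = (m, e) # t" "e = 0 \<or> e = 1" "t = [] \<or> t \<in> exponent_seqs"
proof (cases s)
  case Nil
  with assms show ?thesis by (simp add: exponent_seqs_def)
next
  case (Cons a t)
  obtain m e where "a = (m, e)" by (cases a)
  with Cons that assms show ?thesis by (auto simp: exponent_seqs_Cons)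
qed

context
  fixes A :: "nat \<Rightarrow> 'p::prime_card dihedral_cohomology" and B :: "'p dihedral_cohomology"
  assumes odd_card: "odd CARD('p)"
    and A_0: "A 0 = 1" and A_degree: "\<And>m. A m \<in> cohomology_in_degree (2 * m)"
    and Theta_A: "\<And>m. Theta (A (Suc m)) = A m"
    and B_degree: "B \<in> cohomology_in_degree 3" and Theta_B: "Theta B = 0"
    and generator: "kernel_generator B"
begin

abbreviation (input) "nested \<equiv> nested_product A B"
abbreviation (input) "tail \<equiv> tail_product A B"

interpretation Theta: additive "Theta :: 'p dihedral_cohomology \<Rightarrow> _" by (rule additive_Theta[OF odd_card])
interpretation P: additive "cohomology_P :: 'p dihedral_cohomology \<Rightarrow> _" by (rule additive_P)
interpretation cup: additive "\<lambda>y :: 'p dihedral_cohomology. x \<smile> y" for x by (rule additive_cup)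

lemma Theta_kernel:
  assumes "bounded_class N x" "Theta x = 0"
  obtains k v k' v'
  where "x = cohomology_scale k 1 + cohomology_P v + B \<smile> (cohomology_scale k' 1 + cohomology_P v')"
    "bounded_class (N - 1) v" "bounded_class (N - 4) v'" "3 < N \<or> k' = 0"
  using generator assms unfolding kernel_generator_def by blast

lemma kernel_zero:
  assumes "cohomology_scale k 1 + cohomology_P v + B \<smile> (cohomology_scale k' 1 + cohomology_P v') = 0"
  shows "k = 0 \<and> v = 0 \<and> k' = 0 \<and> v' = 0"
  using generator assms unfolding kernel_generator_def by blast

lemma Theta_tail: "Theta (tail t) = 0"
  by (simp add: tail_product_def Theta_P[OF odd_card] Theta_one[OF odd_card])

lemma Theta_cup_power: "Theta (cup_power B e) = 0"
  by (simp add: cup_power_def Theta_B Theta_one[OF odd_card])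

lemma Theta_raise:
  assumes "s \<in> exponent_seqs" shows "Theta (nested (raise_head s)) = nested s"
  using assms
  by (rule exponent_seqs_cases)
    (simp add: nested_product_Cons Theta_cup[OF odd_card] Theta_tail Theta_cup_power Theta_A cup.zero)

lemma Theta_head_0: "Theta (nested ((0, e) # t)) = 0"
  by (simp add: nested_product_Cons Theta_cup[OF odd_card] Theta_tail Theta_cup_power A_0
      Theta_one[OF odd_card] cup.zero cup_zero_left)

lemma nested_head_0:
  "nested ((0, 0) # t) = tail t" "nested ((0, Suc 0) # t) = B \<smile> tail t"
  by (simp_all add: nested_product_Cons A_0 cup_power_def cup_one_left)

lemma nested_degree:
  "s \<in> exponent_seqs \<Longrightarrow> nested s \<in> cohomology_in_degree (seq_degree s)"
proof (induction s)
  case Nil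
  then show ?case by (simp add: exponent_seqs_def)
next
  case (Cons a t)
  obtain m e where a: "a = (m, e)" by (cases a)
  with Cons.prems have e: "e = 0 \<or> e = 1" and t: "t = [] \<or> t \<in> exponent_seqs"
    by (auto simp: exponent_seqs_Cons)
  have "cup_power B e \<in> cohomology_in_degree (3 * e)"
    using e B_degree in_degree_one by (auto simp: cup_power_def)
  moreover have "tail t \<in> cohomology_in_degree (if t = [] then 0 else Suc (seq_degree t))"
    using t Cons.IH in_degree_one in_degree_P by (auto simp: tail_product_def)
  ultimately show ?case
    unfolding a nested_product_Cons seq_degree.simps by (intro in_degree_cup A_degree)
qed

definition seqs_below :: "nat \<Rightarrow> (nat \<times> nat) list set" where
  "seqs_below N = {s \<in> exponent_seqs. seq_degree s < N}"

lemma subspace_bounded: "cohomology.subspace {x :: 'p dihedral_cohomology. bounded_class N x}"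
  by (rule cohomology.subspaceI)
    (auto simp: bounded_class_add bounded_class_scale intro: bounded_class_mono[of 0 0 N] simp: bounded_class_0)

lemma span_bounded:
  "x \<in> cohomology.span (nested ` seqs_below N) \<Longrightarrow> bounded_class N x"
  by (rule cohomology.span_induct[of x, OF _ subspace_bounded])
    (auto simp: seqs_below_def intro: in_degree_bounded nested_degree)

lemma additive_span:
  fixes \<phi> :: "'p dihedral_cohomology \<Rightarrow> 'p dihedral_cohomology"
  assumes "additive \<phi>" "x \<in> cohomology.span S" "\<And>y. y \<in> S \<Longrightarrow> \<phi> y \<in> cohomology.span T"
  shows "\<phi> x \<in> cohomology.span T"
proof -
  interpret \<phi>: additive \<phi> by fact
  have "cohomology.subspace {x. \<phi> x \<in> cohomology.span T}"
    by (rule cohomology.subspaceI)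
      (auto simp: \<phi>.zero \<phi>.add additive_cohomology_scale[OF assms(1)]
        intro: cohomology.span_zero cohomology.span_add cohomology.span_scale)
  from cohomology.span_induct[OF assms(2) this assms(3)] show ?thesis .
qed

text \<open>Raising the first index of every nested product in \<open>y\<close> gives the preimage; this raises degrees by 2.\<close>

lemma Theta_lift:
  assumes "y \<in> cohomology.span (nested ` seqs_below (N - 2))"
  shows "\<exists>x \<in> cohomology.span (nested ` seqs_below N). Theta x = y"
proof -
  let ?V = "cohomology.span (nested ` seqs_below N)"
  have "cohomology.subspace {y. \<exists>x \<in> ?V. Theta x = y}"
  proof (rule cohomology.subspaceI)
    show "0 \<in> {y. \<exists>x \<in> ?V. Theta x = y}" using Theta.zero cohomology.span_zero by blast
    show "x + y \<in> {y. \<exists>x \<in> ?V. Theta x = y}"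
      if "x \<in> {y. \<exists>x \<in> ?V. Theta x = y}" "y \<in> {y. \<exists>x \<in> ?V. Theta x = y}" for x y
      using that Theta.add cohomology.span_add by (smt (verit) mem_Collect_eq)
    show "cohomology_scale c x \<in> {y. \<exists>x \<in> ?V. Theta x = y}" if "x \<in> {y. \<exists>x \<in> ?V. Theta x = y}"
      for c x
      using that additive_cohomology_scale[OF Theta.additive_axioms] cohomology.span_scale
      by (smt (verit) mem_Collect_eq)
  qed
  moreover have "\<exists>x \<in> ?V. Theta x = nested s" if "s \<in> seqs_below (N - 2)" for s
  proof (rule bexI)
    have s: "s \<in> exponent_seqs" "seq_degree s < N - 2" using that by (auto simp: seqs_below_def)
    show "Theta (nested (raise_head s)) = nested s" by (rule Theta_raise[OF s(1)])
    have "raise_head s \<in> seqs_below N"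
      using s(1) by (rule exponent_seqs_cases) (use s(2) in \<open>auto simp: seqs_below_def exponent_seqs_Cons\<close>)
    then show "nested (raise_head s) \<in> ?V" by (intro cohomology.span_base imageI)
  qed
  ultimately show ?thesis
    using cohomology.span_induct[OF assms, of "\<lambda>y. \<exists>x \<in> ?V. Theta x = y"] by blast
qed

text \<open>By induction, \<open>\<Theta> x\<close> is a combination of nested products, and lifting it as in \<open>Theta_lift\<close> reduces to the case
  that \<open>\<Theta> x = 0\<close>. Then \<open>x\<close> lies in \<open>K + B \<smile> K\<close>, and the elements of \<open>H\<close> that occur under \<open>P\<close> have
  smaller degree.\<close>

lemma bounded_in_span:
  "bounded_class N x \<Longrightarrow> x \<in> cohomology.span (nested ` seqs_below N)"
proof (induction N arbitrary: x rule: less_induct)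
  case (less N)
  let ?V = "cohomology.span (nested ` seqs_below N)"
  show ?case
  proof (cases "N = 0")
    case True
    with less.prems show ?thesis by (simp add: bounded_class_0 cohomology.span_zero)
  next
    case False
    have base: "nested s \<in> ?V" if "s \<in> seqs_below N" for s
      using that by (intro cohomology.span_base imageI)
    have "Theta x \<in> cohomology.span (nested ` seqs_below (N - 2))"
      using False by (intro less.IH Theta_bounded[OF odd_card less.prems]) simp
    then obtain x1 where x1: "x1 \<in> ?V" "Theta x1 = Theta x" using Theta_lift by blast
    \<comment> \<open>the lift of \<open>\<Theta> x\<close> has the same degree bound as \<open>x\<close>\<close>
    have "bounded_class N (x + cohomology_scale (-1) x1)"
      by (intro bounded_class_add bounded_class_scale less.prems span_bounded x1)
    then have "bounded_class N (x - x1)" by (simp add: cohomology.scale_minus_left)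
    moreover have "Theta (x - x1) = 0" by (simp add: Theta.diff x1(2))
    ultimately obtain k v k' v' where
      e: "x - x1 = cohomology_scale k 1 + cohomology_P v + B \<smile> (cohomology_scale k' 1 + cohomology_P v')"
      and v: "bounded_class (N - 1) v" "bounded_class (N - 4) v'" and k: "3 < N \<or> k' = 0"
      by (rule Theta_kernel)
    have 1: "cohomology_scale k 1 \<in> ?V"
      using base[of "[(0, 0)]"] False
      by (intro cohomology.span_scale)
        (simp add: seqs_below_def exponent_seqs_Cons A_0 cup_power_def cup_one_left)
    have 2: "cohomology_P v \<in> ?V"
    proof (rule additive_span[OF P.additive_axioms less.IH[OF _ v(1)]])
      show "N - 1 < N" using False by simp
      fix y assume "y \<in> nested ` seqs_below (N - 1)"
      then obtain s where s: "y = nested s" "s \<in> exponent_seqs" "seq_degree s < N - 1"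
        by (auto simp: seqs_below_def)
      then have "s \<noteq> []" by (auto simp: exponent_seqs_def)
      then show "cohomology_P y \<in> ?V"
        using base[of "(0, 0) # s"] s by (simp add: seqs_below_def exponent_seqs_Cons nested_head_0 tail_product_def)
    qed
    have 3: "B \<smile> cohomology_scale k' 1 \<in> ?V"
    proof (cases "k' = 0")
      case False
      then show ?thesis
        using base[of "[(0, 1)]"] k
        by (simp add: additive_cohomology_scale[OF cup.additive_axioms] cohomology.span_scale
            seqs_below_def exponent_seqs_Cons A_0 cup_power_def cup_one_left cup_one_right)
    qed (simp add: cup.zero cohomology.span_zero)
    have 4: "B \<smile> cohomology_P v' \<in> ?V"
    proof (rule additive_span[of "\<lambda>v. B \<smile> cohomology_P v", OF _ less.IH[OF _ v(2)]])
      show "additive (\<lambda>v. B \<smile> cohomology_P v)" by unfold_locales (simp add: P.add cup.add)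
      show "N - 4 < N" using False by simp
      fix y assume "y \<in> nested ` seqs_below (N - 4)"
      then obtain s where s: "y = nested s" "s \<in> exponent_seqs" "seq_degree s < N - 4"
        by (auto simp: seqs_below_def)
      then have "s \<noteq> []" by (auto simp: exponent_seqs_def)
      then show "B \<smile> cohomology_P y \<in> ?V"
        using base[of "(0, 1) # s"] s by (simp add: seqs_below_def exponent_seqs_Cons nested_head_0 tail_product_def)
    qed
    have "x - x1 \<in> ?V" unfolding e cup.add by (intro cohomology.span_add 1 2 3 4)
    then have "x - x1 + x1 \<in> ?V" by (rule cohomology.span_add[OF _ x1(1)])
    then show ?thesis by simp
  qed
qed

lemma nested_span: "cohomology.span (nested ` exponent_seqs) = UNIV"
proof -
  have "x \<in> cohomology.span (nested ` exponent_seqs)" for x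
  proof -
    obtain N where "bounded_class N x" using bounded_class_exists by blast
    then have "x \<in> cohomology.span (nested ` seqs_below N)" by (rule bounded_in_span)
    moreover have "nested ` seqs_below N \<subseteq> nested ` exponent_seqs"
      by (auto simp: seqs_below_def)
    ultimately show ?thesis using cohomology.span_mono by blast
  qed
  then show ?thesis by blast
qed

lemma tail_sum:
  assumes "finite R"
  shows "(\<Sum>t\<in>R. cohomology_scale (d t) (tail t))
    = cohomology_scale (if [] \<in> R then d [] else 0) 1
      + cohomology_P (\<Sum>t\<in>R - {[]}. cohomology_scale (d t) (nested t))"
proof -
  have *: "(\<Sum>t\<in>R - {[]}. cohomology_scale (d t) (tail t))
      = cohomology_P (\<Sum>t\<in>R - {[]}. cohomology_scale (d t) (nested t))"
    unfolding P.sum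
    by (rule sum.cong) (simp_all add: tail_product_def additive_cohomology_scale[OF additive_P])
  show ?thesis
  proof (cases "[] \<in> R")
    case True
    then show ?thesis
      using assms by (simp add: sum.remove[of R "[]"] * ) (simp add: tail_product_def)
  next
    case False
    then show ?thesis using * by simp
  qed
qed

text \<open>Applying \<open>\<Theta>\<close> to a relation removes the terms with first index 0 and lowers the first index in the others, so
  their coefficients vanish by induction. What is left is a relation in \<open>K + B \<smile> K\<close>. As this sum is direct
  and \<open>P\<close> is injective, it splits into two relations between shorter nested products.\<close>

lemma nested_relation_trivial:
  assumes "finite T" "T \<subseteq> exponent_seqs" "\<And>s. s \<in> T \<Longrightarrow> seq_weight s < K"
    "(\<Sum>s\<in>T. cohomology_scale (c s) (nested s)) = 0"
  shows "\<forall>s\<in>T. c s = 0"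
  using assms
proof (induction K arbitrary: T c)
  case 0
  then show ?case by blast
next
  case (Suc K)
  let ?Tp = "{s \<in> T. fst (hd s) \<noteq> 0}" and ?Tz = "{s \<in> T. fst (hd s) = 0}"
  have fin: "finite ?Tp" "finite ?Tz" using Suc.prems(1) by auto
  have split: "(\<Sum>s\<in>T. F s) = (\<Sum>s\<in>?Tp. F s) + (\<Sum>s\<in>?Tz. F s)"
    for F :: "_ \<Rightarrow> 'p dihedral_cohomology"
    using Suc.prems(1) by (subst sum.union_disjoint[symmetric]) (auto intro: sum.cong)
  have lower: "raise_head (lower_head s) = s" "lower_head s \<in> exponent_seqs" "seq_weight (lower_head s) < K"
    if s: "s \<in> ?Tp" for s
  proof -
    have S: "s \<in> exponent_seqs" "fst (hd s) \<noteq> 0" "seq_weight s < Suc K"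
      using s Suc.prems(2,3) by auto
    from S(1) obtain m e t where "s = (m, e) # t" "e = 0 \<or> e = 1" "t = [] \<or> t \<in> exponent_seqs"
      by (rule exponent_seqs_cases)
    with S show "raise_head (lower_head s) = s" "lower_head s \<in> exponent_seqs" "seq_weight (lower_head s) < K"
      by (auto simp: exponent_seqs_Cons)
  qed
  have positive: "c s = 0" if "s \<in> ?Tp" for s
  proof -
    have "0 = Theta (\<Sum>s\<in>T. cohomology_scale (c s) (nested s))"
      by (simp add: Suc.prems(4) Theta.zero)
    also have "\<dots> = (\<Sum>s\<in>T. cohomology_scale (c s) (Theta (nested s)))"
      by (simp add: Theta.sum additive_cohomology_scale[OF Theta.additive_axioms])
    also have "\<dots> = (\<Sum>s\<in>?Tp. cohomology_scale (c s) (Theta (nested s)))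
        + (\<Sum>s\<in>?Tz. cohomology_scale (c s) (Theta (nested s)))"
      by (rule split)
    also have "(\<Sum>s\<in>?Tz. cohomology_scale (c s) (Theta (nested s))) = 0"
    proof (rule sum.neutral, rule ballI)
      fix s assume s: "s \<in> ?Tz"
      then have "s \<in> exponent_seqs" using Suc.prems(2) by auto
      then obtain m e t where "s = (m, e) # t" by (rule exponent_seqs_cases)
      with s show "cohomology_scale (c s) (Theta (nested s)) = 0" by (simp add: Theta_head_0)
    qed
    also have "(\<Sum>s\<in>?Tp. cohomology_scale (c s) (Theta (nested s)))
        = (\<Sum>s\<in>?Tp. cohomology_scale (c (raise_head (lower_head s))) (nested (lower_head s)))"
    proof (rule sum.cong[OF refl])
      fix s assume "s \<in> ?Tp"
      from lower[OF this] show "cohomology_scale (c s) (Theta (nested s))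
        = cohomology_scale (c (raise_head (lower_head s))) (nested (lower_head s))"
        using Theta_raise[of "lower_head s"] by simp
    qed
    also have "\<dots> = (\<Sum>s\<in>lower_head ` ?Tp. cohomology_scale (c (raise_head s)) (nested s))"
      by (subst sum.reindex) (auto intro: inj_on_inverseI[of _ raise_head] lower(1))
    finally have 0: "(\<Sum>s\<in>lower_head ` ?Tp. cohomology_scale (c (raise_head s)) (nested s)) = 0"
      by simp
    have "\<forall>s\<in>lower_head ` ?Tp. c (raise_head s) = 0"
      by (rule Suc.IH[OF _ _ _ 0]) (use fin lower in auto)
    then show ?thesis using that lower(1) by force
  qed
  define T0 where "T0 = {t. (0, 0) # t \<in> T}"
  define T1 where "T1 = {t. (0, Suc 0) # t \<in> T}"
  have Tz: "?Tz = (#) (0, 0) ` T0 \<union> (#) (0, Suc 0) ` T1"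
  proof
    show "?Tz \<subseteq> (#) (0, 0) ` T0 \<union> (#) (0, Suc 0) ` T1"
    proof
      fix s assume s: "s \<in> ?Tz"
      then have "s \<in> exponent_seqs" using Suc.prems(2) by auto
      then obtain m e t where "s = (m, e) # t" "e = 0 \<or> e = 1" by (rule exponent_seqs_cases)
      with s show "s \<in> (#) (0, 0) ` T0 \<union> (#) (0, Suc 0) ` T1" by (auto simp: T0_def T1_def)
    qed
  qed (auto simp: T0_def T1_def)
  have finT: "finite T0" "finite T1"
    using fin(2) unfolding Tz by (auto dest: finite_imageD)
  let ?d0 = "\<lambda>t. c ((0, 0) # t)" and ?d1 = "\<lambda>t. c ((0, Suc 0) # t)"
  have "(\<Sum>s\<in>?Tp. cohomology_scale (c s) (nested s)) = 0"
    by (rule sum.neutral) (simp add: positive)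
  then have "0 = (\<Sum>s\<in>?Tz. cohomology_scale (c s) (nested s))"
    using Suc.prems(4) by (simp add: split)
  also have "\<dots> = (\<Sum>t\<in>T0. cohomology_scale (?d0 t) (tail t)) + B \<smile> (\<Sum>t\<in>T1. cohomology_scale (?d1 t) (tail t))"
    unfolding Tz
    by (subst sum.union_disjoint)
      (auto simp: finT sum.reindex nested_head_0 cup.sum additive_cohomology_scale[OF cup.additive_axioms])
  finally have "cohomology_scale (if [] \<in> T0 then ?d0 [] else 0) 1
      + cohomology_P (\<Sum>t\<in>T0 - {[]}. cohomology_scale (?d0 t) (nested t))
      + B \<smile> (cohomology_scale (if [] \<in> T1 then ?d1 [] else 0) 1
      + cohomology_P (\<Sum>t\<in>T1 - {[]}. cohomology_scale (?d1 t) (nested t))) = 0"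
    by (simp add: tail_sum finT)
  from kernel_zero[OF this] have
    n: "[] \<in> T0 \<Longrightarrow> ?d0 [] = 0" "[] \<in> T1 \<Longrightarrow> ?d1 [] = 0" and
    z: "(\<Sum>t\<in>T0 - {[]}. cohomology_scale (?d0 t) (nested t)) = 0"
      "(\<Sum>t\<in>T1 - {[]}. cohomology_scale (?d1 t) (nested t)) = 0"
    by (auto split: if_splits)
  have sub: "t \<in> exponent_seqs \<and> seq_weight t < K" if "t \<in> T0 - {[]} \<or> t \<in> T1 - {[]}"
    for t
    using that Suc.prems(2) Suc.prems(3)[of "(0, 0) # t"] Suc.prems(3)[of "(0, Suc 0) # t"]
    by (auto simp: T0_def T1_def exponent_seqs_Cons)
  have "\<forall>t\<in>T0 - {[]}. ?d0 t = 0" by (rule Suc.IH[OF _ _ _ z(1)]) (use finT sub in auto)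
  moreover have "\<forall>t\<in>T1 - {[]}. ?d1 t = 0"
    by (rule Suc.IH[OF _ _ _ z(2)]) (use finT sub in auto)
  ultimately have "c s = 0" if "s \<in> ?Tz" for s
    using that n unfolding Tz by blast
  with positive show ?case by blast
qed

lemma nested_relation:
  assumes "finite T" "T \<subseteq> exponent_seqs" "(\<Sum>s\<in>T. cohomology_scale (c s) (nested s)) = 0" "s \<in> T"
  shows "c s = 0"
proof -
  have "seq_weight s < Suc (\<Sum>s\<in>T. seq_weight s)" if "s \<in> T" for s
    using member_le_sum[OF that, of seq_weight] assms(1) by simp
  from nested_relation_trivial[OF assms(1,2) this assms(3)] show ?thesis using assms(4) by blast
qed

lemma nested_inj: "inj_on nested exponent_seqs"
proof (rule inj_onI, rule ccontr)
  fix s s' assume s: "s \<in> exponent_seqs" "s' \<in> exponent_seqs" "nested s = nested s'" "s \<noteq> s'"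
  have "(if s = s then 1 else - 1 :: 'p mod_ring) = 0"
    by (rule nested_relation[of "{s, s'}" "\<lambda>t. if t = s then 1 else - 1"])
      (use s in \<open>auto simp: cohomology.scale_minus_left\<close>)
  then show False by simp
qed

lemma nested_independent: "cohomology.independent (nested ` exponent_seqs)"
proof
  assume "cohomology.dependent (nested ` exponent_seqs)"
  then obtain U u v where U: "finite U" "U \<subseteq> nested ` exponent_seqs"
    "(\<Sum>v\<in>U. cohomology_scale (u v) v) = 0" "v \<in> U" "u v \<noteq> 0"
    unfolding cohomology.dependent_explicit by blast
  from U(2) obtain T where T: "T \<subseteq> exponent_seqs" "inj_on nested T" "U = nested ` T"
    unfolding subset_image_inj by blast
  from U(4) T(3) obtain s where s: "s \<in> T" "v = nested s" by blast
  have "u (nested s) = 0"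
  proof (rule nested_relation[OF _ T(1) _ s(1), of "\<lambda>s. u (nested s)"])
    show "finite T" using U(1) T(2,3) by (simp add: finite_image_iff)
    show "(\<Sum>s\<in>T. cohomology_scale (u (nested s)) (nested s)) = 0"
      using U(3) unfolding T(3) by (simp add: sum.reindex T(2))
  qed
  with U(5) s(2) show False by simp
qed

end

theorem theorem1:
  assumes "odd CARD('p::prime_card)"
  shows "\<exists>(A :: nat \<Rightarrow> ('p mod_ring, 'p mod_ring) rack_cohomology) B.
    A 0 = 1 \<and> (\<forall>m. A m \<in> cohomology_in_degree (2 * m)) \<and> B \<in> cohomology_in_degree 3 \<and>
    (let S = {s :: (nat \<times> nat) list. s \<noteq> [] \<and> (\<forall>(m, e)\<in>set s. e \<in> {0, 1})} in
      inj_on (nested_product A B) S \<and>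
      cohomology.independent (nested_product A B ` S) \<and>
      cohomology.span (nested_product A B ` S) = UNIV)"
proof -
  have "\<exists>A. \<forall>m. ((A m :: 'p dihedral_cohomology) \<in> cohomology_in_degree (2 * m) \<and> (m = 0 \<longrightarrow> A m = 1))
      \<and> Theta (A (Suc m)) = A m"
  proof (rule dependent_nat_choice)
    show "\<exists>x :: 'p dihedral_cohomology. x \<in> cohomology_in_degree (2 * 0) \<and> (0 = 0 \<longrightarrow> x = 1)"
      using in_degree_one by auto
    show "\<exists>y. (y \<in> cohomology_in_degree (2 * Suc m) \<and> (Suc m = 0 \<longrightarrow> y = 1)) \<and> Theta y = x"
      if "x \<in> cohomology_in_degree (2 * m) \<and> (m = 0 \<longrightarrow> x = 1)" for x :: "'p dihedral_cohomology" and m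
      using Theta_surj[OF assms, of x "2 * m"] that by auto
  qed
  then obtain A :: "nat \<Rightarrow> 'p dihedral_cohomology" where
    *: "\<And>m. (A m \<in> cohomology_in_degree (2 * m) \<and> (m = 0 \<longrightarrow> A m = 1)) \<and> Theta (A (Suc m)) = A m" by metis
  then have A: "A 0 = 1" "\<And>m. A m \<in> cohomology_in_degree (2 * m)" "\<And>m. Theta (A (Suc m)) = A m"
    by auto
  obtain B :: "'p dihedral_cohomology" where
    B: "B \<in> cohomology_in_degree 3" "Theta B = 0" "kernel_generator B"
    using kernel_generator_exists[OF assms] by blast
  note basis = nested_inj[OF assms A B] nested_independent[OF assms A B] nested_span[OF assms A B]
  show ?thesis
    unfolding exponent_seqs_def[symmetric] Let_def
    by (intro exI[of _ A] exI[of _ B] conjI allI A(1,2) B(1) basis)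
qed

end
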